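(* Let $\Omega\subset\mathbb{R}^n$ be a bounded open set, let $L:\mathbb{R}^n\times\mathbb{R}^n\to\mathbb{R}$ be a Tonelli Lagrangian with associated Tonelli Hamiltonian $H$, and let $u:\overline{\Omega}\to\mathbb{R}$ be a Lipschitz and semiconcave (viscosity) solution of $$H(x,Du(x))=0,\quad x\in\Omega,$$ satisfying, for some constants $C_0,C_1,C_2>0$, $|u|\leqslant C_0$ on $\overline{\Omega}$, $|Du|\leqslant C_1$ (at points of differentiability) and $D^2u\leqslant C_2 I_n$ (i.e. $u$ has semiconcavity constant $C_2$). Let $\{u_m\}_{m\geqslant 1}$ be any sequence of $C^\infty$ functions on $\overline{\Omega}$ with $$|u_m(z)|\leqslant C_0,\quad |Du_m(z)|\leqslant C_1,\quad D^2u_m(z)\leqslant C_2I_n,\qquad \forall z\in\overline{\Omega},$$ converging uniformly to $u$ on $\overline{\Omega}$ as $m\to\infty$. Let $x\in\Omega$ be a singular point of $u$, and let $t_0>0$ be (sufficiently small) as described in the context. Let $y:[0,t_0]\to\overline{\Omega}$ be the intrinsic singular characteristic of $u$ starting from $x$, i.e. $$y(0)=x,\qquad y(t)=\arg\max_{z}\{u(z)-A_t(x,z)\}\ \text{ for } t\in(0,t_0],$$ and let $y_m:[0,t_0]\to\overline{\Omega}$ be the curves $$y_m(0)=x,\qquad y_m(t)=\arg\max_{z}\{u_m(z)-A_t(x,z)\}\ \text{ for } t\in(0,t_0].$$ Then $\{y_m\}$ converges to $y$ uniformly on $[0,t_0]$ as $m\to\infty$, and $y$ is Lipschitz continuous on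 $[0,t_0]$.
   Context: Tonelli Lagrangian: $L=L(x,v)$ is of class $C^2$, $L(x,\cdot)$ is strictly convex for every $x$ (in the sense that $L_{vv}(x,v)$ is positive definite for all $(x,v)$), and $L$ is uniformly superlinear in $v$ (for every $K\geqslant0$ there is $C_K\in\mathbb{R}$ with $L(x,v)\geqslant K|v|-C_K$ for all $(x,v)$). The associated Tonelli Hamiltonian is $H(x,p)=\sup_{v\in\mathbb{R}^n}\{\langle p,v\rangle-L(x,v)\}$. Semiconcavity: a function $u$ is semiconcave with constant $C$ if $\lambda u(a)+(1-\lambda)u(b)-u(\lambda a+(1-\lambda)b)\leqslant\frac C2\lambda(1-\lambda)|a-b|^2$ for all $\lambda\in[0,1]$ and all $a,b$ such that the segment $[a,b]$ lies in the domain. The superdifferential is $D^+u(x)=\{p\in\mathbb{R}^n:\limsup_{z\to x}\frac{u(z)-u(x)-\langle p,z-x\rangle}{|z-x|}\leqslant0\}$. A point $x\in\Omega$ is a singular point of a semiconcave function $u$ (written $x\in\mathrm{Sing}(u)$) if $D^+u(x)$ is not a singleton. Fundamental solution: for $x,z\in\mathbb{R}^n$ and $t>0$, $$A_t(x,z)=\inf_{\xi}\int_0^tL(\xi(s),\dot\xi(s))\,ds,$$ the infimum being over all absolutely continuous curves $\xi:[0,t]\to\mathbb{R}^n$ with $\xi(0)=x$, $\xi(t)=z$. Choice of $t_0$: there are $\lambda>0$, $C_3>0$ and $t_0>0$ (with $t_0$ small) such that for every $t\in(0,t_0]$: the closed ball $\overline{B}(x,\lambda t)$ is contained in $\Omega$;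 $(t,z)\mapsto A_t(x,z)$ is of class $C^2$ on $\{(t,z):0<t<t_\lambda,\ |z-x|<\lambda t\}$ for some $t_\lambda>t_0$; $A_t(x,\cdot)$ is uniformly convex on $B(x,\lambda t)$ in the sense that $A_t(x,z')\geqslant A_t(x,z)+\langle D_zA_t(x,z),z'-z\rangle+\frac{C_3}{t}|z'-z|^2$; $C_2-C_3/t<0$ (so that $u(\cdot)-A_t(x,\cdot)$ and every $u_m(\cdot)-A_t(x,\cdot)$ are strictly concave on $B(x,\lambda t)$); and each of the functions $u(\cdot)-A_t(x,\cdot)$ and $u_m(\cdot)-A_t(x,\cdot)$, $m\geqslant1$, on $\overline{\Omega}$ attains its maximum at a unique point, which lies in $B(x,\lambda t)$. Thus the curves $y$ and $y_m$ are well defined on $[0,t_0]$. *)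

theory Defs
  imports "HOL-Analysis.Analysis"
begin

text \<open>
  \<open>C_ext k U S f\<close>, for \<open>U\<close> open and \<open>U \<subseteq> S \<subseteq> closure U\<close>: \<open>f\<close> is of class $C^k$ on \<open>U\<close> and all
  derivatives up to order \<open>k\<close> (order zero included) extend continuously to \<open>S\<close>.  The values of
  \<open>f'\<close> on \<open>S - U\<close> are those of this extension.
\<close>

primrec C_ext :: "nat \<Rightarrow> 'a::euclidean_space set \<Rightarrow> 'a set \<Rightarrow> ('a \<Rightarrow> 'b::euclidean_space) \<Rightarrow> bool" where
  "C_ext 0 U S f \<longleftrightarrow> continuous_on S f"
| "C_ext (Suc k) U S f \<longleftrightarrow> continuous_on S f \<and>
     (\<exists>f'. (\<forall>x\<in>U. (f has_derivative f' x) (at x)) \<and> (\<forall>v. C_ext k U S (\<lambda>x. f' x v)))"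

definition C_on :: "nat \<Rightarrow> 'a::euclidean_space set \<Rightarrow> ('a \<Rightarrow> 'b::euclidean_space) \<Rightarrow> bool" where
  "C_on k U f \<longleftrightarrow> C_ext k U U f"

definition smooth_on_closure :: "'a::euclidean_space set \<Rightarrow> ('a \<Rightarrow> 'b::euclidean_space) \<Rightarrow> bool" where
  "smooth_on_closure U f \<longleftrightarrow> (\<forall>k. C_ext k U (closure U) f)"

definition has_hessian :: "(real^'n \<Rightarrow> real) \<Rightarrow> real^'n^'n \<Rightarrow> real^'n \<Rightarrow> bool" where
  "has_hessian f M v \<longleftrightarrow>
     (\<exists>g. (\<forall>\<^sub>F w in nhds v. GDERIV f w :> g w) \<and> (g has_derivative (\<lambda>h. M *v h)) (at v))"

definition tonelli_lagrangian :: "(real^'n \<Rightarrow> real^'n \<Rightarrow> real) \<Rightarrow> bool" where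
  "tonelli_lagrangian L \<longleftrightarrow>
     C_on 2 UNIV (\<lambda>(x, v). L x v) \<and>
     (\<forall>x v. \<exists>M. has_hessian (L x) M v \<and> (\<forall>h. h \<noteq> 0 \<longrightarrow> h \<bullet> (M *v h) > 0)) \<and>
     (\<forall>K\<ge>0. \<exists>C. \<forall>x v. L x v \<ge> K * norm v - C)"

text \<open>The supremum is over a set that is bounded above when \<open>L\<close> is superlinear.\<close>

definition hamiltonian :: "(real^'n \<Rightarrow> real^'n \<Rightarrow> real) \<Rightarrow> real^'n \<Rightarrow> real^'n \<Rightarrow> real" where
  "hamiltonian L x p = (SUP v. p \<bullet> v - L x v)"

definition semiconcave_on :: "'a::euclidean_space set \<Rightarrow> real \<Rightarrow> ('a \<Rightarrow> real) \<Rightarrow> bool" where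
  "semiconcave_on S C u \<longleftrightarrow>
     (\<forall>l\<in>{0..1}. \<forall>a b. closed_segment a b \<subseteq> S \<longrightarrow>
        l * u a + (1 - l) * u b - u (l *\<^sub>R a + (1 - l) *\<^sub>R b)
          \<le> C / 2 * l * (1 - l) * (norm (a - b))\<^sup>2)"

text \<open>The semidifferentials are used only at interior points of the domain of \<open>u\<close>.\<close>

definition superdifferential :: "('a::euclidean_space \<Rightarrow> real) \<Rightarrow> 'a \<Rightarrow> 'a set" where
  "superdifferential u x =
     {p. Limsup (at x) (\<lambda>z. ereal ((u z - u x - p \<bullet> (z - x)) / norm (z - x))) \<le> 0}"

definition subdifferential :: "('a::euclidean_space \<Rightarrow> real) \<Rightarrow> 'a \<Rightarrow> 'a set" where
  "subdifferential u x =
     {p. Liminf (at x) (\<lambda>z. ereal ((u z - u x - p \<bullet> (z - x)) / norm (z - x))) \<ge> 0}"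

definition Sing :: "'a::euclidean_space set \<Rightarrow> ('a \<Rightarrow> real) \<Rightarrow> 'a set" where
  "Sing \<Omega> u = {x \<in> \<Omega>. \<not> is_singleton (superdifferential u x)}"

definition viscosity_solution ::
    "('a::euclidean_space \<Rightarrow> 'a \<Rightarrow> real) \<Rightarrow> 'a set \<Rightarrow> ('a \<Rightarrow> real) \<Rightarrow> bool" where
  "viscosity_solution H \<Omega> u \<longleftrightarrow>
     continuous_on \<Omega> u \<and>
     (\<forall>x\<in>\<Omega>. (\<forall>p\<in>superdifferential u x. H x p \<le> 0) \<and>
             (\<forall>p\<in>subdifferential u x. H x p \<ge> 0))"

definition absolutely_continuous_curve ::
    "real \<Rightarrow> real \<Rightarrow> (real \<Rightarrow> 'a::real_normed_vector) \<Rightarrow> bool" where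
  "absolutely_continuous_curve a b \<xi> \<longleftrightarrow>
     (\<forall>\<epsilon>>0. \<exists>\<delta>>0. \<forall>(k::nat) c d.
        (\<forall>i<k. a \<le> c i \<and> c i \<le> d i \<and> d i \<le> b) \<longrightarrow>
        disjoint_family_on (\<lambda>i. {c i<..<d i}) {..<k} \<longrightarrow>
        (\<Sum>i<k. d i - c i) < \<delta> \<longrightarrow>
        (\<Sum>i<k. norm (\<xi> (d i) - \<xi> (c i))) < \<epsilon>)"

text \<open>
  A Tonelli Lagrangian is bounded below, so the action of an absolutely continuous curve is either
  finite or \<open>+\<infinity>\<close>; the curves of infinite action, which do not affect the infimum, are those whose
  running cost is not integrable, and they are left out of the set.  The set is nonempty for
  \<open>t > 0\<close>, as it contains the action of the segment.  The derivative of a curve exists almost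
  everywhere; its junk values on the exceptional null set are irrelevant.
\<close>

definition fundamental_solution ::
    "(real^'n \<Rightarrow> real^'n \<Rightarrow> real) \<Rightarrow> real \<Rightarrow> real^'n \<Rightarrow> real^'n \<Rightarrow> real" where
  "fundamental_solution L t x z =
     Inf {integral {0..t} (\<lambda>s. L (\<xi> s) (vector_derivative \<xi> (at s))) | \<xi>.
            absolutely_continuous_curve 0 t \<xi> \<and> \<xi> 0 = x \<and> \<xi> t = z \<and>
            (\<lambda>s. L (\<xi> s) (vector_derivative \<xi> (at s))) absolutely_integrable_on {0..t}}"

end

theory Submission
  imports Defs
begin

text \<open>
  Write \<open>F (t, z) = A t x z\<close> and \<open>z = y t\<close>.  Maximality of \<open>z\<close> and semiconcavity of \<open>u\<close> give
  \<open>u a - u z \<le> p \<bullet> (a - z) + C\<^sub>2 / 2 * |a - z|^2\<close> with \<open>p = F\<^sub>z (t, z)\<close>, so \<open>z\<close> is a maximum with a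
  quadratic gap that is uniform in \<open>t\<close>; this yields the uniform convergence.

  For the Lipschitz bound the same inequality, used at \<open>t\<close> and at \<open>s\<close>, gives for
  \<open>\<Delta> = y s - y t\<close> and \<open>r = s - t\<close>
  \<open>D(\<Delta>, \<Delta>) \<le> C\<^sub>2 |\<Delta>|^2 - r F\<^sub>t\<^sub>z \<bullet> \<Delta> + o(r^2)\<close>, where \<open>D = F\<^sub>z\<^sub>z \<ge> 2 C\<^sub>3 / t\<close>.  The mixed derivative has to be
  controlled as \<open>t\<close> tends to \<open>0\<close>.  Differentiating the Hamilton--Jacobi equation yields
  \<open>F\<^sub>t\<^sub>z = L\<^sub>x - D V\<close> and \<open>F\<^sub>t\<^sub>t = D(V, V) - L\<^sub>x \<bullet> V\<close> with a bounded velocity \<open>V\<close>, and by Cauchy--Schwarz for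
  \<open>D\<close> it suffices that \<open>D(V, V) \<le> C / t\<close>, that is, \<open>F\<^sub>t\<^sub>t \<le> C / t\<close>.  This semiconcavity in time follows
  by cutting a nearly minimizing curve into many short pieces and stretching or compressing in time
  those of bounded average speed, replaced by segments.  No minimizer is needed, but lower bounds for the
  action of arbitrary absolutely continuous curves are, and these rest on the fundamental theorem of
  calculus for such curves.
\<close>

section \<open>Almost everywhere differentiability of monotone functions\<close>

text \<open>The obstacle is the vertex \<open>(0, x)\<close> of the cone on which \<open>F\<close>
  is of class C2: \<open>D\<close> grows there at least like \<open>1 / t\<close> and is bounded
  from below only, so compactness gives no control of the mixed derivative that is uniform in
  \<open>t\<close>. Cauchy-Schwarz in the form \<open>D\<close> asks for no upper bound on
  \<open>D\<close> but for the single value \<open>D(V, V)\<close>, and a bound of order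
  \<open>1 / t\<close> on it is balanced by the lower bound on \<open>D\<close>. The velocity
  \<open>V\<close> solves \<open>Lv z V = p\<close>; superlinearity bounds it once \<open>p\<close>
  is bounded, and \<open>p\<close> is bounded because \<open>u\<close> is Lipschitz. The order
  \<open>1 / t\<close> is what a change of time yields: a piece of duration \<open>d\<close> and
  velocity \<open>w\<close> costs about \<open>d L(q, w)\<close>, and after stretching
  \<open>d (1 + r) L(q, w / (1 + r))\<close>, whose symmetric second difference is
  \<open>O(d r^2)\<close>; with \<open>r\<close> of order \<open>h / t\<close> the pieces add up to
  \<open>t (h / t)^2 = h^2 / t\<close>. All expansions are made at a fixed \<open>t\<close>, in a
  neighbourhood that depends on \<open>t\<close> but with a constant that does not; on an interval
  this is enough.\<close>

lemma emeasure_interval_measure_UN_Icc: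
  fixes f :: "real \<Rightarrow> real" and C :: "(real \<times> real) set"
  assumes f: "mono f" "continuous_on UNIV f" and C: "countable C" "\<And>i. i \<in> C \<Longrightarrow> fst i \<le> snd i"
    and disj: "disjoint_family_on (\<lambda>i. {fst i..snd i}) C"
  shows "emeasure (interval_measure f) (\<Union>i\<in>C. {fst i..snd i})
       = (\<integral>\<^sup>+i. ennreal (f (snd i) - f (fst i)) \<partial>count_space C)"
proof -
  have "emeasure (interval_measure f) (\<Union>i\<in>C. {fst i..snd i})
      = (\<integral>\<^sup>+i. emeasure (interval_measure f) {fst i..snd i} \<partial>count_space C)"
    by (rule emeasure_UN_countable) (use C disj in auto)
  also have "\<dots> = (\<integral>\<^sup>+i. ennreal (f (snd i) - f (fst i)) \<partial>count_space C)"
    by (intro nn_integral_cong emeasure_interval_measure_Icc)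
       (use C f in \<open>auto simp: mono_def\<close>)
  finally show ?thesis .
qed

text \<open>The short intervals of slope at most \<alpha> around the points of \<open>S\<close> form
  a Vitali cover, so disjoint ones exhaust \<open>S\<close> up to a null set, and the Stieltjes
  measure of their union is estimated interval by interval. The intervals are open so that
  \<open>W\<close> can serve as the open set \<open>U\<close> of
  \<open>Vitali_slope_ge\<close>.\<close>

lemma Vitali_slope_le:
  fixes f :: "real \<Rightarrow> real"
  assumes f: "mono f" "continuous_on UNIV f" and U: "open U" "S \<subseteq> U" and \<alpha>: "0 \<le> \<alpha>"
    and S: "\<And>x d. x \<in> S \<Longrightarrow> 0 < d \<Longrightarrow> \<exists>u v. u < x \<and> x < v \<and> v - u < d \<and> f v - f u \<le> \<alpha> * (v - u)"
  obtains W where "open W" "W \<subseteq> U" "negligible (S - W)"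
    "emeasure (interval_measure f) W \<le> ennreal \<alpha> * emeasure lborel U"
proof -
  define K where "K = {(u, v). u < v \<and> {u<..<v} \<subseteq> U \<and> f v - f u \<le> \<alpha> * (v - u)}"
  let ?a = "\<lambda>i::real\<times>real. (fst i + snd i) / 2" and ?r = "\<lambda>i::real\<times>real. (snd i - fst i) / 2"
  have ball: "ball (?a i) (?r i) = {fst i<..<snd i}" for i
    by (auto simp: dist_real_def field_simps abs_less_iff)
  have "\<exists>i. i \<in> K \<and> x \<in> ball (?a i) (?r i) \<and> ?r i < d" if xd: "x \<in> S" "0 < d" for x d
  proof -
    obtain e where e: "e > 0" "ball x e \<subseteq> U"
      using U xd unfolding open_contains_ball by blast
    obtain u v where uv: "u < x" "x < v" "v - u < min d e" "f v - f u \<le> \<alpha> * (v - u)"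
      using S[of x "min d e"] xd e by auto
    have "{u<..<v} \<subseteq> ball x e"
      using uv by (auto simp: dist_real_def)
    then have "(u, v) \<in> K"
      using uv e by (auto simp: K_def)
    then show ?thesis
      using uv that unfolding ball by (intro exI[of _ "(u,v)"]) auto
  qed
  then obtain C where C: "countable C" "C \<subseteq> K"
     "pairwise (\<lambda>i j. disjnt (ball (?a i) (?r i)) (ball (?a j) (?r j))) C"
     "negligible (S - (\<Union>i \<in> C. ball (?a i) (?r i)))"
    using Vitali_covering_theorem_balls[of S K ?a ?r] by blast
  let ?W = "\<Union>i \<in> C. {fst i<..<snd i}"
  have disj: "disjoint_family_on (\<lambda>i. {fst i<..<snd i}) C"
    using C(3) unfolding ball pairwise_def disjnt_def disjoint_family_on_def by blast
  have "emeasure (interval_measure f) ?W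
      = (\<integral>\<^sup>+i. emeasure (interval_measure f) {fst i<..<snd i} \<partial>count_space C)"
    by (rule emeasure_UN_countable) (use C disj in auto)
  also have "\<dots> \<le> (\<integral>\<^sup>+i. ennreal \<alpha> * emeasure lborel {fst i<..<snd i} \<partial>count_space C)"
  proof (rule nn_integral_mono)
    fix i assume "i \<in> space (count_space C)"
    then have i: "fst i < snd i" "f (snd i) - f (fst i) \<le> \<alpha> * (snd i - fst i)"
      using C(2) by (auto simp: K_def)
    have "emeasure (interval_measure f) {fst i<..<snd i} \<le> emeasure (interval_measure f) {fst i..snd i}"
      by (rule emeasure_mono) auto
    also have "\<dots> = ennreal (f (snd i) - f (fst i))"
      by (rule emeasure_interval_measure_Icc) (use i f in \<open>auto simp: mono_def\<close>)
    also have "\<dots> \<le> ennreal (\<alpha> * (snd i - fst i))"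
      using i by (intro ennreal_leI)
    also have "\<dots> = ennreal \<alpha> * emeasure lborel {fst i<..<snd i}"
      using i \<alpha> by (simp add: ennreal_mult)
    finally show "emeasure (interval_measure f) {fst i<..<snd i} \<le> \<dots>" .
  qed
  also have "\<dots> = ennreal \<alpha> * (\<integral>\<^sup>+i. emeasure lborel {fst i<..<snd i} \<partial>count_space C)"
    by (rule nn_integral_cmult) auto
  also have "(\<integral>\<^sup>+i. emeasure lborel {fst i<..<snd i} \<partial>count_space C) = emeasure lborel ?W"
    by (rule emeasure_UN_countable[symmetric]) (use C disj in auto)
  also have "ennreal \<alpha> * emeasure lborel ?W \<le> ennreal \<alpha> * emeasure lborel U"
    by (intro mult_left_mono emeasure_mono) (use C(2) U in \<open>force simp: K_def\<close>)+
  finally have le: "emeasure (interval_measure f) ?W \<le> ennreal \<alpha> * emeasure lborel U" .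
  show thesis
  proof
    show "open ?W" by auto
    show "?W \<subseteq> U" using C(2) by (force simp: K_def)
    show "negligible (S - ?W)" using C(4) unfolding ball .
  qed (rule le)
qed

text \<open>The same covering argument from the other side. The intervals are closed here: their
  Stieltjes measure is exactly \<open>f v - f u\<close>, which a lower bound can use
  directly.\<close>

lemma Vitali_slope_ge:
  fixes f :: "real \<Rightarrow> real"
  assumes f: "mono f" "continuous_on UNIV f" and U: "open U" "S \<subseteq> U" and \<beta>: "0 \<le> \<beta>"
    and S: "\<And>x d. x \<in> S \<Longrightarrow> 0 < d \<Longrightarrow> \<exists>u v. u < x \<and> x < v \<and> v - u < d \<and> \<beta> * (v - u) \<le> f v - f u"
  obtains W where "W \<in> sets borel" "W \<subseteq> U" "negligible (S - W)"
    "ennreal \<beta> * emeasure lborel W \<le> emeasure (interval_measure f) W"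
proof -
  define K where "K = {(u, v). u < v \<and> {u..v} \<subseteq> U \<and> \<beta> * (v - u) \<le> f v - f u}"
  let ?a = "\<lambda>i::real\<times>real. (fst i + snd i) / 2" and ?r = "\<lambda>i::real\<times>real. (snd i - fst i) / 2"
  have ball: "cball (?a i) (?r i) = {fst i..snd i}" for i
    by (auto simp: dist_real_def field_simps abs_le_iff)
  have cov: "\<exists>i. i \<in> K \<and> x \<in> cball (?a i) (?r i) \<and> ?r i < d" if xd: "x \<in> S" "0 < d" for x d
  proof -
    obtain e where e: "e > 0" "ball x e \<subseteq> U"
      using U xd unfolding open_contains_ball by blast
    obtain u v where uv: "u < x" "x < v" "v - u < min d e" "\<beta> * (v - u) \<le> f v - f u"
      using S[of x "min d e"] xd e by auto
    have "{u..v} \<subseteq> ball x e"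
      using uv by (auto simp: dist_real_def)
    then have "(u, v) \<in> K"
      using uv e by (auto simp: K_def)
    then show ?thesis
      using uv that unfolding ball by (intro exI[of _ "(u,v)"]) auto
  qed
  have r0: "0 < ?r i" if "i \<in> K" for i
    using that by (auto simp: K_def)
  obtain C where C: "countable C" "C \<subseteq> K"
     "pairwise (\<lambda>i j. disjnt (cball (?a i) (?r i)) (cball (?a j) (?r j))) C"
     "negligible (S - (\<Union>i \<in> C. cball (?a i) (?r i)))"
    by (rule Vitali_covering_theorem_cballs[of K ?r S ?a, OF r0 cov])
  let ?W = "\<Union>i \<in> C. {fst i..snd i}"
  have disj: "disjoint_family_on (\<lambda>i. {fst i..snd i}) C"
    using C(3) unfolding ball pairwise_def disjnt_def disjoint_family_on_def by blast
  have le: "fst i \<le> snd i" "\<beta> * (snd i - fst i) \<le> f (snd i) - f (fst i)" if "i \<in> C" for i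
    using C(2) that by (auto simp: K_def)
  have "ennreal \<beta> * emeasure lborel ?W = ennreal \<beta> * (\<integral>\<^sup>+i. emeasure lborel {fst i..snd i} \<partial>count_space C)"
    by (subst emeasure_UN_countable) (use C disj in auto)
  also have "\<dots> = (\<integral>\<^sup>+i. ennreal \<beta> * emeasure lborel {fst i..snd i} \<partial>count_space C)"
    by (rule nn_integral_cmult[symmetric]) auto
  also have "\<dots> \<le> (\<integral>\<^sup>+i. ennreal (f (snd i) - f (fst i)) \<partial>count_space C)"
    by (rule nn_integral_mono) (use le \<beta> in \<open>auto simp: ennreal_mult[symmetric] intro!: ennreal_leI\<close>)
  also have "\<dots> = emeasure (interval_measure f) ?W"
    by (rule emeasure_interval_measure_UN_Icc[symmetric]) (use f C le disj in auto)
  finally have le: "ennreal \<beta> * emeasure lborel ?W \<le> emeasure (interval_measure f) ?W" .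
  show thesis
  proof
    show "?W \<in> sets borel" using C by auto
    show "?W \<subseteq> U" using C(2) by (force simp: K_def)
    show "negligible (S - ?W)" using C(4) unfolding ball .
  qed (rule le)
qed

text \<open>The infimum is the outer Lebesgue measure of \<open>S\<close>. It stands in for the
  measure because the sets of points with prescribed slopes are not known to be measurable.\<close>

lemma INF_open_le_emeasure:
  fixes S W :: "real set"
  assumes "W \<in> sets borel" "negligible (S - W)"
  shows "(INF U\<in>{U. open U \<and> S \<subseteq> U}. emeasure lborel U) \<le> emeasure lborel W"
proof (rule ennreal_le_epsilon)
  fix e :: real assume e: "e > 0"
  have null: "S - W \<in> null_sets lebesgue" 
    using assms negligible_iff_null_sets by auto
  then have meas: "W \<union> (S - W) \<in> sets lebesgue"
    using assms(1) by (intro sets.Un) auto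
  obtain T where T: "open T" "W \<union> (S - W) \<subseteq> T"
     "T - (W \<union> (S - W)) \<in> lmeasurable" "emeasure lebesgue (T - (W \<union> (S - W))) < ennreal e"
    using sets_lebesgue_outer_open[OF meas e] by metis
  have "emeasure lborel T = emeasure lebesgue ((W \<union> (S - W)) \<union> (T - (W \<union> (S - W))))"
    using T by (simp add: Un_absorb1)
  also have "\<dots> \<le> emeasure lebesgue (W \<union> (S - W)) + emeasure lebesgue (T - (W \<union> (S - W)))"
    by (rule emeasure_subadditive) (use meas T in auto)
  also have "emeasure lebesgue (W \<union> (S - W)) = emeasure lebesgue W"
    using null assms by (subst emeasure_Un_null_set) auto
  also have "emeasure lebesgue W = emeasure lborel W"
    using assms by simp
  finally have "emeasure lborel T \<le> emeasure lborel W + ennreal e"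
    using T(4) by (meson add_left_mono order.trans order_less_imp_le)
  moreover have "(INF U\<in>{U. open U \<and> S \<subseteq> U}. emeasure lborel U) \<le> emeasure lborel T"
    by (rule INF_lower) (use T in auto)
  ultimately show "(INF U\<in>{U. open U \<and> S \<subseteq> U}. emeasure lborel U) \<le> emeasure lborel W + ennreal e"
    by order
qed

lemma negligible_if_INF_open_eq_0:
  fixes S :: "real set"
  assumes "(INF U\<in>{U. open U \<and> S \<subseteq> U}. emeasure lborel U) = 0"
  shows "negligible S"
  unfolding negligible_outer
proof (intro allI impI)
  fix e :: real assume "e > 0"
  then have "(INF U\<in>{U. open U \<and> S \<subseteq> U}. emeasure lborel U) < ennreal e"
    using assms by simp
  then obtain U where U: "open U" "S \<subseteq> U" "emeasure lborel U < ennreal e"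
    unfolding INF_less_iff by auto
  then have "U \<in> lmeasurable"
    by (auto simp: fmeasurable_def intro: less_trans)
  moreover have "measure lebesgue U < e"
    using U \<open>e > 0\<close> by (simp add: measure_def enn2real_less_iff)
       (smt (verit) U(3) emeasure_lborel_cbox enn2real_ennreal enn2real_less_iff ennreal_less_top less_trans)
  ultimately show "\<exists>T. S \<subseteq> T \<and> T \<in> lmeasurable \<and> measure lebesgue T < e"
    using U by auto
qed


text \<open>Let \<open>m\<close> be the outer measure of \<open>S\<close>. Flat intervals inside an
  open \<open>U\<close>, and then steep intervals inside the union of the flat ones, give
  \<open>\<beta> * m \<le> \<alpha> * |U|\<close>. Letting \<open>U\<close> shrink to
  \<open>S\<close> gives \<open>\<beta> * m \<le> \<alpha> * m\<close>, which forces
  \<open>m = 0\<close>.\<close>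

lemma negligible_two_slopes:
  fixes f :: "real \<Rightarrow> real"
  assumes f: "mono f" "continuous_on UNIV f" and "bounded S" and \<alpha>\<beta>: "0 \<le> \<alpha>" "\<alpha> < \<beta>"
    and le: "\<And>x d. x \<in> S \<Longrightarrow> 0 < d \<Longrightarrow> \<exists>u v. u < x \<and> x < v \<and> v - u < d \<and> f v - f u \<le> \<alpha> * (v - u)"
    and ge: "\<And>x d. x \<in> S \<Longrightarrow> 0 < d \<Longrightarrow> \<exists>u v. u < x \<and> x < v \<and> v - u < d \<and> \<beta> * (v - u) \<le> f v - f u"
  shows "negligible S"
proof (rule negligible_if_INF_open_eq_0, rule ccontr)
  define m where "m = (INF U\<in>{U. open U \<and> S \<subseteq> U}. emeasure lborel U)"
  assume "m \<noteq> 0"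
  obtain R where R: "S \<subseteq> ball 0 R"
    using \<open>bounded S\<close> bounded_subset_ballD by blast
  have "m \<le> emeasure lborel (ball (0::real) R)"
    unfolding m_def by (rule INF_lower) (use R in auto)
  also have "\<dots> < \<infinity>"
    by (metis emeasure_bounded_finite bounded_ball infinity_ennreal_def)
  finally have "m < \<infinity>" .
  have key: "ennreal \<beta> * m \<le> ennreal \<alpha> * emeasure lborel U" if U: "open U" "S \<subseteq> U" for U
  proof -
    obtain W where W: "open W" "W \<subseteq> U" "negligible (S - W)"
        "emeasure (interval_measure f) W \<le> ennreal \<alpha> * emeasure lborel U"
      by (rule Vitali_slope_le[OF f U \<alpha>\<beta>(1) le])
    obtain W' where W': "W' \<in> sets borel" "W' \<subseteq> W" "negligible (S \<inter> W - W')"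
        "ennreal \<beta> * emeasure lborel W' \<le> emeasure (interval_measure f) W'"
      by (rule Vitali_slope_ge[OF f W(1), of "S \<inter> W" \<beta>]) (use ge \<alpha>\<beta> in auto)
    have "negligible (S - W')"
      by (rule negligible_subset[OF negligible_Un[OF W(3) W'(3)]]) auto
    then have "ennreal \<beta> * m \<le> ennreal \<beta> * emeasure lborel W'"
      unfolding m_def by (intro mult_left_mono INF_open_le_emeasure W') auto
    also have "\<dots> \<le> emeasure (interval_measure f) W'" by (rule W')
    also have "\<dots> \<le> emeasure (interval_measure f) W"
      by (rule emeasure_mono) (use W W' in auto)
    also have "\<dots> \<le> ennreal \<alpha> * emeasure lborel U" by (rule W)
    finally show ?thesis .
  qed
  obtain r where r: "m = ennreal r" "r > 0"
    using \<open>m \<noteq> 0\<close> \<open>m < \<infinity>\<close> by (cases m) (auto simp: order_less_le)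
  \<comment> \<open>Chosen so that \<open>\<alpha> * e < (\<beta> - \<alpha>) * r\<close>, which
    contradicts \<open>\<beta> * r \<le> \<alpha> * (r + e)\<close>; the \<open>+ 1\<close> covers
    \<open>\<alpha> = 0\<close>.\<close>
  define e where "e = (\<beta> - \<alpha>) * r / (\<alpha> + 1)"
  have e: "e > 0" using \<alpha>\<beta> r by (simp add: e_def)
  have "m < ennreal (r + e)"
    using r e by (simp add: ennreal_less_iff)
  then obtain U where U: "open U" "S \<subseteq> U" "emeasure lborel U < ennreal (r + e)"
    unfolding m_def INF_less_iff by auto
  have "ennreal (\<beta> * r) \<le> ennreal \<alpha> * emeasure lborel U"
    using key[OF U(1,2)] r \<alpha>\<beta> by (simp add: ennreal_mult)
  also have "\<dots> \<le> ennreal \<alpha> * ennreal (r + e)"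
    by (intro mult_left_mono) (use U in auto)
  also have "\<dots> = ennreal (\<alpha> * (r + e))"
    using \<alpha>\<beta> r e by (simp add: ennreal_mult)
  finally have "\<beta> * r \<le> \<alpha> * (r + e)"
    using \<alpha>\<beta> r e by (subst (asm) ennreal_le_iff) auto
  then have "(\<beta> - \<alpha>) * r \<le> \<alpha> * e" by (simp add: algebra_simps)
  also have "\<dots> < (\<alpha> + 1) * e" using e by simp
  also have "\<dots> = (\<beta> - \<alpha>) * r" using \<alpha>\<beta> by (simp add: e_def)
  finally show False by simp
qed

text \<open>Slopes \<open>n\<close> near every point of \<open>S\<close> force \<open>n\<close>
  times the outer measure of \<open>S\<close> below the total increase of \<open>f\<close> over a
  bounded interval, for every \<open>n\<close>.\<close>

lemma negligible_infinite_slope: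
  fixes f :: "real \<Rightarrow> real"
  assumes f: "mono f" "continuous_on UNIV f" and "bounded S"
    and ge: "\<And>n x d. x \<in> S \<Longrightarrow> 0 < d \<Longrightarrow> \<exists>u v. u < x \<and> x < v \<and> v - u < d \<and> real n * (v - u) \<le> f v - f u"
  shows "negligible S"
proof (rule negligible_if_INF_open_eq_0, rule ccontr)
  define m where "m = (INF U\<in>{U. open U \<and> S \<subseteq> U}. emeasure lborel U)"
  assume "m \<noteq> 0"
  obtain R where R: "S \<subseteq> ball 0 R" "R > 0"
    using \<open>bounded S\<close> bounded_subset_ballD by blast
  then have RI: "S \<subseteq> {-R<..<R}"
    by (auto simp: subset_eq dist_real_def)
  have "m \<le> emeasure lborel (ball (0::real) R)"
    unfolding m_def by (rule INF_lower) (use R in auto)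
  also have "\<dots> < \<infinity>"
    by (metis emeasure_bounded_finite bounded_ball infinity_ennreal_def)
  finally have "m < \<infinity>" .
  have key: "ennreal (real n) * m \<le> ennreal (f R - f (-R))" for n
  proof -
    obtain W where W: "W \<in> sets borel" "W \<subseteq> {-R<..<R}" "negligible (S - W)"
        "ennreal (real n) * emeasure lborel W \<le> emeasure (interval_measure f) W"
      using Vitali_slope_ge[OF f _ RI, of "real n"] ge by auto
    have "ennreal (real n) * m \<le> ennreal (real n) * emeasure lborel W"
      unfolding m_def by (intro mult_left_mono INF_open_le_emeasure W) auto
    also have "\<dots> \<le> emeasure (interval_measure f) W" by (rule W)
    also have "\<dots> \<le> emeasure (interval_measure f) {-R..R}"
      by (rule emeasure_mono) (use W in auto)
    also have "\<dots> = ennreal (f R - f (-R))"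
      by (rule emeasure_interval_measure_Icc) (use R f in \<open>auto simp: mono_def\<close>)
    finally show ?thesis .
  qed
  obtain r where r: "m = ennreal r" "r > 0"
    using \<open>m \<noteq> 0\<close> \<open>m < \<infinity>\<close> by (cases m) (auto simp: order_less_le)
  obtain n where n: "f R - f (-R) < real n * r"
    using r reals_Archimedean3 by blast
  have "f (-R) \<le> f R" using f(1) R by (auto simp: mono_def)
  moreover have "ennreal (real n * r) \<le> ennreal (f R - f (-R))"
    using key[of n] r by (simp add: ennreal_mult)
  ultimately show False using n
    by (subst (asm) ennreal_le_iff) auto
qed

text \<open>A Vitali interval contains the point in its interior, so the covering arguments only see
  increments across \<open>x\<close>. By continuity one endpoint may tend to \<open>x\<close>, which
  turns them into one-sided difference quotients.\<close>

lemma has_real_derivative_of_straddling_slopes: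
  fixes f :: "real \<Rightarrow> real"
  assumes cont: "isCont f x"
    and D: "\<And>e. e > 0 \<Longrightarrow> \<exists>d>0. \<forall>u v. u < x \<and> x < v \<and> v - u < d \<longrightarrow> \<bar>f v - f u - D * (v - u)\<bar> \<le> e * (v - u)"
  shows "(f has_real_derivative D) (at x)"
  unfolding has_field_derivative_def has_derivative_at_alt
proof (intro conjI allI impI)
  fix e :: real assume "e > 0"
  then obtain d where d: "d > 0" "\<And>u v. u < x \<Longrightarrow> x < v \<Longrightarrow> v - u < d \<Longrightarrow> \<bar>f v - f u - D * (v - u)\<bar> \<le> e * (v - u)"
    using D by metis
  have lim: "(f \<longlongrightarrow> f x) (at_left x)" "(f \<longlongrightarrow> f x) (at_right x)"
    using cont by (auto simp: isCont_def filterlim_at_split)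
  have right: "\<bar>f v - f x - D * (v - x)\<bar> \<le> e * (v - x)" if v: "x < v" "v - x < d" for v
  proof (rule tendsto_le[OF _ _ _])
    show "((\<lambda>u. \<bar>f v - f u - D * (v - u)\<bar>) \<longlongrightarrow> \<bar>f v - f x - D * (v - x)\<bar>) (at_left x)"
      by (intro tendsto_intros lim)
    show "((\<lambda>u. e * (v - u)) \<longlongrightarrow> e * (v - x)) (at_left x)"
      by (intro tendsto_intros)
    show "\<forall>\<^sub>F u in at_left x. \<bar>f v - f u - D * (v - u)\<bar> \<le> e * (v - u)"
      using eventually_at_left_real[of "v - d" x] v
      by (auto elim!: eventually_mono intro!: d)
  qed auto
  have left: "\<bar>f x - f u - D * (x - u)\<bar> \<le> e * (x - u)" if u: "u < x" "x - u < d" for u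
  proof (rule tendsto_le[OF _ _ _])
    show "((\<lambda>v. \<bar>f v - f u - D * (v - u)\<bar>) \<longlongrightarrow> \<bar>f x - f u - D * (x - u)\<bar>) (at_right x)"
      by (intro tendsto_intros lim)
    show "((\<lambda>v. e * (v - u)) \<longlongrightarrow> e * (x - u)) (at_right x)"
      by (intro tendsto_intros)
    show "\<forall>\<^sub>F v in at_right x. \<bar>f v - f u - D * (v - u)\<bar> \<le> e * (v - u)"
      using eventually_at_right_real[of x "u + d"] u
      by (auto elim!: eventually_mono intro!: d)
  qed auto
  have "norm (f y - f x - D * (y - x)) \<le> e * norm (y - x)" if "norm (y - x) < d" for y
  proof (cases y x rule: linorder_cases)
    case less
    then have "\<bar>f y - f x - D * (y - x)\<bar> = \<bar>f x - f y - D * (x - y)\<bar>"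
      by (simp add: algebra_simps abs_minus_commute)
    then show ?thesis using left[of y] that less by auto
  qed (use right[of y] that in auto)
  then show "\<exists>d>0. \<forall>y. norm (y - x) < d \<longrightarrow> norm (f y - f x - D * (y - x)) \<le> e * norm (y - x)"
    using d(1) by blast
qed (rule bounded_linear_mult_right)

lemma mono_imp_negligible_not_differentiable:
  fixes f :: "real \<Rightarrow> real"
  assumes f: "mono f" "continuous_on UNIV f"
  shows "negligible {x. \<not> f differentiable (at x)}"
proof -
  define up where "up \<beta> x \<longleftrightarrow> (\<forall>d>0. \<exists>u v. u < x \<and> x < v \<and> v - u < d \<and> \<beta> * (v - u) \<le> f v - f u)" for \<beta> x
  define lo where "lo \<alpha> x \<longleftrightarrow> (\<forall>d>0. \<exists>u v. u < x \<and> x < v \<and> v - u < d \<and> f v - f u \<le> \<alpha> * (v - u))" for \<alpha> x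
  define E where "E R \<alpha> \<beta> = {x\<in>ball 0 R. lo \<alpha> x \<and> up \<beta> x}" for R \<alpha> \<beta> :: real
  define I where "I R = {x\<in>ball 0 R. \<forall>n. up (real n) x}" for R :: real
  have negE: "negligible (E R \<alpha> \<beta>)" if "0 \<le> \<alpha>" "\<alpha> < \<beta>" for R \<alpha> \<beta>
    by (rule negligible_two_slopes[OF f _ that]) (auto simp: E_def lo_def up_def intro: bounded_subset[OF bounded_ball[of 0 R]])
  have negI: "negligible (I R)" for R
    by (rule negligible_infinite_slope[OF f]) (auto simp: I_def up_def intro: bounded_subset[OF bounded_ball[of 0 R]])
  \<comment> \<open>Outside \<open>N\<close> the slopes near \<open>x\<close> do not exceed every
    bound, and no pair of rationals separates recurrent flat slopes from recurrent steep ones.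
    Rational pairs keep the union countable; the radius \<open>n\<close> makes the sets
    bounded.\<close>
  define N where "N = (\<Union>n::nat. I n) \<union> (\<Union>n::nat. \<Union>p\<in>{(\<alpha>,\<beta>). \<alpha> \<in> \<rat> \<and> \<beta> \<in> \<rat> \<and> 0 \<le> \<alpha> \<and> \<alpha> < \<beta>}. E n (fst p) (snd p))"
  have "countable (\<rat> \<times> \<rat> :: (real \<times> real) set)"
    by (intro countable_SIGMA countable_rat)
  then have "countable {(\<alpha>::real,\<beta>::real). \<alpha> \<in> \<rat> \<and> \<beta> \<in> \<rat> \<and> 0 \<le> \<alpha> \<and> \<alpha> < \<beta>}"
    by (rule countable_subset[rotated]) auto
  then have negN: "negligible N"
    unfolding N_def by (intro negligible_Un negligible_countable_Union negligible_Union) (auto intro!: negI negE)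
  have "f differentiable (at x)" if xN: "x \<notin> N" for x
  proof -
    obtain n :: nat where n: "x \<in> ball 0 (real n)"
      using reals_Archimedean2[of "\<bar>x\<bar>"] by (auto simp: dist_real_def)
    obtain M where M: "\<not> up (real M) x"
      using xN n unfolding N_def I_def by blast
    have no: "\<not> lo \<alpha> x \<or> \<not> up \<beta> x" if "\<alpha> \<in> \<rat>" "\<beta> \<in> \<rat>" "0 \<le> \<alpha>" "\<alpha> < \<beta>" for \<alpha> \<beta>
      using \<open>x \<notin> N\<close> n that unfolding N_def E_def by fastforce
    have fle: "f u \<le> f v" if "u \<le> v" for u v
      using f that by (auto simp: mono_def)
    have up_mono: "up \<beta>' x" if "up \<beta> x" "\<beta>' \<le> \<beta>" for \<beta> \<beta>'
      using that unfolding up_def by (meson diff_gt_0_iff_gt less_imp_le mult_right_mono order.strict_trans order.trans)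
    have up0: "up 0 x"
      unfolding up_def
    proof (intro allI impI)
      fix d :: real assume "d > 0"
      then show "\<exists>u v. u < x \<and> x < v \<and> v - u < d \<and> 0 * (v - u) \<le> f v - f u"
        by (intro exI[of _ "x - d/3"] exI[of _ "x + d/3"]) (auto intro!: fle)
    qed
    \<comment> \<open>The upper derivative over straddling intervals; it is finite because
      \<open>up (real M) x\<close> fails.\<close>
    define D where "D = Sup {\<beta>. up \<beta> x}"
    have bdd: "bdd_above {\<beta>. up \<beta> x}"
      using M up_mono by (intro bdd_aboveI[of _ "real M"]) (meson linorder_le_cases mem_Collect_eq)
    have D0: "D \<ge> 0"
      unfolding D_def by (rule cSup_upper) (use up0 bdd in auto)
    have upD: "\<not> up \<beta> x" if "\<beta> > D" for \<beta>
      using that bdd unfolding D_def by (meson cSup_upper linorder_not_le mem_Collect_eq)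
    have loD: "\<not> lo \<alpha> x" if \<alpha>D: "\<alpha> < D" "0 \<le> \<alpha>" for \<alpha>
    proof -
      \<comment> \<open>Two rationals are inserted between \<alpha> and \<open>D\<close>, because
        \<open>N\<close> only excludes rational pairs: \<open>lo q x\<close> and
        \<open>up q' x\<close> cannot both hold.\<close>
      obtain q where q: "q \<in> \<rat>" "\<alpha> < q" "q < D" using Rats_dense_in_real[OF \<alpha>D(1)] by blast
      obtain q' where q': "q' \<in> \<rat>" "q < q'" "q' < D" using Rats_dense_in_real[OF q(3)] by blast
      obtain \<beta> where "up \<beta> x" "q' < \<beta>"
        using less_cSupD[of "{\<beta>. up \<beta> x}" q'] q'(3) up0 unfolding D_def by auto
      then have "up q' x" using up_mono by (meson less_imp_le)
      then have "\<not> lo q x" using no[of q q'] q q' \<alpha>D by auto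
      then show ?thesis
        unfolding lo_def using q(2) 
        by (meson diff_gt_0_iff_gt less_imp_le mult_right_mono order.strict_trans order.trans)
    qed
    have "(f has_real_derivative D) (at x)"
    proof (rule has_real_derivative_of_straddling_slopes)
      show "isCont f x" using f(2) continuous_on_eq_continuous_at by blast
      fix e :: real assume e: "e > 0"
      obtain d1 where d1: "d1 > 0" "\<And>u v. u < x \<Longrightarrow> x < v \<Longrightarrow> v - u < d1 \<Longrightarrow> f v - f u < (D + e) * (v - u)"
        using upD[of "D + e"] e unfolding up_def by force
      obtain d2 where d2: "d2 > 0" "\<And>u v. u < x \<Longrightarrow> x < v \<Longrightarrow> v - u < d2 \<Longrightarrow> (D - e) * (v - u) \<le> f v - f u"
      proof (cases "D - e \<ge> 0")
        case True
        then show ?thesis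
          using loD[of "D - e"] e that unfolding lo_def by (metis diff_less_eq less_add_same_cancel1 less_imp_le not_le)
      next
        case False
        \<comment> \<open>\<open>loD\<close> concerns nonnegative slopes only; a negative lower
          bound holds because \<open>f\<close> is monotone.\<close>
        have "(D - e) * (v - u) \<le> f v - f u" if "u < x" "x < v" for u v
          using False that fle[of u v] by (smt (verit) mult_nonpos_nonneg)
        then show ?thesis using that[of 1] by auto
      qed
      show "\<exists>d>0. \<forall>u v. u < x \<and> x < v \<and> v - u < d \<longrightarrow> \<bar>f v - f u - D * (v - u)\<bar> \<le> e * (v - u)"
      proof (intro exI[of _ "min d1 d2"] conjI allI impI; (elim conjE)?)
        fix u v assume "u < x" "x < v" "v - u < min d1 d2"
        then show "\<bar>f v - f u - D * (v - u)\<bar> \<le> e * (v - u)"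
          using d1(2)[of u v] d2(2)[of u v] by (simp add: algebra_simps abs_le_iff)
      qed (use d1 d2 in auto)
    qed
    then show ?thesis
      using real_differentiable_def by blast
  qed
  then have "{x. \<not> f differentiable (at x)} \<subseteq> N" by auto
  then show ?thesis using negN negligible_subset by blast
qed

section \<open>Absolutely continuous curves\<close>

lemma sum_disjoint_intervals_le_measure:
  fixes c d :: "'i \<Rightarrow> real"
  assumes "finite I" "\<And>i. i \<in> I \<Longrightarrow> c i \<le> d i" "disjoint_family_on (\<lambda>i. {c i<..<d i}) I"
    and U: "U \<in> lmeasurable" "\<And>i. i \<in> I \<Longrightarrow> {c i<..<d i} \<subseteq> U"
  shows "(\<Sum>i\<in>I. d i - c i) \<le> measure lebesgue U"
proof -
  have "(\<Sum>i\<in>I. d i - c i) = (\<Sum>i\<in>I. measure lebesgue {c i<..<d i})"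
    using assms(2) by (intro sum.cong) auto
  also have "\<dots> = measure lebesgue (\<Union>i\<in>I. {c i<..<d i})"
    by (rule measure_finite_Union[symmetric]) (use assms in auto)
  also have "\<dots> \<le> measure lebesgue U"
    by (rule measure_mono_fmeasurable) (use U assms(1) in auto)
  finally show ?thesis .
qed

text \<open>The families in the definition are indexed by initial segments of the naturals. Here
  they are reindexed, since the intervals of a tagged division are indexed by its point-interval
  pairs.\<close>

lemma absolutely_continuous_curveD:
  assumes "absolutely_continuous_curve a b \<xi>" "0 < \<epsilon>"
  obtains \<delta> where "\<delta> > 0" "\<forall>(I::'i set) c d. finite I \<longrightarrow> (\<forall>i\<in>I. a \<le> c i \<and> c i \<le> d i \<and> d i \<le> b) \<longrightarrow>
     disjoint_family_on (\<lambda>i. {c i<..<d i}) I \<longrightarrow> (\<Sum>i\<in>I. d i - c i) < \<delta> \<longrightarrow>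
     (\<Sum>i\<in>I. norm (\<xi> (d i) - \<xi> (c i))) < \<epsilon>"
proof -
  obtain \<delta> where \<delta>: "\<delta> > 0" "\<forall>(k::nat) c d. (\<forall>i<k. a \<le> c i \<and> c i \<le> d i \<and> d i \<le> b) \<longrightarrow>
        disjoint_family_on (\<lambda>i. {c i<..<d i}) {..<k} \<longrightarrow> (\<Sum>i<k. d i - c i) < \<delta> \<longrightarrow>
        (\<Sum>i<k. norm (\<xi> (d i) - \<xi> (c i))) < \<epsilon>"
    using assms(1)[unfolded absolutely_continuous_curve_def, THEN spec, THEN mp, OF assms(2)]
    by (elim exE conjE) (rule that)
  show thesis
  proof (rule that[OF \<delta>(1)], intro allI impI)
    fix I :: "'i set" and c d
    assume I: "finite I" "\<forall>i\<in>I. a \<le> c i \<and> c i \<le> d i \<and> d i \<le> b"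
     "disjoint_family_on (\<lambda>i. {c i<..<d i}) I" "(\<Sum>i\<in>I. d i - c i) < \<delta>"
    obtain h where h: "bij_betw h {..<card I} I"
      using ex_bij_betw_nat_finite[OF I(1)] by (auto simp: atLeast0LessThan)
    have eq: "(\<Sum>i<card I. F (h i)) = (\<Sum>i\<in>I. F i)" for F :: "'i \<Rightarrow> real"
      by (rule sum.reindex_bij_betw[OF h])
    have "h i \<in> I" if "i < card I" for i
      using h that by (auto simp: bij_betw_def)
    moreover have "disjoint_family_on (\<lambda>i. {(c \<circ> h) i<..<(d \<circ> h) i}) {..<card I}"
      using I(3) h unfolding disjoint_family_on_def bij_betw_def inj_on_def by (auto; metis IntI empty_iff greaterThanLessThan_iff imageI lessThan_iff)
    ultimately show "(\<Sum>i\<in>I. norm (\<xi> (d i) - \<xi> (c i))) < \<epsilon>"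
      using \<delta>(2)[rule_format, of "card I" "c \<circ> h" "d \<circ> h"] I eq[of "\<lambda>i. d i - c i"] eq[of "\<lambda>i. norm (\<xi> (d i) - \<xi> (c i))"]
      by auto
  qed
qed

lemma absolutely_continuous_curve_inner:
  assumes "absolutely_continuous_curve a b \<xi>"
  shows "absolutely_continuous_curve a b (\<lambda>s. \<xi> s \<bullet> v)"
  unfolding absolutely_continuous_curve_def
proof (intro allI impI)
  fix \<epsilon> :: real assume "\<epsilon> > 0"
  then have \<epsilon>': "\<epsilon> / (norm v + 1) > 0" by (simp add: add_nonneg_pos)
  obtain \<delta> where \<delta>: "\<delta> > 0" "\<forall>(k::nat) c d. (\<forall>i<k. a \<le> c i \<and> c i \<le> d i \<and> d i \<le> b) \<longrightarrow>
        disjoint_family_on (\<lambda>i. {c i<..<d i}) {..<k} \<longrightarrow> (\<Sum>i<k. d i - c i) < \<delta> \<longrightarrow>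
        (\<Sum>i<k. norm (\<xi> (d i) - \<xi> (c i))) < \<epsilon> / (norm v + 1)"
    using assms[unfolded absolutely_continuous_curve_def, THEN spec, THEN mp, OF \<epsilon>']
    by (elim exE conjE) (rule that)
  show "\<exists>\<delta>>0. \<forall>(k::nat) c d. (\<forall>i<k. a \<le> c i \<and> c i \<le> d i \<and> d i \<le> b) \<longrightarrow>
        disjoint_family_on (\<lambda>i. {c i<..<d i}) {..<k} \<longrightarrow> (\<Sum>i<k. d i - c i) < \<delta> \<longrightarrow>
        (\<Sum>i<k. norm (\<xi> (d i) \<bullet> v - \<xi> (c i) \<bullet> v)) < \<epsilon>"
  proof (intro exI[of _ \<delta>] conjI allI impI \<delta>(1))
    fix k :: nat and c d
    assume A: "\<forall>i<k. a \<le> c i \<and> c i \<le> d i \<and> d i \<le> b"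
      "disjoint_family_on (\<lambda>i. {c i<..<d i}) {..<k}" "(\<Sum>i<k. d i - c i) < \<delta>"
    have "(\<Sum>i<k. norm (\<xi> (d i) \<bullet> v - \<xi> (c i) \<bullet> v)) \<le> (\<Sum>i<k. norm (\<xi> (d i) - \<xi> (c i)) * (norm v + 1))"
    proof (rule sum_mono)
      fix i
      have "norm (\<xi> (d i) \<bullet> v - \<xi> (c i) \<bullet> v) \<le> norm (\<xi> (d i) - \<xi> (c i)) * norm v"
        using Cauchy_Schwarz_ineq2[of "\<xi> (d i) - \<xi> (c i)" v] by (simp add: inner_diff_left)
      also have "\<dots> \<le> norm (\<xi> (d i) - \<xi> (c i)) * (norm v + 1)"
        by (intro mult_left_mono) auto
      finally show "norm (\<xi> (d i) \<bullet> v - \<xi> (c i) \<bullet> v) \<le> norm (\<xi> (d i) - \<xi> (c i)) * (norm v + 1)" .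
    qed
    also have "\<dots> = (\<Sum>i<k. norm (\<xi> (d i) - \<xi> (c i))) * (norm v + 1)"
      by (simp add: sum_distrib_right)
    also have "\<dots> < \<epsilon>"
      using \<delta>(2)[rule_format, OF A(1)[rule_format] A(2,3)] by (simp add: pos_less_divide_eq add_nonneg_pos)
    finally show "(\<Sum>i<k. norm (\<xi> (d i) \<bullet> v - \<xi> (c i) \<bullet> v)) < \<epsilon>" .
  qed
qed

lemma clamped_interval:
  fixes c d :: real
  defines "cl \<equiv> \<lambda>lo hi s. max lo (min hi s)"
  assumes "lo \<le> hi" "c \<le> d"
  shows "cl lo hi c \<le> cl lo hi d" "cl lo hi d - cl lo hi c \<le> d - c" "{cl lo hi c<..<cl lo hi d} \<subseteq> {c<..<d}"
  using assms by (auto simp: max_def min_def)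

text \<open>Clamping the endpoints of a family of intervals is how such a family is cut at a point, both for
  the variation function and for concatenated curves.\<close>

lemma disjoint_family_clamped:
  fixes c d :: "'i \<Rightarrow> real"
  assumes "lo \<le> hi" "\<And>i. i \<in> I \<Longrightarrow> c i \<le> d i" "disjoint_family_on (\<lambda>i. {c i<..<d i}) I"
  shows "disjoint_family_on (\<lambda>i. {max lo (min hi (c i))<..<max lo (min hi (d i))}) I"
  unfolding disjoint_family_on_def
proof (intro ballI impI)
  fix m n assume "m \<in> I" "n \<in> I" "m \<noteq> n"
  then have "{c m<..<d m} \<inter> {c n<..<d n} = {}"
    using assms(3) by (auto simp: disjoint_family_on_def)
  then show "{max lo (min hi (c m))<..<max lo (min hi (d m))} \<inter>
      {max lo (min hi (c n))<..<max lo (min hi (d n))} = {}"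
    using clamped_interval(3)[OF assms(1) assms(2)[OF \<open>m \<in> I\<close>]]
      clamped_interval(3)[OF assms(1) assms(2)[OF \<open>n \<in> I\<close>]] by blast
qed

text \<open>A local Jordan decomposition: on a short interval \<open>g\<close> is the difference of
  two continuous monotone functions, its positive variation \<open>P\<close> and
  \<open>P - g\<close>.\<close>

lemma AC_imp_negligible_not_differentiable:
  fixes g :: "real \<Rightarrow> real"
  assumes AC: "absolutely_continuous_curve a b g"
  shows "negligible {x\<in>{a<..<b}. \<not> g differentiable (at x)}"
proof -
  obtain \<delta> where \<delta>: "\<delta> > 0" "\<forall>(I::nat set) c d. finite I \<longrightarrow> (\<forall>i\<in>I. a \<le> c i \<and> c i \<le> d i \<and> d i \<le> b) \<longrightarrow>
     disjoint_family_on (\<lambda>i. {c i<..<d i}) I \<longrightarrow> (\<Sum>i\<in>I. d i - c i) < \<delta> \<longrightarrow>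
     (\<Sum>i\<in>I. norm (g (d i) - g (c i))) < 1"
    by (rule absolutely_continuous_curveD[OF AC zero_less_one])
  \<comment> \<open>Sums of increments are bounded by 1 only for families of total length below
    \<delta>, hence the restriction to short intervals.\<close>
  have local: "negligible {x\<in>{s<..<s'}. \<not> g differentiable (at x)}"
    if s: "a \<le> s" "s < s'" "s' \<le> b" "s' - s < \<delta>" for s s'
  proof -
    \<comment> \<open>Clamping extends \<open>g\<close> from \<open>[s, s']\<close> to the whole
      line by constants, where the result on monotone functions applies.\<close>
    define cl where "cl y = max s (min s' y)" for y
    have cl_mono: "cl y \<le> cl y'" if "y \<le> y'" for y y'
      using that by (auto simp: cl_def)
    have cl_range: "s \<le> cl y" "cl y \<le> s'" for y
      using s by (auto simp: cl_def)
    have cl_diff: "cl y' - cl y \<le> y' - y" if "y \<le> y'" for y y'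
      using that by (auto simp: cl_def)
    define fam where "fam y k c d \<longleftrightarrow> (\<forall>i<k. s \<le> c i \<and> c i \<le> d i \<and> d i \<le> cl y) \<and>
        disjoint_family_on (\<lambda>i. {c i<..<d i}) {..<k}" for y c d and k :: nat
    define T where "T k c d = (\<Sum>i<k. g (d i) - g (c i))" for c d and k :: nat
    \<comment> \<open>The positive variation of \<open>g\<close> on \<open>[s, cl y]\<close>: the
      increments are signed and the families need not cover the interval, so the supremum collects
      the increasing parts.\<close>
    define P where "P y = Sup {T k c d |k c d. fam y k c d}" for y
    have len: "(\<Sum>i<k. d i - c i) \<le> y' - x" if "fam y k c d" "\<And>i. i < k \<Longrightarrow> x \<le> c i \<and> d i \<le> y'" "x \<le> y'" for y k c d x y'
    proof -
      have "(\<Sum>i<k. d i - c i) \<le> measure lebesgue {x..y'}"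
      proof (rule sum_disjoint_intervals_le_measure)
        show "{c i<..<d i} \<subseteq> {x..y'}" if "i \<in> {..<k}" for i
          using \<open>\<And>i. i < k \<Longrightarrow> x \<le> c i \<and> d i \<le> y'\<close>[of i] that by auto
      qed (use that(1) in \<open>auto simp: fam_def\<close>)
      then show ?thesis using that by simp
    qed
    have T_le: "T k c d \<le> (\<Sum>i<k. norm (g (d i) - g (c i)))" for k c d
      unfolding T_def by (rule sum_mono) auto
    have T1: "T k c d \<le> 1" if "fam y k c d" for y k c d
    proof -
      have "(\<Sum>i<k. d i - c i) \<le> s' - s"
        by (rule len[OF that]) (use that cl_range[of y] s in \<open>force simp: fam_def\<close>)+
      then have "(\<Sum>i<k. norm (g (d i) - g (c i))) < 1"
        using that s cl_range[of y] by (intro \<delta>(2)[rule_format]) (force simp: fam_def)+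
      then show ?thesis using T_le[of k c d] by simp
    qed
    have bdd: "bdd_above {T k c d |k c d. fam y k c d}" for y
      using T1 by (auto intro!: bdd_aboveI[of _ 1])
    have "fam y 0 (\<lambda>_. 0) (\<lambda>_. 0)" for y
      by (auto simp: fam_def disjoint_family_on_def)
    then have ne: "{T k c d |k c d. fam y k c d} \<noteq> {}" for y by blast
    have T_P: "T k c d \<le> P y" if "fam y k c d" for y k c d
      unfolding P_def by (rule cSup_upper) (use that bdd in auto)
    have P_le: "P y \<le> z" if "\<And>k c d. fam y k c d \<Longrightarrow> T k c d \<le> z" for y z
      unfolding P_def by (rule cSup_least) (use that ne in auto)
    have mono_P: "mono P"
    proof
      fix y y' :: real assume "y \<le> y'"
      then have "fam y k c d \<Longrightarrow> fam y' k c d" for k c d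
        using cl_mono unfolding fam_def by (meson order.trans)
      then show "P y \<le> P y'" by (intro P_le T_P)
    qed
    have P_add: "P y + (g (cl y') - g (cl y)) \<le> P y'" if "y \<le> y'" for y y'
    proof -
      have "P y \<le> P y' - (g (cl y') - g (cl y))"
      proof (rule P_le)
        fix k c d assume f: "fam y k c d"
        have "disjoint_family_on (\<lambda>i. {(c(k := cl y)) i<..<(d(k := cl y')) i}) {..<Suc k}"
          using f unfolding fam_def disjoint_family_on_def
          by (auto simp: less_Suc_eq)
        then have "fam y' (Suc k) (c(k := cl y)) (d(k := cl y'))"
          using f cl_mono[OF that] cl_range[of y] unfolding fam_def by (auto simp: less_Suc_eq)
        from T_P[OF this] have "T k c d + (g (cl y') - g (cl y)) \<le> P y'"
          by (simp add: T_def)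
        then show "T k c d \<le> P y' - (g (cl y') - g (cl y))" by simp
      qed
      then show ?thesis by simp
    qed
    have contP: "continuous_on UNIV P" and contg: "continuous_on UNIV (g \<circ> cl)"
    proof -
      have "\<exists>\<eta>>0. \<forall>y y'. y \<le> y' \<and> y' - y < \<eta> \<longrightarrow> P y' \<le> P y + \<epsilon> \<and> \<bar>g (cl y') - g (cl y)\<bar> < \<epsilon>" if \<epsilon>0: "\<epsilon> > 0" for \<epsilon>
      proof -
        obtain \<eta> where \<eta>: "\<eta> > 0" "\<forall>(I::nat set) c d. finite I \<longrightarrow> (\<forall>i\<in>I. a \<le> c i \<and> c i \<le> d i \<and> d i \<le> b) \<longrightarrow>
           disjoint_family_on (\<lambda>i. {c i<..<d i}) I \<longrightarrow> (\<Sum>i\<in>I. d i - c i) < \<eta> \<longrightarrow>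
           (\<Sum>i\<in>I. norm (g (d i) - g (c i))) < \<epsilon>"
          by (rule absolutely_continuous_curveD[OF AC \<epsilon>0])
        have "P y' \<le> P y + \<epsilon>" if y: "y \<le> y'" "y' - y < \<eta>" for y y'
        proof (rule P_le)
          fix k c d assume f: "fam y' k c d"
          let ?c1 = "\<lambda>i. max s (min (cl y) (c i))" and ?d1 = "\<lambda>i. max s (min (cl y) (d i))"
          let ?c2 = "\<lambda>i. max (cl y) (min s' (c i))" and ?d2 = "\<lambda>i. max (cl y) (min s' (d i))"
          have f1: "fam y k ?c1 ?d1"
            using f cl_range[of y] disjoint_family_clamped[of s "cl y" "{..<k}" c d]
            unfolding fam_def by (auto simp: le_max_iff_disj min_le_iff_disj)
          have f2: "fam y' k ?c2 ?d2"
            using f cl_range[of y] cl_range[of y'] cl_mono[OF y(1)] disjoint_family_clamped[of "cl y" s' "{..<k}" c d]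
            unfolding fam_def by (auto simp: le_max_iff_disj min_le_iff_disj)
          have "(\<Sum>i<k. ?d2 i - ?c2 i) \<le> cl y' - cl y"
            by (rule len[OF f2]) (use f2 cl_mono[OF y(1)] in \<open>auto simp: fam_def\<close>)
          also have "\<dots> < \<eta>" using cl_diff[OF y(1)] y by simp
          finally have "(\<Sum>i<k. norm (g (?d2 i) - g (?c2 i))) < \<epsilon>"
            using f2 s cl_range[of y'] by (intro \<eta>(2)[rule_format]) (force simp: fam_def)+
          then have "T k ?c2 ?d2 < \<epsilon>" using T_le[of k ?c2 ?d2] by simp
          moreover have "T k ?c1 ?d1 \<le> P y" by (rule T_P[OF f1])
          moreover have "T k c d = T k ?c1 ?d1 + T k ?c2 ?d2"
            unfolding T_def sum.distrib[symmetric]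
          proof (rule sum.cong)
            fix i assume "i \<in> {..<k}"
            then have "s \<le> c i" "c i \<le> d i" "d i \<le> s'"
              using f cl_range[of y'] by (force simp: fam_def)+
            then have 1: "?c1 i = min (cl y) (c i)" "?d1 i = min (cl y) (d i)" "?c2 i = max (cl y) (c i)" "?d2 i = max (cl y) (d i)"
              using cl_range[of y] by auto
            show "g (d i) - g (c i) = g (?d1 i) - g (?c1 i) + (g (?d2 i) - g (?c2 i))"
              unfolding 1 using \<open>c i \<le> d i\<close> by (auto simp: min_def max_def)
          qed simp
          ultimately show "T k c d \<le> P y + \<epsilon>" by simp
        qed
        moreover have "\<bar>g (cl y') - g (cl y)\<bar> < \<epsilon>" if y: "y \<le> y'" "y' - y < \<eta>" for y y'
          using \<eta>(2)[rule_format, of "{0}" "\<lambda>_. cl y" "\<lambda>_. cl y'"] cl_mono[OF y(1)] cl_diff[OF y(1)] y cl_range s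
          by (auto simp: disjoint_family_on_def intro: order.trans)
        ultimately show ?thesis using \<eta>(1) by blast
      qed note * = this
      show "continuous_on UNIV P"
        unfolding continuous_on_iff
      proof (intro ballI allI impI)
        fix x \<epsilon> :: real assume "\<epsilon> > 0"
        then obtain \<eta> where \<eta>: "\<eta> > 0" "\<And>y y'. y \<le> y' \<Longrightarrow> y' - y < \<eta> \<Longrightarrow> P y' \<le> P y + \<epsilon>/2"
          using *[of "\<epsilon>/2"] by auto
        have "dist (P x') (P x) < \<epsilon>" if "dist x' x < \<eta>" for x'
          using \<eta>(2)[of x x'] \<eta>(2)[of x' x] mono_P[THEN monoD, of x x'] mono_P[THEN monoD, of x' x] that \<open>\<epsilon> > 0\<close>
          by (cases "x \<le> x'") (auto simp: dist_real_def)
        then show "\<exists>d>0. \<forall>x'\<in>UNIV. dist x' x < d \<longrightarrow> dist (P x') (P x) < \<epsilon>"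
          using \<eta>(1) by blast
      qed
      show "continuous_on UNIV (g \<circ> cl)"
        unfolding continuous_on_iff
      proof (intro ballI allI impI)
        fix x \<epsilon> :: real assume "\<epsilon> > 0"
        then obtain \<eta> where \<eta>: "\<eta> > 0" "\<And>y y'. y \<le> y' \<Longrightarrow> y' - y < \<eta> \<Longrightarrow> \<bar>g (cl y') - g (cl y)\<bar> < \<epsilon>"
          using *[of "\<epsilon>"] by auto
        have "dist ((g \<circ> cl) x') ((g \<circ> cl) x) < \<epsilon>" if "dist x' x < \<eta>" for x'
          using \<eta>(2)[of x x'] \<eta>(2)[of x' x] that \<open>\<epsilon> > 0\<close>
          by (cases "x \<le> x'") (auto simp: dist_real_def abs_minus_commute)
        then show "\<exists>d>0. \<forall>x'\<in>UNIV. dist x' x < d \<longrightarrow> dist ((g \<circ> cl) x') ((g \<circ> cl) x) < \<epsilon>"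
          using \<eta>(1) by blast
      qed
    qed
    define h where "h y = P y - (g \<circ> cl) y" for y
    have h: "mono h" "continuous_on UNIV h"
      using P_add unfolding h_def mono_def
      by (fastforce, intro continuous_on_diff contP contg)
    have "g differentiable (at x)" if x: "x \<in> {s<..<s'}" "P differentiable (at x)" "h differentiable (at x)" for x
    proof -
      have "(\<lambda>y. P y - h y) differentiable (at x)"
        by (intro differentiable_diff x)
      then obtain D where "((\<lambda>y. P y - h y) has_derivative D) (at x)"
        unfolding differentiable_def by blast
      then have "(g has_derivative D) (at x)"
      proof (rule has_derivative_transform_within_open)
        show "open {s<..<s'}" "x \<in> {s<..<s'}" using x by auto
        show "P y - h y = g y" if "y \<in> {s<..<s'}" for y
          using that by (simp add: h_def cl_def)
      qed
      then show ?thesis unfolding differentiable_def by blast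
    qed
    then have "{x\<in>{s<..<s'}. \<not> g differentiable (at x)} \<subseteq>
      {x. \<not> P differentiable (at x)} \<union> {x. \<not> h differentiable (at x)}" by blast
    then show ?thesis
      using mono_imp_negligible_not_differentiable[OF mono_P contP] mono_imp_negligible_not_differentiable[OF h]
      by (meson negligible_Un negligible_subset)
  qed
  show ?thesis
    unfolding locally_negligible_alt[of "{x\<in>{a<..<b}. \<not> g differentiable (at x)}"]
  proof
    let ?S = "{x\<in>{a<..<b}. \<not> g differentiable (at x)}"
    fix x assume x: "x \<in> ?S"
    define s where "s = max a (x - \<delta>/4)"
    define s' where "s' = min b (x + \<delta>/4)"
    have ss: "a \<le> s" "s < s'" "s' \<le> b" "s' - s < \<delta>" "x \<in> {s<..<s'}"
      using x \<delta>(1) by (auto simp: s_def s'_def)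
    have "negligible (?S \<inter> {s<..<s'})"
      by (rule negligible_subset[OF local[OF ss(1-4)]]) auto
    then show "\<exists>U. openin (top_of_set ?S) U \<and> x \<in> U \<and> negligible U"
      using ss(5) x by (intro exI[of _ "?S \<inter> {s<..<s'}"]) (auto intro: openin_open_Int)
  qed
qed

lemma AC_curve_has_vector_derivative:
  fixes \<xi> :: "real \<Rightarrow> 'a::euclidean_space"
  assumes AC: "absolutely_continuous_curve a b \<xi>"
  obtains N where "negligible N" "\<And>s. s \<in> {a..b} - N \<Longrightarrow> (\<xi> has_vector_derivative vector_derivative \<xi> (at s)) (at s)"
proof -
  \<comment> \<open>The endpoints join the null set, since the two-sided derivative there depends on
    values of \<xi> outside \<open>[a, b]\<close>.\<close>
  define N where "N = insert a (insert b (\<Union>i\<in>Basis. {x\<in>{a<..<b}. \<not> (\<lambda>s. \<xi> s \<bullet> i) differentiable (at x)}))"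
  have "negligible N"
    unfolding N_def
    by (intro negligible_insert[THEN iffD2] negligible_Union)
       (use AC_imp_negligible_not_differentiable[OF absolutely_continuous_curve_inner[OF AC]] in auto)
  moreover have "(\<xi> has_vector_derivative vector_derivative \<xi> (at s)) (at s)" if "s \<in> {a..b} - N" for s
  proof -
    have "\<xi> differentiable (at s)"
      unfolding differentiable_componentwise_within[of \<xi>] using that by (auto simp: N_def)
    then show ?thesis by (simp add: vector_derivative_works)
  qed
  ultimately show thesis using that by blast
qed

text \<open>Riemann sums for a suitable gauge are compared with the increment directly, so
  integrability of the derivative comes out rather than going in. At tags off \<open>N\<close> the
  differentiability is used; pieces tagged in \<open>N\<close> lie in an open set of small measure,
  where absolute continuity makes the total increment small.\<close>

lemma fundamental_theorem_of_calculus_AC: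
  fixes \<xi> :: "real \<Rightarrow> 'a::euclidean_space"
  assumes AC: "absolutely_continuous_curve a b \<xi>" and ab: "a \<le> b"
  shows "((\<lambda>s. vector_derivative \<xi> (at s)) has_integral \<xi> b - \<xi> a) {a..b}"
proof -
  obtain N where N: "negligible N" "\<And>s. s \<in> {a..b} - N \<Longrightarrow> (\<xi> has_vector_derivative vector_derivative \<xi> (at s)) (at s)"
    using AC_curve_has_vector_derivative[OF AC] by blast
  \<comment> \<open>With the value 0 on \<open>N\<close> the Riemann sums receive nothing from tags
    in \<open>N\<close>.\<close>
  define f' where "f' s = (if s \<in> N then 0 else vector_derivative \<xi> (at s))" for s
  have "(f' has_integral \<xi> b - \<xi> a) {a..b}"
  proof (cases "a = b")
    case True
    then show ?thesis by (simp add: has_integral_refl)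
  next
    case False
    show ?thesis
      unfolding has_integral_factor_content_real
    proof (intro allI impI)
      fix e :: real assume e: "e > 0"
      \<comment> \<open>Half of the error budget \<open>e * (b - a)\<close> goes to the tags in
        \<open>N\<close>, the other half to the remaining tags.\<close>
      have ba0: "e / 2 * (b - a) > 0" using e False ab by simp
      obtain \<delta> where \<delta>: "\<delta> > 0" "\<forall>(I::(real \<times> real set) set) c d. finite I \<longrightarrow> (\<forall>i\<in>I. a \<le> c i \<and> c i \<le> d i \<and> d i \<le> b) \<longrightarrow>
         disjoint_family_on (\<lambda>i. {c i<..<d i}) I \<longrightarrow> (\<Sum>i\<in>I. d i - c i) < \<delta> \<longrightarrow>
         (\<Sum>i\<in>I. norm (\<xi> (d i) - \<xi> (c i))) < e / 2 * (b - a)"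
        by (rule absolutely_continuous_curveD[OF AC ba0])
      obtain U where U: "open U" "N \<subseteq> U" "U \<in> lmeasurable" "measure lebesgue U < \<delta>"
      proof -
        have Nm: "N \<in> sets lebesgue" using N(1) by (simp add: negligible_imp_sets)
        obtain T where T: "open T" "N \<subseteq> T" "(T - N) \<in> lmeasurable" "emeasure lebesgue (T - N) < ennreal \<delta>"
          using sets_lebesgue_outer_open[OF Nm \<delta>(1)] by metis
        have NT: "N \<in> lmeasurable" "measure lebesgue N = 0" 
          using N(1) negligible_iff_measure by auto
        have TN: "T = N \<union> (T - N)" using T(2) by auto
        have Tl: "T \<in> lmeasurable"
          by (subst TN) (intro fmeasurable.Un T NT)
        have "measure lebesgue T = measure lebesgue (T - N)"
          using measurable_measure_Diff[OF Tl Nm T(2)] NT by simp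
        also have "\<dots> < \<delta>" using T(3,4) \<delta>(1)
          by (metis emeasure_eq_measure2 ennreal_less_iff measure_nonneg)
        finally show thesis using that T Tl by blast
      qed
      have "\<exists>d>0. (x \<in> N \<longrightarrow> ball x d \<subseteq> U) \<and> (x \<in> {a..b} - N \<longrightarrow>
           (\<forall>y. norm (y-x) < d \<longrightarrow> norm (\<xi> y - \<xi> x - (y-x) *\<^sub>R f' x) \<le> e/2 * norm (y-x)))" for x
      proof (cases "x \<in> N")
        case True
        then show ?thesis using U open_contains_ball by blast
      next
        case False
        show ?thesis
        proof (cases "x \<in> {a..b}")
          case True
          then have "(\<xi> has_vector_derivative f' x) (at x)"
            using N(2)[of x] False by (simp add: f'_def)
          then have "\<exists>d>0. \<forall>y. norm (y-x) < d \<longrightarrow> norm (\<xi> y - \<xi> x - (y-x) *\<^sub>R f' x) \<le> e/2 * norm (y-x)"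
            using e unfolding has_vector_derivative_def has_derivative_at_alt by (metis half_gt_zero)
          then show ?thesis using False by blast
        qed (use False in \<open>auto intro: exI[of _ 1]\<close>)
      qed
      then obtain d where d: "\<And>x. d x > 0" "\<And>x. x \<in> N \<Longrightarrow> ball x (d x) \<subseteq> U"
         "\<And>x y. x \<in> {a..b} - N \<Longrightarrow> norm (y-x) < d x \<Longrightarrow> norm (\<xi> y - \<xi> x - (y-x) *\<^sub>R f' x) \<le> e/2 * norm (y-x)"
        by metis
      show "\<exists>d. gauge d \<and> (\<forall>p. p tagged_division_of {a..b} \<and> d fine p \<longrightarrow>
          norm (sum (\<lambda>(x,k). measure lborel k *\<^sub>R f' x) p - (\<xi> b - \<xi> a)) \<le> e * measure lborel {a..b})"
      proof (intro exI[of _ "\<lambda>x. ball x (d x)"] conjI allI impI; (elim conjE)?)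
        show "gauge (\<lambda>x. ball x (d x))" using d(1) gauge_ball_dependent by blast
      next
        fix p assume p: "p tagged_division_of {a..b}" and fine: "(\<lambda>x. ball x (d x)) fine p"
        have fin: "finite p" using p by blast
        have K: "K = {Inf K..Sup K} \<and> Inf K \<le> x \<and> x \<le> Sup K \<and> a \<le> Inf K \<and> Sup K \<le> b \<and> K \<subseteq> ball x (d x)"
          if xK: "(x, K) \<in> p" for x K
        proof -
          obtain u v where uv: "K = {u..v}" using tagged_division_ofD(4)[OF p xK] by auto
          have "x \<in> K" "K \<subseteq> {a..b}" using tagged_division_ofD(2,3)[OF p xK] by auto
          moreover have "K \<subseteq> ball x (d x)" using fine xK by (auto simp: fine_def)
          ultimately show ?thesis unfolding uv by auto
        qed
        have ba: "b - a = (\<Sum>(x,K)\<in>p. Sup K - Inf K)" "\<xi> b - \<xi> a = (\<Sum>(x,K)\<in>p. \<xi> (Sup K) - \<xi> (Inf K))"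
          using additive_tagged_division_1[where f= "\<lambda>x. x"] additive_tagged_division_1[where f= \<xi>] ab p by auto
        let ?q = "{i\<in>p. fst i \<in> N}"
        have disj: "disjoint_family_on (\<lambda>i. {Inf (snd i)<..<Sup (snd i)}) ?q"
          unfolding disjoint_family_on_def
        proof (intro ballI impI)
          fix i j assume ij: "i \<in> ?q" "j \<in> ?q" "i \<noteq> j"
          then have "interior (snd i) \<inter> interior (snd j) = {}"
            using tagged_division_ofD(5)[OF p, of "fst i" "snd i" "fst j" "snd j"] by auto
          moreover have "snd i = {Inf (snd i)..Sup (snd i)}" "snd j = {Inf (snd j)..Sup (snd j)}"
            using K[of "fst i" "snd i"] K[of "fst j" "snd j"] ij by auto
          ultimately show "{Inf (snd i)<..<Sup (snd i)} \<inter> {Inf (snd j)<..<Sup (snd j)} = {}"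
            by (metis interior_atLeastAtMost_real)
        qed
        have "(\<Sum>i\<in>?q. Sup (snd i) - Inf (snd i)) \<le> measure lebesgue U"
        proof (rule sum_disjoint_intervals_le_measure[OF _ _ disj U(3)])
          fix i assume i: "i \<in> ?q"
          have Ki: "snd i = {Inf (snd i)..Sup (snd i)}" "snd i \<subseteq> ball (fst i) (d (fst i))" "Inf (snd i) \<le> Sup (snd i)"
            using K[of "fst i" "snd i"] i by auto
          then show "Inf (snd i) \<le> Sup (snd i)" by simp
          have "{Inf (snd i)<..<Sup (snd i)} \<subseteq> snd i"
            by (subst (3) Ki(1)) auto
          then show "{Inf (snd i)<..<Sup (snd i)} \<subseteq> U"
            using Ki(2) d(2)[of "fst i"] i by blast
        qed (use fin in auto)
        then have small: "(\<Sum>i\<in>?q. norm (\<xi> (Sup (snd i)) - \<xi> (Inf (snd i)))) < e / 2 * (b - a)"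
          by (intro \<delta>(2)[rule_format] disj) (use fin U(4) K in force)+
        let ?E = "\<lambda>(x,K). measure lborel K *\<^sub>R f' x - (\<xi> (Sup K) - \<xi> (Inf K))"
        have "norm (\<Sum>i\<in>p. ?E i) \<le> (\<Sum>i\<in>p. e/2 * (Sup (snd i) - Inf (snd i)) + (if fst i \<in> N then norm (\<xi> (Sup (snd i)) - \<xi> (Inf (snd i))) else 0))"
        proof (rule sum_norm_le)
          fix i assume "i \<in> p"
          then obtain x K' where i: "i = (x, K')" "(x, K') \<in> p" by (cases i) auto
          define u v where "u = Inf K'" and "v = Sup K'"
          have K': "K' = {u..v}" "u \<le> x" "x \<le> v" "a \<le> u" "v \<le> b" "K' \<subseteq> ball x (d x)"
            using K[OF i(2)] unfolding u_def v_def by blast+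
          have c: "measure lborel K' = v - u" using K' by simp
          show "norm (?E i) \<le> e/2 * (Sup (snd i) - Inf (snd i)) + (if fst i \<in> N then norm (\<xi> (Sup (snd i)) - \<xi> (Inf (snd i))) else 0)"
          proof (cases "x \<in> N")
            case True
            then have "f' x = 0" by (simp add: f'_def)
            moreover have "0 \<le> e * (v - u)" using e K' by simp
            ultimately show ?thesis using i True by (simp add: norm_minus_commute u_def[symmetric] v_def[symmetric])
          next
            case False
            have uv: "norm (u - x) < d x" "norm (v - x) < d x"
              using K'(2,3) subsetD[OF K'(6), of u] subsetD[OF K'(6), of v] unfolding K'(1)
              by (auto simp: dist_norm)
            \<comment> \<open>The derivative is known at the tag only, so the increment over the
              piece is split there; the two errors are proportional to the two lengths and add
              up.\<close>
            have "norm ((v - u) *\<^sub>R f' x - (\<xi> v - \<xi> u)) = norm (\<xi> u - \<xi> x - (u - x) *\<^sub>R f' x - (\<xi> v - \<xi> x - (v - x) *\<^sub>R f' x))"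
              by (auto simp: algebra_simps)
            also have "\<dots> \<le> norm (\<xi> u - \<xi> x - (u - x) *\<^sub>R f' x) + norm (\<xi> v - \<xi> x - (v - x) *\<^sub>R f' x)"
              by (rule norm_triangle_ineq4)
            also have "\<dots> \<le> e/2 * norm (u - x) + e/2 * norm (v - x)"
              by (intro add_mono d(3) uv) (use False K' in auto)
            also have "\<dots> = e/2 * (v - u)" using K' by (simp add: field_simps)
            finally show ?thesis
              using i False c by (simp add: u_def[symmetric] v_def[symmetric])
          qed
        qed
        also have "\<dots> = e/2 * (\<Sum>i\<in>p. Sup (snd i) - Inf (snd i)) + (\<Sum>i\<in>?q. norm (\<xi> (Sup (snd i)) - \<xi> (Inf (snd i))))"
          by (simp add: sum.distrib sum_distrib_left sum.inter_filter[OF fin])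
        also have "(\<Sum>i\<in>p. Sup (snd i) - Inf (snd i)) = b - a"
          using ba(1) by (simp add: case_prod_unfold)
        also have "e/2 * (b - a) + (\<Sum>i\<in>?q. norm (\<xi> (Sup (snd i)) - \<xi> (Inf (snd i)))) \<le> e * (b - a)"
          using small by simp
        finally show "norm (sum (\<lambda>(x,k). measure lborel k *\<^sub>R f' x) p - (\<xi> b - \<xi> a)) \<le> e * measure lborel {a..b}"
          using ab by (simp add: ba(2) sum_subtractf case_prod_unfold)
      qed
    qed
  qed
  then show ?thesis
    by (rule has_integral_spike[OF N(1), rotated]) (auto simp: f'_def)
qed

section \<open>Action and fundamental solution\<close>

text \<open>The curves of \<open>fundamental_solution\<close> live on \<open>[0, t]\<close>; general
  intervals allow near-minimizers to be cut, shifted and joined.\<close>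

definition action :: "(real^'n \<Rightarrow> real^'n \<Rightarrow> real) \<Rightarrow> real \<Rightarrow> real \<Rightarrow> (real \<Rightarrow> real^'n) \<Rightarrow> real" where
  "action L a b \<xi> = integral {a..b} (\<lambda>s. L (\<xi> s) (vector_derivative \<xi> (at s)))"

definition admissible :: "(real^'n \<Rightarrow> real^'n \<Rightarrow> real) \<Rightarrow> real \<Rightarrow> real \<Rightarrow> (real \<Rightarrow> real^'n) \<Rightarrow> bool" where
  "admissible L a b \<xi> \<longleftrightarrow> absolutely_continuous_curve a b \<xi> \<and>
     (\<lambda>s. L (\<xi> s) (vector_derivative \<xi> (at s))) absolutely_integrable_on {a..b}"

lemma fundamental_solution_eq:
  "fundamental_solution L t x z = Inf {action L 0 t \<xi> |\<xi>. admissible L 0 t \<xi> \<and> \<xi> 0 = x \<and> \<xi> t = z}"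
  unfolding fundamental_solution_def action_def admissible_def by (simp add: conj_ac)

lemma admissible_integrable:
  "admissible L a b \<xi> \<Longrightarrow> (\<lambda>s. L (\<xi> s) (vector_derivative \<xi> (at s))) integrable_on {a..b}"
  unfolding admissible_def absolutely_integrable_on_def by blast

lemma absolutely_continuous_curve_subinterval:
  assumes "absolutely_continuous_curve a b \<xi>" "a \<le> c" "d \<le> b"
  shows "absolutely_continuous_curve c d \<xi>"
  unfolding absolutely_continuous_curve_def
proof (intro allI impI)
  fix \<epsilon> :: real assume "\<epsilon> > 0"
  then obtain \<delta> where \<delta>: "\<delta> > 0" "\<forall>(I::nat set) c d. finite I \<longrightarrow> (\<forall>i\<in>I. a \<le> c i \<and> c i \<le> d i \<and> d i \<le> b) \<longrightarrow>
     disjoint_family_on (\<lambda>i. {c i<..<d i}) I \<longrightarrow> (\<Sum>i\<in>I. d i - c i) < \<delta> \<longrightarrow>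
     (\<Sum>i\<in>I. norm (\<xi> (d i) - \<xi> (c i))) < \<epsilon>"
    by (rule absolutely_continuous_curveD[OF assms(1)])
  show "\<exists>\<delta>>0. \<forall>(k::nat) c' d'. (\<forall>i<k. c \<le> c' i \<and> c' i \<le> d' i \<and> d' i \<le> d) \<longrightarrow>
        disjoint_family_on (\<lambda>i. {c' i<..<d' i}) {..<k} \<longrightarrow> (\<Sum>i<k. d' i - c' i) < \<delta> \<longrightarrow>
        (\<Sum>i<k. norm (\<xi> (d' i) - \<xi> (c' i))) < \<epsilon>"
    by (intro exI[of _ \<delta>] conjI allI impI \<delta>(1) \<delta>(2)[rule_format]) (use assms(2,3) in force)+
qed

lemma admissible_subinterval:
  assumes "admissible L a b \<xi>" "a \<le> c" "d \<le> b"
  shows "admissible L c d \<xi>"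
  using assms absolutely_continuous_curve_subinterval absolutely_integrable_on_subinterval[where S="{a..b}" and a=c and b=d]
  unfolding admissible_def by auto

lemma action_combine:
  assumes "admissible L a c \<xi>" "a \<le> b" "b \<le> c"
  shows "action L a b \<xi> + action L b c \<xi> = action L a c \<xi>"
  unfolding action_def
  by (rule Henstock_Kurzweil_Integration.integral_combine[OF assms(2,3) admissible_integrable[OF assms(1)]])

text \<open>Holds also where \<xi> has no derivative: \<open>vector_derivative\<close> is a choice
  from the set of derivatives, and the two sets coincide.\<close>

lemma vector_derivative_shift: "vector_derivative (\<lambda>s. \<xi> (s + r)) (at s) = vector_derivative \<xi> (at (s + r))"
  for \<xi> :: "real \<Rightarrow> 'a::real_normed_vector"
proof -
  have shift: "((\<lambda>s. f (s + r)) has_vector_derivative D) (at s)" if "(f has_vector_derivative D) (at (s + r))"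
    for f :: "real \<Rightarrow> 'a" and r s D
  proof -
    have "((f \<circ> (\<lambda>s. s + r)) has_vector_derivative 1 *\<^sub>R D) (at s)"
      by (rule vector_diff_chain_at) (use that in \<open>auto intro!: derivative_eq_intros\<close>)
    then show ?thesis by (simp add: o_def)
  qed
  have "((\<lambda>s. \<xi> (s + r)) has_vector_derivative D) (at s) \<longleftrightarrow> (\<xi> has_vector_derivative D) (at (s + r))" for D
    using shift[of \<xi> D s r] shift[of "\<lambda>s. \<xi> (s + r)" D "s + r" "- r"] by auto
  then show ?thesis unfolding vector_derivative_def by simp
qed

lemma admissible_shift:
  assumes "admissible L a b \<xi>"
  shows "admissible L (a - r) (b - r) (\<lambda>s. \<xi> (s + r))"
    and "action L (a - r) (b - r) (\<lambda>s. \<xi> (s + r)) = action L a b \<xi>"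
proof -
  have "absolutely_continuous_curve (a - r) (b - r) (\<lambda>s. \<xi> (s + r))"
    unfolding absolutely_continuous_curve_def
  proof (intro allI impI)
    fix \<epsilon> :: real assume e: "\<epsilon> > 0"
    have AC: "absolutely_continuous_curve a b \<xi>"
      using assms by (simp add: admissible_def)
    obtain \<delta> where \<delta>: "\<delta> > 0" "\<forall>(I::nat set) c d. finite I \<longrightarrow> (\<forall>i\<in>I. a \<le> c i \<and> c i \<le> d i \<and> d i \<le> b) \<longrightarrow>
       disjoint_family_on (\<lambda>i. {c i<..<d i}) I \<longrightarrow> (\<Sum>i\<in>I. d i - c i) < \<delta> \<longrightarrow>
       (\<Sum>i\<in>I. norm (\<xi> (d i) - \<xi> (c i))) < \<epsilon>"
      by (rule absolutely_continuous_curveD[OF AC e])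
    show "\<exists>\<delta>>0. \<forall>(k::nat) c d. (\<forall>i<k. a - r \<le> c i \<and> c i \<le> d i \<and> d i \<le> b - r) \<longrightarrow>
          disjoint_family_on (\<lambda>i. {c i<..<d i}) {..<k} \<longrightarrow> (\<Sum>i<k. d i - c i) < \<delta> \<longrightarrow>
          (\<Sum>i<k. norm (\<xi> (d i + r) - \<xi> (c i + r))) < \<epsilon>"
    proof (intro exI[of _ \<delta>] conjI allI impI \<delta>(1))
      fix k :: nat and c d
      assume A: "\<forall>i<k. a - r \<le> c i \<and> c i \<le> d i \<and> d i \<le> b - r"
        "disjoint_family_on (\<lambda>i. {c i<..<d i}) {..<k}" "(\<Sum>i<k. d i - c i) < \<delta>"
      have "disjoint_family_on (\<lambda>i. {c i + r<..<d i + r}) {..<k}"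
        unfolding disjoint_family_on_def
      proof (intro ballI impI)
        fix i j assume ij: "i \<in> {..<k}" "j \<in> {..<k}" "i \<noteq> j"
        have "s \<notin> {c j + r<..<d j + r}" if "s \<in> {c i + r<..<d i + r}" for s
        proof -
          have "s - r \<in> {c i<..<d i}" using that by auto
          then have "s - r \<notin> {c j<..<d j}" using A(2) ij unfolding disjoint_family_on_def by blast
          then show ?thesis by auto
        qed
        then show "{c i + r<..<d i + r} \<inter> {c j + r<..<d j + r} = {}" by blast
      qed
      then show "(\<Sum>i<k. norm (\<xi> (d i + r) - \<xi> (c i + r))) < \<epsilon>"
        using A by (intro \<delta>(2)[rule_format]) auto
    qed
  qed
  then show "admissible L (a - r) (b - r) (\<lambda>s. \<xi> (s + r))"
    using assms
      integrable_shift_real_ivl_iff[of "\<lambda>s. L (\<xi> s) (vector_derivative \<xi> (at s))" r a b]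
      integrable_shift_real_ivl_iff[of "\<lambda>s. norm (L (\<xi> s) (vector_derivative \<xi> (at s)))" r a b]
    unfolding admissible_def absolutely_integrable_on_def vector_derivative_shift by blast
  show "action L (a - r) (b - r) (\<lambda>s. \<xi> (s + r)) = action L a b \<xi>"
    unfolding action_def vector_derivative_shift
    by (rule integral_shift_real_ivl[of a r b "\<lambda>s. L (\<xi> s) (vector_derivative \<xi> (at s))"])
qed

lemma absolutely_continuous_curve_concat:
  fixes \<xi> \<eta> :: "real \<Rightarrow> 'a::real_normed_vector"
  assumes \<xi>: "absolutely_continuous_curve a b \<xi>" and \<eta>: "absolutely_continuous_curve b c \<eta>"
    and eq: "\<xi> b = \<eta> b" and abc: "a \<le> b" "b \<le> c"
  shows "absolutely_continuous_curve a c (\<lambda>s. if s \<le> b then \<xi> s else \<eta> s)"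
  unfolding absolutely_continuous_curve_def
proof (intro allI impI)
  let ?\<zeta> = "\<lambda>s. if s \<le> b then \<xi> s else \<eta> s"
  fix \<epsilon> :: real assume "\<epsilon> > 0"
  then have e2: "\<epsilon> / 2 > 0" by simp
  obtain \<delta>1 where \<delta>1: "\<delta>1 > 0" "\<forall>(I::nat set) c d. finite I \<longrightarrow> (\<forall>i\<in>I. a \<le> c i \<and> c i \<le> d i \<and> d i \<le> b) \<longrightarrow>
     disjoint_family_on (\<lambda>i. {c i<..<d i}) I \<longrightarrow> (\<Sum>i\<in>I. d i - c i) < \<delta>1 \<longrightarrow>
     (\<Sum>i\<in>I. norm (\<xi> (d i) - \<xi> (c i))) < \<epsilon> / 2"
    by (rule absolutely_continuous_curveD[OF \<xi> e2])
  obtain \<delta>2 where \<delta>2: "\<delta>2 > 0" "\<forall>(I::nat set) c' d. finite I \<longrightarrow> (\<forall>i\<in>I. b \<le> c' i \<and> c' i \<le> d i \<and> d i \<le> c) \<longrightarrow>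
     disjoint_family_on (\<lambda>i. {c' i<..<d i}) I \<longrightarrow> (\<Sum>i\<in>I. d i - c' i) < \<delta>2 \<longrightarrow>
     (\<Sum>i\<in>I. norm (\<eta> (d i) - \<eta> (c' i))) < \<epsilon> / 2"
    by (rule absolutely_continuous_curveD[OF \<eta> e2])
  show "\<exists>\<delta>>0. \<forall>(k::nat) c' d'. (\<forall>i<k. a \<le> c' i \<and> c' i \<le> d' i \<and> d' i \<le> c) \<longrightarrow>
        disjoint_family_on (\<lambda>i. {c' i<..<d' i}) {..<k} \<longrightarrow> (\<Sum>i<k. d' i - c' i) < \<delta> \<longrightarrow>
        (\<Sum>i<k. norm (?\<zeta> (d' i) - ?\<zeta> (c' i))) < \<epsilon>"
  proof (intro exI[of _ "min \<delta>1 \<delta>2"] conjI allI impI)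
    fix k :: nat and c' d'
    assume A: "\<forall>i<k. a \<le> c' i \<and> c' i \<le> d' i \<and> d' i \<le> c"
      "disjoint_family_on (\<lambda>i. {c' i<..<d' i}) {..<k}" "(\<Sum>i<k. d' i - c' i) < min \<delta>1 \<delta>2"
    let ?c1 = "\<lambda>i. max a (min b (c' i))" and ?d1 = "\<lambda>i. max a (min b (d' i))"
    let ?c2 = "\<lambda>i. max b (min c (c' i))" and ?d2 = "\<lambda>i. max b (min c (d' i))"
    have cl: "?c1 i \<le> ?d1 i" "?d1 i - ?c1 i \<le> d' i - c' i" "?c2 i \<le> ?d2 i" "?d2 i - ?c2 i \<le> d' i - c' i" if i: "i < k" for i
    proof -
      have le: "c' i \<le> d' i" using A(1) i by blast
      show "?c1 i \<le> ?d1 i" "?d1 i - ?c1 i \<le> d' i - c' i" "?c2 i \<le> ?d2 i" "?d2 i - ?c2 i \<le> d' i - c' i"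
        using clamped_interval[OF abc(1) le] clamped_interval[OF abc(2) le] by blast+
    qed
    have "(\<Sum>i<k. norm (\<xi> (?d1 i) - \<xi> (?c1 i))) < \<epsilon>/2"
    proof (rule \<delta>1(2)[rule_format])
      show "disjoint_family_on (\<lambda>i. {?c1 i<..<?d1 i}) {..<k}"
        by (rule disjoint_family_clamped) (use A abc in auto)
      have "(\<Sum>i<k. ?d1 i - ?c1 i) \<le> (\<Sum>i<k. d' i - c' i)"
        by (rule sum_mono, rule cl(2)) simp
      then show "(\<Sum>i<k. ?d1 i - ?c1 i) < \<delta>1" using A(3) by simp
      show "a \<le> ?c1 i \<and> ?c1 i \<le> ?d1 i \<and> ?d1 i \<le> b" if "i \<in> {..<k}" for i
        by (intro conjI cl(1)) (use abc that in auto)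
    qed simp
    moreover have "(\<Sum>i<k. norm (\<eta> (?d2 i) - \<eta> (?c2 i))) < \<epsilon>/2"
    proof (rule \<delta>2(2)[rule_format])
      show "disjoint_family_on (\<lambda>i. {?c2 i<..<?d2 i}) {..<k}"
        by (rule disjoint_family_clamped) (use A abc in auto)
      have "(\<Sum>i<k. ?d2 i - ?c2 i) \<le> (\<Sum>i<k. d' i - c' i)"
        by (rule sum_mono, rule cl(4)) simp
      then show "(\<Sum>i<k. ?d2 i - ?c2 i) < \<delta>2" using A(3) by simp
      show "b \<le> ?c2 i \<and> ?c2 i \<le> ?d2 i \<and> ?d2 i \<le> c" if "i \<in> {..<k}" for i
        by (intro conjI cl(3)) (use abc that in auto)
    qed simp
    moreover have "(\<Sum>i<k. norm (?\<zeta> (d' i) - ?\<zeta> (c' i))) \<le>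
      (\<Sum>i<k. norm (\<xi> (?d1 i) - \<xi> (?c1 i)) + norm (\<eta> (?d2 i) - \<eta> (?c2 i)))"
    proof (rule sum_mono)
      fix i assume "i \<in> {..<k}"
      then have i: "a \<le> c' i" "c' i \<le> d' i" "d' i \<le> c" using A(1) by auto
      \<comment> \<open>On \<open>[a, c]\<close> the joined curve is the sum of the two clamped
        curves minus their common value at \<open>b\<close>, so every increment splits into one of
        \<xi> and one of \<eta>.\<close>
      have c: "?\<zeta> s = \<xi> (max a (min b s)) + (\<eta> (max b (min c s)) - \<eta> b)" if "a \<le> s" "s \<le> c" for s
        using that eq abc by (auto simp: max_def min_def)
      have "?\<zeta> (d' i) - ?\<zeta> (c' i) = (\<xi> (?d1 i) - \<xi> (?c1 i)) + (\<eta> (?d2 i) - \<eta> (?c2 i))"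
        using c[of "d' i"] c[of "c' i"] i by (simp add: algebra_simps)
      then show "norm (?\<zeta> (d' i) - ?\<zeta> (c' i)) \<le> norm (\<xi> (?d1 i) - \<xi> (?c1 i)) + norm (\<eta> (?d2 i) - \<eta> (?c2 i))"
        by (metis norm_triangle_ineq)
    qed
    ultimately show "(\<Sum>i<k. norm (?\<zeta> (d' i) - ?\<zeta> (c' i))) < \<epsilon>"
      unfolding sum.distrib by linarith
  qed (use \<delta>1 \<delta>2 in auto)
qed

lemma admissible_concat:
  assumes \<xi>: "admissible L a b \<xi>" and \<eta>: "admissible L b c \<eta>"
    and eq: "\<xi> b = \<eta> b" and abc: "a \<le> b" "b \<le> c"
  defines "\<zeta> \<equiv> \<lambda>s. if s \<le> b then \<xi> s else \<eta> s"
  shows "admissible L a c \<zeta>" "action L a c \<zeta> = action L a b \<xi> + action L b c \<eta>"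
proof -
  have vd1: "vector_derivative \<zeta> (at s) = vector_derivative \<xi> (at s)" if "s < b" for s
    by (rule vector_derivative_cong_eq)
       (use that in \<open>auto simp: \<zeta>_def eventually_nhds intro!: exI[of _ "{..<b}"]\<close>)
  have vd2: "vector_derivative \<zeta> (at s) = vector_derivative \<eta> (at s)" if "s > b" for s
    by (rule vector_derivative_cong_eq)
       (use that in \<open>auto simp: \<zeta>_def eventually_nhds intro!: exI[of _ "{b<..}"]\<close>)
  let ?l = "\<lambda>\<xi> s. L (\<xi> s) (vector_derivative \<xi> (at s))"
  \<comment> \<open>On either side of \<open>b\<close> the derivative of the joined curve is
    inherited; its value at \<open>b\<close> itself is arbitrary, which the null set
    \<open>{b}\<close> absorbs.\<close>
  have i1: "?l \<zeta> absolutely_integrable_on {a..b}"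
    by (rule absolutely_integrable_spike[where f="?l \<xi>" and S="{b}"])
       (use \<xi> vd1 in \<open>auto simp: admissible_def \<zeta>_def\<close>)
  have i2: "?l \<zeta> absolutely_integrable_on {b..c}"
    by (rule absolutely_integrable_spike[where f="?l \<eta>" and S="{b}"])
       (use \<eta> vd2 in \<open>auto simp: admissible_def \<zeta>_def\<close>)
  show adm: "admissible L a c \<zeta>"
    unfolding admissible_def
    using absolutely_continuous_curve_concat[where \<xi>=\<xi> and \<eta>=\<eta>, OF _ _ eq abc] \<xi> \<eta> absolutely_integrable_on_combine[OF i1 i2 abc]
    by (auto simp: admissible_def \<zeta>_def)
  have "action L a b \<zeta> = action L a b \<xi>"
    unfolding action_def by (rule integral_spike[where S="{b}"]) (use vd1 in \<open>auto simp: \<zeta>_def\<close>)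
  moreover have "action L b c \<zeta> = action L b c \<eta>"
    unfolding action_def by (rule integral_spike[where S="{b}"]) (use vd2 in \<open>auto simp: \<zeta>_def\<close>)
  ultimately show "action L a c \<zeta> = action L a b \<xi> + action L b c \<eta>"
    using action_combine[OF adm abc] by simp
qed

lemma Lipschitz_imp_absolutely_continuous_curve:
  assumes "C-lipschitz_on {a..b} \<xi>"
  shows "absolutely_continuous_curve a b \<xi>"
  unfolding absolutely_continuous_curve_def
proof (intro allI impI)
  fix \<epsilon> :: real assume "\<epsilon> > 0"
  have C: "C \<ge> 0" using assms lipschitz_on_nonneg by blast
  show "\<exists>\<delta>>0. \<forall>(k::nat) c d. (\<forall>i<k. a \<le> c i \<and> c i \<le> d i \<and> d i \<le> b) \<longrightarrow>
        disjoint_family_on (\<lambda>i. {c i<..<d i}) {..<k} \<longrightarrow> (\<Sum>i<k. d i - c i) < \<delta> \<longrightarrow>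
        (\<Sum>i<k. norm (\<xi> (d i) - \<xi> (c i))) < \<epsilon>"
  proof (intro exI[of _ "\<epsilon> / (C + 1)"] conjI allI impI)
    fix k :: nat and c d
    assume A: "\<forall>i<k. a \<le> c i \<and> c i \<le> d i \<and> d i \<le> b" "(\<Sum>i<k. d i - c i) < \<epsilon> / (C + 1)"
    have "(\<Sum>i<k. norm (\<xi> (d i) - \<xi> (c i))) \<le> (\<Sum>i<k. (C + 1) * (d i - c i))"
    proof (rule sum_mono)
      fix i assume "i \<in> {..<k}"
      then have i: "a \<le> c i" "c i \<le> d i" "d i \<le> b" using A(1) by auto
      have "norm (\<xi> (d i) - \<xi> (c i)) \<le> C * (d i - c i)"
        using lipschitz_onD[OF assms, of "d i" "c i"] i by (auto simp: dist_norm)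
      also have "\<dots> \<le> (C + 1) * (d i - c i)" using i by (intro mult_right_mono) auto
      finally show "norm (\<xi> (d i) - \<xi> (c i)) \<le> (C + 1) * (d i - c i)" .
    qed
    also have "\<dots> < \<epsilon>"
      unfolding sum_distrib_left[symmetric] using A(2) C by (simp add: pos_less_divide_eq mult.commute)
    finally show "(\<Sum>i<k. norm (\<xi> (d i) - \<xi> (c i))) < \<epsilon>" .
  qed (use \<open>\<epsilon> > 0\<close> C in auto)
qed

text \<open>A linear minorant of \<open>L\<close> integrates, by the fundamental theorem, to a
  quantity that depends on the endpoints only. It plays the part of Jensen's inequality and turns
  pointwise bounds on \<open>L\<close> into bounds for curves about which nothing else is
  known.\<close>

lemma action_ge_linear:
  assumes adm: "admissible L a b \<xi>" and ab: "a \<le> b"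
    and L: "\<And>s v. s \<in> {a..b} \<Longrightarrow> L (\<xi> s) v \<ge> p \<bullet> v - c"
  shows "action L a b \<xi> \<ge> p \<bullet> (\<xi> b - \<xi> a) - c * (b - a)"
proof -
  have "((\<lambda>s. vector_derivative \<xi> (at s)) has_integral \<xi> b - \<xi> a) {a..b}"
    by (rule fundamental_theorem_of_calculus_AC) (use adm ab in \<open>auto simp: admissible_def\<close>)
  then have "((\<lambda>s. p \<bullet> vector_derivative \<xi> (at s)) has_integral p \<bullet> (\<xi> b - \<xi> a)) {a..b}"
    using has_integral_linear[OF _ bounded_linear_inner_right] unfolding o_def by blast
  then have "((\<lambda>s. p \<bullet> vector_derivative \<xi> (at s) - c) has_integral p \<bullet> (\<xi> b - \<xi> a) - c * (b - a)) {a..b}"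
    using has_integral_diff[OF _ has_integral_const_real[of c a b]] ab by (force simp: mult.commute)
  moreover have "((\<lambda>s. L (\<xi> s) (vector_derivative \<xi> (at s))) has_integral action L a b \<xi>) {a..b}"
    unfolding action_def by (rule integrable_integral[OF admissible_integrable[OF adm]])
  ultimately show ?thesis
    by (rule has_integral_le) (rule L)
qed

lemma action_ge_norm:
  assumes adm: "admissible L a b \<xi>" and L: "\<And>x v. L x v \<ge> K * norm v - C" and K: "K \<ge> 0"
    and st: "a \<le> s" "s \<le> t" "t \<le> b"
  shows "K * norm (\<xi> t - \<xi> s) \<le> action L a b \<xi> + C * (b - a)"
proof -
  define w where "w = \<xi> t - \<xi> s"
  \<comment> \<open>The slope of length \<open>K\<close> in the direction of the displacement, so
    that \<open>p \<bullet> w = K * norm w\<close>; it is 0 when \<open>w = 0\<close>.\<close>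
  define p where "p = (K / norm w) *\<^sub>R w"
  have p: "p \<bullet> v \<le> K * norm v" for v
  proof -
    have "p \<bullet> v \<le> norm p * norm v" by (rule norm_cauchy_schwarz)
    also have "\<dots> \<le> K * norm v" using K by (intro mult_right_mono) (auto simp: p_def)
    finally show ?thesis .
  qed
  have pw: "p \<bullet> w = K * norm w"
    by (cases "w = 0") (auto simp: p_def power2_norm_eq_inner[symmetric] power2_eq_square)
  have 1: "action L s t \<xi> \<ge> p \<bullet> (\<xi> t - \<xi> s) - C * (t - s)"
    by (rule action_ge_linear) (use admissible_subinterval[OF adm] st L p in \<open>auto intro: order.trans[OF _ L]\<close>)
  \<comment> \<open>Before \<open>s\<close> and after \<open>t\<close> the running cost is merely
    bounded below by \<open>- C\<close>.\<close>
  have 0: "0 \<bullet> v - C \<le> L x v" for x v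
    using L[of v x] K by (smt (verit) inner_zero_left mult_nonneg_nonneg norm_ge_zero)
  have 2: "action L a s \<xi> \<ge> 0 \<bullet> (\<xi> s - \<xi> a) - C * (s - a)"
    by (rule action_ge_linear) (use admissible_subinterval[OF adm] st 0 in auto)
  have 3: "action L t b \<xi> \<ge> 0 \<bullet> (\<xi> b - \<xi> t) - C * (b - t)"
    by (rule action_ge_linear) (use admissible_subinterval[OF adm] st 0 in auto)
  have "action L a b \<xi> = action L a s \<xi> + action L s t \<xi> + action L t b \<xi>"
    using action_combine[OF adm, of s] action_combine[of L s b \<xi> t] admissible_subinterval[OF adm] st by auto
  then show ?thesis using 1 2 3 pw unfolding w_def by (simp add: algebra_simps)
qed

section \<open>The fundamental solution as an infimum of actions\<close>

locale tonelli =
  fixes L :: "real^'n \<Rightarrow> real^'n \<Rightarrow> real"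
  assumes tonelli: "tonelli_lagrangian L"
begin

abbreviation "A \<equiv> fundamental_solution L"

lemma superlinear:
  assumes "K \<ge> 0"
  obtains C where "C \<ge> 0" "\<And>x v. L x v \<ge> K * norm v - C"
proof -
  obtain C where C: "\<And>x v. L x v \<ge> K * norm v - C"
    using tonelli assms unfolding tonelli_lagrangian_def by blast
  show thesis
    by (rule that[of "max C 0"]) (use C in \<open>auto intro: order.trans[OF _ C]\<close>)
qed

lemma continuous_L: "continuous_on S (\<lambda>(x, v). L x v)"
proof -
  have "continuous_on UNIV (\<lambda>(x, v). L x v)"
    using tonelli unfolding tonelli_lagrangian_def C_on_def numeral_2_eq_2 by simp
  then show ?thesis by (rule continuous_on_subset) auto
qed

lemma continuous_on_L:
  assumes "continuous_on S f" "continuous_on S g"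
  shows "continuous_on S (\<lambda>s. L (f s) (g s))"
  using continuous_on_compose2[OF continuous_L[of UNIV] continuous_on_Pair[OF assms]] by auto

lemma action_segment:
  fixes a v :: "real^'n"
  assumes "t \<ge> 0"
  shows "admissible L 0 t (\<lambda>s. a + s *\<^sub>R v)" "action L 0 t (\<lambda>s. a + s *\<^sub>R v) = integral {0..t} (\<lambda>s. L (a + s *\<^sub>R v) v)"
proof -
  have vd: "vector_derivative (\<lambda>s. a + s *\<^sub>R v) (at s) = v" for s
    by (rule vector_derivative_at) (auto intro!: derivative_eq_intros)
  have "(norm v)-lipschitz_on {0..t} (\<lambda>s. a + s *\<^sub>R v)"
    by (rule lipschitz_onI) (auto simp: dist_norm scaleR_diff_left[symmetric])
  then have "absolutely_continuous_curve 0 t (\<lambda>s. a + s *\<^sub>R v)"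
    by (rule Lipschitz_imp_absolutely_continuous_curve)
  moreover have "(\<lambda>s. L (a + s *\<^sub>R v) v) absolutely_integrable_on {0..t}"
    by (intro absolutely_integrable_continuous_real continuous_on_L continuous_intros)
  ultimately show "admissible L 0 t (\<lambda>s. a + s *\<^sub>R v)"
    unfolding admissible_def vd by simp
  show "action L 0 t (\<lambda>s. a + s *\<^sub>R v) = integral {0..t} (\<lambda>s. L (a + s *\<^sub>R v) v)"
    unfolding action_def vd ..
qed

text \<open>On the reals \<open>Inf\<close> is a lower bound only for sets that are bounded below;
  superlinearity with \<open>K = 0\<close> bounds all actions below by
  \<open>- C * t\<close>.\<close>

lemma fundamental_solution_le:
  assumes "admissible L 0 t \<xi>" "\<xi> 0 = x" "\<xi> t = z" "t \<ge> 0"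
  shows "A t x z \<le> action L 0 t \<xi>"
proof -
  obtain C where C: "\<And>x v. L x v \<ge> 0 * norm v - C"
    using superlinear[OF order_refl] by blast
  have "action L 0 t \<xi> \<ge> 0 \<bullet> (\<xi> t - \<xi> 0) - C * (t - 0)" if "admissible L 0 t \<xi>" for \<xi>
    using that by (rule action_ge_linear) (use C assms in auto)
  then have "bdd_below {action L 0 t \<xi> |\<xi>. admissible L 0 t \<xi> \<and> \<xi> 0 = x \<and> \<xi> t = z}"
    by (intro bdd_belowI[of _ "- C * t"]) auto
  then show ?thesis
    unfolding fundamental_solution_eq using assms by (intro cInf_lower) auto
qed

text \<open>Source of the near-minimizers that take the place of minimizers throughout. The segment
  shows that the set of competitors is nonempty, as the infimum requires.\<close>

lemma fundamental_solution_less: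
  assumes "A t x z < r" "t > 0"
  obtains \<xi> where "admissible L 0 t \<xi>" "\<xi> 0 = x" "\<xi> t = z" "action L 0 t \<xi> < r"
proof -
  have "admissible L 0 t (\<lambda>s. x + s *\<^sub>R ((z - x) /\<^sub>R t))"
    by (rule action_segment) (use assms in auto)
  then have "{action L 0 t \<xi> |\<xi>. admissible L 0 t \<xi> \<and> \<xi> 0 = x \<and> \<xi> t = z} \<noteq> {}"
    using assms(2) by (auto intro!: exI[of _ "\<lambda>s. x + s *\<^sub>R ((z - x) /\<^sub>R t)"])
  from cInf_lessD[OF this assms(1)[unfolded fundamental_solution_eq]] show thesis
    using that by blast
qed

lemma fundamental_solution_segment:
  assumes "t \<ge> 0" and "\<And>s. s \<in> {0..t} \<Longrightarrow> L (a + s *\<^sub>R v) v \<le> B"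
  shows "A t a (a + t *\<^sub>R v) \<le> B * t"
proof -
  have "A t a (a + t *\<^sub>R v) \<le> action L 0 t (\<lambda>s. a + s *\<^sub>R v)"
    by (rule fundamental_solution_le) (use action_segment assms in auto)
  also have "\<dots> = integral {0..t} (\<lambda>s. L (a + s *\<^sub>R v) v)"
    by (rule action_segment) (rule assms)
  also have "\<dots> \<le> integral {0..t} (\<lambda>s. B)"
    by (rule integral_le)
       (use assms in \<open>auto intro!: integrable_continuous_interval continuous_on_L continuous_intros\<close>)
  finally show ?thesis using assms by (simp add: mult.commute)
qed

lemma fundamental_solution_triangle:
  assumes "t > 0" "s > 0"
  shows "A (t + s) x z \<le> A t x q + A s q z"
proof (rule field_le_epsilon)
  fix e :: real assume "e > 0"
  then have e: "A t x q < A t x q + e/2" "A s q z < A s q z + e/2" by auto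
  obtain \<xi> where \<xi>: "admissible L 0 t \<xi>" "\<xi> 0 = x" "\<xi> t = q" "action L 0 t \<xi> < A t x q + e/2"
    using fundamental_solution_less[OF e(1) assms(1)] .
  obtain \<eta> where \<eta>: "admissible L 0 s \<eta>" "\<eta> 0 = q" "\<eta> s = z" "action L 0 s \<eta> < A s q z + e/2"
    using fundamental_solution_less[OF e(2) assms(2)] .
  have \<eta>': "admissible L t (t + s) (\<lambda>r. \<eta> (r - t))" "action L t (t + s) (\<lambda>r. \<eta> (r - t)) = action L 0 s \<eta>"
    using admissible_shift[OF \<eta>(1), of "- t"] by (auto simp: add.commute)
  let ?\<zeta> = "\<lambda>r. if r \<le> t then \<xi> r else \<eta> (r - t)"
  have "admissible L 0 (t + s) ?\<zeta>" "action L 0 (t + s) ?\<zeta> = action L 0 t \<xi> + action L t (t + s) (\<lambda>r. \<eta> (r - t))"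
    by (rule admissible_concat[OF \<xi>(1) \<eta>'(1)]; use \<xi> \<eta> assms in simp)+
  then have "A (t + s) x z \<le> action L 0 t \<xi> + action L 0 s \<eta>"
    using fundamental_solution_le[of "t + s" ?\<zeta> x z] \<xi> \<eta> \<eta>' assms by auto
  then show "A (t + s) x z \<le> A t x q + A s q z + e"
    using \<xi>(4) \<eta>(4) by simp
qed

lemma fundamental_solution_le_action:
  assumes "admissible L a b \<xi>" "a \<le> b"
  shows "A (b - a) (\<xi> a) (\<xi> b) \<le> action L a b \<xi>"
  using fundamental_solution_le[of "b - a" "\<lambda>s. \<xi> (s + a)"] admissible_shift[OF assms(1), of a] assms(2) by simp

text \<open>Counterpart of \<open>action_ge_chain\<close>. Between the two, each piece of a curve
  can be given a new duration while the points \<open>q i\<close> stay fixed.\<close>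

lemma fundamental_solution_chain:
  assumes "\<And>i. i < n \<Longrightarrow> \<tau> i > 0" "n > 0"
  shows "A (\<Sum>i<n. \<tau> i) (q 0) (q n) \<le> (\<Sum>i<n. A (\<tau> i) (q i) (q (Suc i)))"
  using assms(2,1)
proof (induction n rule: nat_induct_non_zero)
  case (Suc n)
  have "A (\<Sum>i<Suc n. \<tau> i) (q 0) (q (Suc n)) \<le> A (\<Sum>i<n. \<tau> i) (q 0) (q n) + A (\<tau> n) (q n) (q (Suc n))"
    unfolding sum.lessThan_Suc
    by (rule fundamental_solution_triangle) (use Suc in \<open>auto intro!: sum_pos\<close>)
  then show ?case using Suc by auto
qed simp

lemma action_ge_chain:
  assumes adm: "admissible L 0 t \<xi>" and \<delta>: "\<delta> \<ge> 0" "real n * \<delta> \<le> t"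
  shows "(\<Sum>i<n. A \<delta> (\<xi> (real i * \<delta>)) (\<xi> (real (Suc i) * \<delta>))) \<le> action L 0 (real n * \<delta>) \<xi>"
  using \<delta>(2)
proof (induction n)
  case 0
  then show ?case by (simp add: action_def)
next
  case (Suc n)
  have le: "real n * \<delta> \<le> real (Suc n) * \<delta>" using \<delta> by (intro mult_right_mono) auto
  have "admissible L (real n * \<delta>) (real (Suc n) * \<delta>) \<xi>"
    by (rule admissible_subinterval[OF adm]) (use Suc \<delta> in auto)
  from fundamental_solution_le_action[OF this le]
  have "A \<delta> (\<xi> (real n * \<delta>)) (\<xi> (real (Suc n) * \<delta>)) \<le> action L (real n * \<delta>) (real (Suc n) * \<delta>) \<xi>"
    by (simp add: algebra_simps)
  moreover have "action L 0 (real n * \<delta>) \<xi> + action L (real n * \<delta>) (real (Suc n) * \<delta>) \<xi> = action L 0 (real (Suc n) * \<delta>) \<xi>"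
    by (rule action_combine[OF admissible_subinterval[OF adm]]) (use Suc \<delta> le in auto)
  ultimately show ?case using Suc le by simp
qed

end

section \<open>Second derivatives and Tonelli Lagrangians\<close>

text \<open>The mean value theorem for \<open>f (x + r v + s w) - f (x + r v)\<close> in
  \<open>r\<close>, followed by the expansion of \<open>g\<close> at \<open>x\<close>. It serves
  twice: exchanging \<open>v\<close> and \<open>w\<close> gives the symmetry of second derivatives,
  and \<open>w = - v\<close> turns symmetric second differences into a second derivative in
  time.\<close>

lemma second_difference_estimate:
  fixes f :: "'a::real_inner \<Rightarrow> real"
  assumes U: "open U" "x \<in> U" and f: "\<And>y. y \<in> U \<Longrightarrow> (f has_derivative (\<lambda>h. g y \<bullet> h)) (at y)"
    and g: "(g has_derivative G) (at x)" and e: "e > 0"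
  obtains s0 where "s0 > 0" "\<And>s. 0 < s \<Longrightarrow> s < s0 \<Longrightarrow>
    \<bar>f (x + s *\<^sub>R v + s *\<^sub>R w) - f (x + s *\<^sub>R v) - f (x + s *\<^sub>R w) + f x - s\<^sup>2 * (G w \<bullet> v)\<bar> \<le> e * s\<^sup>2"
proof -
  define n where "n = norm v + norm w"
  have n0: "n \<ge> 0" by (simp add: n_def)
  \<comment> \<open>The error at the end is at most \<open>2 * e1 * n * norm v * s\<^sup>2\<close>;
    the \<open>+ 1\<close> avoids a zero denominator.\<close>
  define e1 where "e1 = e / (2 * n * norm v + 1)"
  have pos: "2 * n * norm v + 1 > 0" using n0 by (simp add: add_nonneg_pos)
  have e1: "e1 > 0" using e pos by (simp add: e1_def)
  obtain d1 where d1: "d1 > 0" "\<And>y. norm (y - x) < d1 \<Longrightarrow> norm (g y - g x - G (y - x)) \<le> e1 * norm (y - x)"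
    using g e1 unfolding has_derivative_at_alt by blast
  obtain d2 where d2: "d2 > 0" "ball x d2 \<subseteq> U"
    using U openE by blast
  define d where "d = min d1 d2"
  have d: "d > 0" using d1 d2 by (simp add: d_def)
  have lin: "linear G" using g has_derivative_linear by blast
  show thesis
  proof (rule that[of "d / (n + 1)"])
    show "d / (n + 1) > 0" using d n0 by (simp add: add_nonneg_pos)
    fix s :: real assume s: "0 < s" "s < d / (n + 1)"
    have sn: "s * n < d"
    proof -
      have "s * n \<le> s * (n + 1)" using s by simp
      also have "\<dots> < d" using s n0 by (simp add: pos_less_divide_eq)
      finally show ?thesis .
    qed
    have near: "norm (r *\<^sub>R v + t *\<^sub>R w) \<le> s * n" if "0 \<le> r" "r \<le> s" "0 \<le> t" "t \<le> s" for r t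
    proof -
      have "norm (r *\<^sub>R v + t *\<^sub>R w) \<le> r * norm v + t * norm w"
        using norm_triangle_ineq[of "r *\<^sub>R v" "t *\<^sub>R w"] that by simp
      also have "\<dots> \<le> s * norm v + s * norm w"
        by (intro add_mono mult_right_mono) (use that in auto)
      finally show ?thesis by (simp add: n_def algebra_simps)
    qed
    have inU: "x + r *\<^sub>R v + t *\<^sub>R w \<in> U" if "0 \<le> r" "r \<le> s" "0 \<le> t" "t \<le> s" for r t
    proof -
      have "dist x (x + r *\<^sub>R v + t *\<^sub>R w) = norm (r *\<^sub>R v + t *\<^sub>R w)"
        by (metis add.assoc add_diff_cancel_left' dist_commute dist_norm)
      then show ?thesis using near[OF that] sn d2 by (auto simp: d_def)
    qed
    define \<phi> where "\<phi> r = f (x + r *\<^sub>R v + s *\<^sub>R w) - f (x + r *\<^sub>R v)" for r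
    have "(\<phi> has_real_derivative (g (x + r *\<^sub>R v + s *\<^sub>R w) - g (x + r *\<^sub>R v)) \<bullet> v) (at r)"
      if r: "0 \<le> r" "r \<le> s" for r
    proof -
      have 1: "((\<lambda>r. f (x + r *\<^sub>R v + s *\<^sub>R w)) has_derivative (\<lambda>h. g (x + r *\<^sub>R v + s *\<^sub>R w) \<bullet> (h *\<^sub>R v))) (at r)"
        by (rule has_derivative_compose[where g=f]) (use inU[of r s] r s in \<open>auto intro!: derivative_eq_intros f\<close>)
      have 2: "((\<lambda>r. f (x + r *\<^sub>R v)) has_derivative (\<lambda>h. g (x + r *\<^sub>R v) \<bullet> (h *\<^sub>R v))) (at r)"
        by (rule has_derivative_compose[where g=f]) (use inU[of r 0] r s in \<open>auto intro!: derivative_eq_intros f\<close>)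
      show ?thesis
        unfolding \<phi>_def has_field_derivative_def
        by (rule has_derivative_eq_rhs[OF has_derivative_diff[OF 1 2]]) (auto simp: algebra_simps)
    qed
    from MVT2[OF s(1) this] obtain r where r: "0 < r" "r < s"
      "\<phi> s - \<phi> 0 = (s - 0) * ((g (x + r *\<^sub>R v + s *\<^sub>R w) - g (x + r *\<^sub>R v)) \<bullet> v)" by blast
    define a where "a = g (x + (r *\<^sub>R v + s *\<^sub>R w)) - g x - G (r *\<^sub>R v + s *\<^sub>R w)"
    define b where "b = g (x + (r *\<^sub>R v + 0 *\<^sub>R w)) - g x - G (r *\<^sub>R v + 0 *\<^sub>R w)"
    have "norm a \<le> e1 * norm (r *\<^sub>R v + s *\<^sub>R w)"
      using d1(2)[of "x + (r *\<^sub>R v + s *\<^sub>R w)"] near[of r s] r s sn unfolding a_def d_def by auto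
    also have "\<dots> \<le> e1 * (s * n)"
      by (intro mult_left_mono near) (use r s e1 in auto)
    finally have na: "norm a \<le> e1 * (s * n)" .
    have "norm b \<le> e1 * norm (r *\<^sub>R v + 0 *\<^sub>R w)"
      using d1(2)[of "x + (r *\<^sub>R v + 0 *\<^sub>R w)"] near[of r 0] r s sn unfolding b_def d_def by auto
    also have "\<dots> \<le> e1 * (s * n)"
      by (intro mult_left_mono near) (use r s e1 in auto)
    finally have nb: "norm b \<le> e1 * (s * n)" .
    have ab: "g (x + r *\<^sub>R v + s *\<^sub>R w) - g (x + r *\<^sub>R v) = s *\<^sub>R G w + (a - b)"
      unfolding a_def b_def using lin by (simp add: linear_add linear_scale linear_0 add.assoc)
    have "f (x + s *\<^sub>R v + s *\<^sub>R w) - f (x + s *\<^sub>R v) - f (x + s *\<^sub>R w) + f x = \<phi> s - \<phi> 0"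
      by (simp add: \<phi>_def)
    also have "\<dots> = s\<^sup>2 * (G w \<bullet> v) + s * ((a - b) \<bullet> v)"
      using r(3) unfolding ab by (simp add: inner_add_left power2_eq_square algebra_simps)
    finally have eq: "f (x + s *\<^sub>R v + s *\<^sub>R w) - f (x + s *\<^sub>R v) - f (x + s *\<^sub>R w) + f x - s\<^sup>2 * (G w \<bullet> v)
      = s * ((a - b) \<bullet> v)" by simp
    have "\<bar>(a - b) \<bullet> v\<bar> \<le> norm (a - b) * norm v" by (rule Cauchy_Schwarz_ineq2)
    also have "\<dots> \<le> (2 * (e1 * (s * n))) * norm v"
      using na nb norm_triangle_ineq4[of a b] by (intro mult_right_mono) auto
    also have "\<dots> = s * (e1 * (2 * n * norm v))" by simp
    also have "\<dots> \<le> s * e"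
      using s e1 pos e by (intro mult_left_mono) (auto simp: e1_def field_simps)
    finally have "\<bar>s * ((a - b) \<bullet> v)\<bar> \<le> s * (s * e)"
      using s by (simp add: abs_mult)
    then show "\<bar>f (x + s *\<^sub>R v + s *\<^sub>R w) - f (x + s *\<^sub>R v) - f (x + s *\<^sub>R w) + f x - s\<^sup>2 * (G w \<bullet> v)\<bar> \<le> e * s\<^sup>2"
      unfolding eq by (simp add: power2_eq_square mult_ac)
  qed
qed

lemma second_derivative_symmetric:
  fixes f :: "'a::real_inner \<Rightarrow> real"
  assumes U: "open U" "x \<in> U" and f: "\<And>y. y \<in> U \<Longrightarrow> (f has_derivative (\<lambda>h. g y \<bullet> h)) (at y)"
    and g: "(g has_derivative G) (at x)"
  shows "G v \<bullet> w = G w \<bullet> v"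
proof (rule ccontr)
  assume "G v \<bullet> w \<noteq> G w \<bullet> v"
  define e where "e = \<bar>G v \<bullet> w - G w \<bullet> v\<bar> / 3"
  have e: "e > 0" using \<open>G v \<bullet> w \<noteq> G w \<bullet> v\<close> by (simp add: e_def)
  obtain s1 where s1: "s1 > 0" "\<And>s. 0 < s \<Longrightarrow> s < s1 \<Longrightarrow>
    \<bar>f (x + s *\<^sub>R v + s *\<^sub>R w) - f (x + s *\<^sub>R v) - f (x + s *\<^sub>R w) + f x - s\<^sup>2 * (G w \<bullet> v)\<bar> \<le> e * s\<^sup>2"
    using second_difference_estimate[OF U f g e, where v=v and w=w] by blast
  obtain s2 where s2: "s2 > 0" "\<And>s. 0 < s \<Longrightarrow> s < s2 \<Longrightarrow>
    \<bar>f (x + s *\<^sub>R w + s *\<^sub>R v) - f (x + s *\<^sub>R w) - f (x + s *\<^sub>R v) + f x - s\<^sup>2 * (G v \<bullet> w)\<bar> \<le> e * s\<^sup>2"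
    using second_difference_estimate[OF U f g e, where v=w and w=v] by blast
  define s where "s = min s1 s2 / 2"
  have s: "0 < s" "s < s1" "s < s2" using s1 s2 by (auto simp: s_def)
  have comm: "x + s *\<^sub>R w + s *\<^sub>R v = x + s *\<^sub>R v + s *\<^sub>R w" by simp
  have "\<bar>s\<^sup>2 * (G v \<bullet> w) - s\<^sup>2 * (G w \<bullet> v)\<bar> \<le> 2 * (e * s\<^sup>2)"
    using s1(2)[OF s(1,2)] s2(2)[OF s(1,3)] unfolding comm by linarith
  then have "s\<^sup>2 * (3 * e) \<le> s\<^sup>2 * (2 * e)"
    unfolding right_diff_distrib[symmetric] abs_mult e_def by (simp add: mult_ac)
  then show False using s e by simp
qed

text \<open>\<open>C_ext\<close> differentiates each directional derivative \<open>f' x v\<close>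
  separately. Summing over the basis assembles them into one gradient field \<open>g\<close> with a
  derivative of its own.\<close>

lemma C2_gradient:
  fixes f :: "'a::euclidean_space \<Rightarrow> real"
  assumes "open U" "C_on 2 U f"
  obtains g G where "\<And>x. x \<in> U \<Longrightarrow> (f has_derivative (\<lambda>h. g x \<bullet> h)) (at x)"
    "\<And>x. x \<in> U \<Longrightarrow> (g has_derivative G x) (at x)" "\<And>v. continuous_on U (\<lambda>x. G x v)"
    "\<And>x v w. x \<in> U \<Longrightarrow> G x v \<bullet> w = G x w \<bullet> v"
proof -
  obtain f' where f': "\<And>x. x \<in> U \<Longrightarrow> (f has_derivative f' x) (at x)"
     "\<And>v. C_ext (Suc 0) U U (\<lambda>x. f' x v)"
    using assms(2) unfolding C_on_def numeral_2_eq_2 C_ext.simps(2)[of "Suc 0"] by blast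
  have "\<exists>f''. (\<forall>x\<in>U. ((\<lambda>x. f' x v) has_derivative f'' x) (at x)) \<and> (\<forall>w. continuous_on U (\<lambda>x. f'' x w))" for v
    using f'(2)[of v] by simp
  then obtain f'' where f'': "\<And>v x. x \<in> U \<Longrightarrow> ((\<lambda>x. f' x v) has_derivative f'' v x) (at x)"
     "\<And>v w. continuous_on U (\<lambda>x. f'' v x w)"
    by metis
  define g where "g x = (\<Sum>i\<in>Basis. f' x i *\<^sub>R i)" for x
  define G where "G x w = (\<Sum>i\<in>Basis. f'' i x w *\<^sub>R i)" for x w
  have gf: "f' x h = g x \<bullet> h" if "x \<in> U" for x h
  proof -
    have lin: "linear (f' x)" using f'(1)[OF that] has_derivative_linear by blast
    have "f' x h = f' x (\<Sum>i\<in>Basis. (h \<bullet> i) *\<^sub>R i)" by (simp add: euclidean_representation)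
    also have "\<dots> = (\<Sum>i\<in>Basis. (h \<bullet> i) * f' x i)"
      using lin by (simp add: linear_sum linear_scale)
    also have "\<dots> = g x \<bullet> h" by (simp add: g_def inner_sum_right inner_commute mult.commute)
    finally show ?thesis .
  qed
  have 1: "(f has_derivative (\<lambda>h. g x \<bullet> h)) (at x)" if "x \<in> U" for x
    using f'(1)[OF that] gf[OF that] by (metis (no_types, lifting) ext has_derivative_eq_rhs)
  have 2: "(g has_derivative G x) (at x)" if "x \<in> U" for x
    unfolding g_def G_def by (intro has_derivative_sum has_derivative_scaleR_left f''(1) that)
  show thesis
  proof
    show "continuous_on U (\<lambda>x. G x v)" for v
      unfolding G_def by (intro continuous_intros f'')
    show "G x v \<bullet> w = G x w \<bullet> v" if "x \<in> U" for x v w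
      by (rule second_derivative_symmetric[OF assms(1) that 1 2[OF that]])
  qed (use 1 2 in auto)
qed

lemma Lipschitz_on_compact_convex:
  fixes g :: "'a::euclidean_space \<Rightarrow> 'b::euclidean_space"
  assumes S: "compact S" "convex S" and g: "\<And>x. x \<in> S \<Longrightarrow> (g has_derivative G x) (at x)"
    and cont: "\<And>v. continuous_on S (\<lambda>x. G x v)"
  obtains B where "B \<ge> 0" "\<And>x y. x \<in> S \<Longrightarrow> y \<in> S \<Longrightarrow> norm (g x - g y) \<le> B * norm (x - y)"
proof -
  have "\<exists>b. \<forall>x\<in>S. norm (G x v) \<le> b" for v
    using compact_imp_bounded[OF compact_continuous_image[OF cont S(1)], of v] unfolding bounded_iff by auto
  then obtain b where b: "\<And>v x. x \<in> S \<Longrightarrow> norm (G x v) \<le> b v" by metis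
  \<comment> \<open>Continuity of \<open>G\<close> is given direction by direction, so the operator
    norm is bounded through the basis vectors.\<close>
  define B where "B = (\<Sum>i\<in>Basis. \<bar>b i\<bar>)"
  have B0: "B \<ge> 0" by (simp add: B_def sum_nonneg)
  have "onorm (G x) \<le> B" if x: "x \<in> S" for x
  proof (rule onorm_bound[OF B0])
    fix h
    have lin: "linear (G x)" using g[OF x] has_derivative_linear by blast
    have "G x h = G x (\<Sum>i\<in>Basis. (h \<bullet> i) *\<^sub>R i)" by (simp add: euclidean_representation)
    also have "\<dots> = (\<Sum>i\<in>Basis. (h \<bullet> i) *\<^sub>R G x i)"
      using lin by (simp add: linear_sum linear_scale)
    finally have "norm (G x h) \<le> (\<Sum>i\<in>Basis. norm ((h \<bullet> i) *\<^sub>R G x i))" by (metis norm_sum)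
    also have "\<dots> \<le> (\<Sum>i\<in>Basis. norm h * \<bar>b i\<bar>)"
    proof (rule sum_mono)
      fix i :: 'a assume i: "i \<in> Basis"
      have "norm (G x i) \<le> \<bar>b i\<bar>" using b[OF x, of i] by simp
      then show "norm ((h \<bullet> i) *\<^sub>R G x i) \<le> norm h * \<bar>b i\<bar>"
        using Basis_le_norm[OF i, of h] by (simp add: mult_mono')
    qed
    also have "\<dots> = B * norm h" by (simp add: B_def sum_distrib_left mult.commute sum_distrib_right)
    finally show "norm (G x h) \<le> B * norm h" .
  qed
  then have "norm (g x - g y) \<le> B * norm (x - y)" if "x \<in> S" "y \<in> S" for x y
    using differentiable_bound[OF S(2) has_derivative_at_withinI[OF g], of B y x] that by (simp add: norm_minus_commute)
  then show thesis using that B0 by blast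
qed

section \<open>Gradient, convexity and local bounds of a Tonelli Lagrangian\<close>

context tonelli
begin

text \<open>The gradient in both variables jointly, a field on the product space. Gradients are
  unique, so the choice is determined.\<close>

definition "gradL = (SOME g. \<forall>p. ((\<lambda>(x, v). L x v) has_derivative (\<lambda>h. g p \<bullet> h)) (at p))"
definition "Lx x v = fst (gradL (x, v))"
definition "Lv x v = snd (gradL (x, v))"

lemma gradL:
  obtains G where "\<And>p. ((\<lambda>(x, v). L x v) has_derivative (\<lambda>h. gradL p \<bullet> h)) (at p)"
    "\<And>p. (gradL has_derivative G p) (at p)" "\<And>v. continuous_on UNIV (\<lambda>p. G p v)"
proof -
  have "C_on 2 UNIV (\<lambda>(x, v). L x v)"
    using tonelli by (simp add: tonelli_lagrangian_def)
  from C2_gradient[OF open_UNIV this] obtain g G where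
    g: "\<And>p. ((\<lambda>(x, v). L x v) has_derivative (\<lambda>h. g p \<bullet> h)) (at p)"
    "\<And>p. (g has_derivative G p) (at p)" "\<And>v. continuous_on UNIV (\<lambda>p. G p v)" by (metis UNIV_I)
  have *: "\<And>p. ((\<lambda>(x, v). L x v) has_derivative (\<lambda>h. gradL p \<bullet> h)) (at p)"
    unfolding gradL_def using someI[of "\<lambda>g. \<forall>p. ((\<lambda>(x, v). L x v) has_derivative (\<lambda>h. g p \<bullet> h)) (at p)" g] g(1)
    by blast
  have "gradL p \<bullet> h = g p \<bullet> h" for p h
    using has_derivative_unique[OF *[of p] g(1)[of p]] by meson
  then have "gradL = g" by (intro ext) (metis vector_eq_rdot)
  then show thesis using that * g by blast
qed

lemma gradL_inner: "gradL (x, v) \<bullet> (h, k) = Lx x v \<bullet> h + Lv x v \<bullet> k"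
  by (simp add: Lx_def Lv_def inner_prod_def)

lemma GDERIV_Lv: "GDERIV (L x) v :> Lv x v"
proof -
  obtain G where G: "\<And>p. ((\<lambda>(x, v). L x v) has_derivative (\<lambda>h. gradL p \<bullet> h)) (at p)"
    using gradL by blast
  have "((\<lambda>v. case (x, v) of (x, v) \<Rightarrow> L x v) has_derivative (\<lambda>k. gradL (x, v) \<bullet> (0, k))) (at v)"
    by (rule has_derivative_compose[where g="\<lambda>(x, v). L x v" and f="\<lambda>v. (x, v)", OF _ G]) (auto intro!: derivative_eq_intros)
  then show ?thesis
    by (simp add: gderiv_def gradL_inner inner_commute[of _ "Lv x v"] inner_commute[of _ "Lx x v"])
qed

lemma GDERIV_Lx: "GDERIV (\<lambda>x. L x v) x :> Lx x v"
proof -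
  obtain G where G: "\<And>p. ((\<lambda>(x, v). L x v) has_derivative (\<lambda>h. gradL p \<bullet> h)) (at p)"
    using gradL by blast
  have "((\<lambda>x. case (x, v) of (x, v) \<Rightarrow> L x v) has_derivative (\<lambda>h. gradL (x, v) \<bullet> (h, 0))) (at x)"
    by (rule has_derivative_compose[where g="\<lambda>(x, v). L x v" and f="\<lambda>x. (x, v)", OF _ G]) (auto intro!: derivative_eq_intros)
  then show ?thesis
    by (simp add: gderiv_def gradL_inner inner_commute[of _ "Lv x v"] inner_commute[of _ "Lx x v"])
qed

text \<open>The slope \<psi> of \<open>L x\<close> along the segment from \<open>v\<close> to
  \<open>w\<close> is nondecreasing because its derivative is a value of the Hessian form; the mean
  value theorem then compares the increment of \<open>L x\<close> with
  \<open>\<psi> 0\<close>.\<close>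

lemma L_support: "L x w \<ge> L x v + Lv x v \<bullet> (w - v)"
proof (cases "w = v")
  case False
  define d where "d = w - v"
  have d: "d \<noteq> 0" using False by (simp add: d_def)
  define \<psi> where "\<psi> s = Lv x (v + s *\<^sub>R d) \<bullet> d" for s
  have line: "((\<lambda>s. v + s *\<^sub>R d) has_derivative (\<lambda>h. h *\<^sub>R d)) (at s)" for s
    by (auto intro!: derivative_eq_intros)
  have \<phi>: "((\<lambda>s. L x (v + s *\<^sub>R d)) has_real_derivative \<psi> s) (at s)" for s
  proof -
    have "((\<lambda>s. L x (v + s *\<^sub>R d)) has_derivative (\<lambda>h. (h *\<^sub>R d) \<bullet> Lv x (v + s *\<^sub>R d))) (at s)"
      by (rule has_derivative_compose[where g="L x", OF line GDERIV_Lv[unfolded gderiv_def]])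
    then show ?thesis
      unfolding has_field_derivative_def
      by (rule has_derivative_eq_rhs) (rule ext, simp add: \<psi>_def inner_commute mult.commute)
  qed
  have \<psi>: "\<exists>D. (\<psi> has_real_derivative D) (at s) \<and> D \<ge> 0" for s
  proof -
    obtain M where M: "has_hessian (L x) M (v + s *\<^sub>R d)" "\<And>h. h \<noteq> 0 \<Longrightarrow> h \<bullet> (M *v h) > 0"
      using tonelli unfolding tonelli_lagrangian_def by blast
    obtain g where g: "\<forall>\<^sub>F w in nhds (v + s *\<^sub>R d). GDERIV (L x) w :> g w"
       "(g has_derivative (\<lambda>h. M *v h)) (at (v + s *\<^sub>R d))"
      using M(1) unfolding has_hessian_def by blast
    \<comment> \<open>\<open>has_hessian\<close> only asserts that some gradient field exists;
      uniqueness of gradients identifies it with \<open>Lv x\<close> near the point, so its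
      derivative carries over.\<close>
    have ev: "\<forall>\<^sub>F w in nhds (v + s *\<^sub>R d). g w = Lv x w"
      using g(1) by eventually_elim (use GDERIV_Lv in \<open>metis gderiv_def has_derivative_unique vector_eq_ldot\<close>)
    have "(Lv x has_derivative (\<lambda>h. M *v h)) (at (v + s *\<^sub>R d))"
      using has_derivative_transform_eventually[OF g(2)] ev eventually_nhds_x_imp_x[OF ev]
      by (simp add: eventually_at_filter eventually_mono)
    then have "((\<lambda>s. Lv x (v + s *\<^sub>R d)) has_derivative (\<lambda>h. M *v (h *\<^sub>R d))) (at s)"
      by (rule has_derivative_compose[where g="Lv x", OF line])
    then have "(\<psi> has_derivative (\<lambda>h. (M *v (h *\<^sub>R d)) \<bullet> d)) (at s)"
      unfolding \<psi>_def by (rule has_derivative_inner_left)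
    then have "(\<psi> has_real_derivative d \<bullet> (M *v d)) (at s)"
      unfolding has_field_derivative_def
      by (rule has_derivative_eq_rhs) (rule ext, simp add: matrix_vector_mult_scaleR inner_commute mult.commute)
    then show ?thesis using M(2)[OF d] less_imp_le by blast
  qed
  obtain s where s: "0 < s" "s < 1" "L x (v + 1 *\<^sub>R d) - L x (v + 0 *\<^sub>R d) = (1 - 0) * \<psi> s"
    using MVT2[of 0 1 "\<lambda>s. L x (v + s *\<^sub>R d)" \<psi>] \<phi> by auto
  have "\<psi> 0 \<le> \<psi> s"
    by (rule DERIV_nonneg_imp_nondecreasing) (use s \<psi> in auto)
  then show ?thesis using s(3) by (simp add: \<psi>_def d_def)
qed simp

lemma local_bounds:
  obtains B where "B \<ge> 0"
    "\<And>x v. norm x \<le> R \<Longrightarrow> norm v \<le> R \<Longrightarrow> \<bar>L x v\<bar> \<le> B \<and> norm (Lx x v) \<le> B \<and> norm (Lv x v) \<le> B"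
    "\<And>x y v w. norm x \<le> R \<Longrightarrow> norm y \<le> R \<Longrightarrow> norm v \<le> R \<Longrightarrow> norm w \<le> R \<Longrightarrow>
       \<bar>L x v - L y w\<bar> \<le> B * (norm (x - y) + norm (v - w)) \<and> norm (Lv x v - Lv y w) \<le> B * (norm (x - y) + norm (v - w))"
proof -
  let ?S = "cball (0::real^'n) R \<times> cball (0::real^'n) R"
  have S: "compact ?S" "convex ?S" by (auto intro: compact_Times convex_Times)
  obtain G where G: "\<And>p. ((\<lambda>(x, v). L x v) has_derivative (\<lambda>h. gradL p \<bullet> h)) (at p)"
    "\<And>p. (gradL has_derivative G p) (at p)" "\<And>v. continuous_on UNIV (\<lambda>p. G p v)"
    using gradL by blast
  have cg: "continuous_on ?S gradL"
    by (intro continuous_at_imp_continuous_on ballI has_derivative_continuous[OF G(2)])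
  obtain b1 where b1: "\<And>p. p \<in> ?S \<Longrightarrow> norm (case p of (x, v) \<Rightarrow> L x v) \<le> b1"
    using compact_imp_bounded[OF compact_continuous_image[OF continuous_L S(1)]] unfolding bounded_iff by auto
  obtain b2 where b2: "\<And>p. p \<in> ?S \<Longrightarrow> norm (gradL p) \<le> b2"
    using compact_imp_bounded[OF compact_continuous_image[OF cg S(1)]] unfolding bounded_iff by auto
  obtain b3 where b3: "b3 \<ge> 0" "\<And>p q. p \<in> ?S \<Longrightarrow> q \<in> ?S \<Longrightarrow> norm (gradL p - gradL q) \<le> b3 * norm (p - q)"
    using Lipschitz_on_compact_convex[OF S G(2) continuous_on_subset[OF G(3) subset_UNIV]] by blast
  obtain b4 where b4: "b4 \<ge> 0" "\<And>p q. p \<in> ?S \<Longrightarrow> q \<in> ?S \<Longrightarrow>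
      norm ((case p of (x, v) \<Rightarrow> L x v) - (case q of (x, v) \<Rightarrow> L x v)) \<le> b4 * norm (p - q)"
    using Lipschitz_on_compact_convex[OF S G(1)] continuous_on_inner[OF cg continuous_on_const] by blast
  define B where "B = \<bar>b1\<bar> + \<bar>b2\<bar> + b3 + b4"
  have B0: "B \<ge> 0" using b3 b4 by (simp add: B_def)
  show thesis
  proof (rule that[OF B0])
    fix x v :: "real^'n" assume xv: "norm x \<le> R" "norm v \<le> R"
    have "norm (Lx x v) \<le> norm (gradL (x, v))" "norm (Lv x v) \<le> norm (gradL (x, v))"
      using norm_fst_le[of "fst (gradL (x, v))" "snd (gradL (x, v))"] norm_snd_le[of "snd (gradL (x, v))" "fst (gradL (x, v))"]
      by (simp_all add: Lx_def Lv_def)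
    then show "\<bar>L x v\<bar> \<le> B \<and> norm (Lx x v) \<le> B \<and> norm (Lv x v) \<le> B"
      using b1[of "(x, v)"] b2[of "(x, v)"] xv b3(1) b4(1) by (auto simp: B_def)
  next
    fix x y v w :: "real^'n"
    assume R: "norm x \<le> R" "norm y \<le> R" "norm v \<le> R" "norm w \<le> R"
    have n: "norm ((x, v) - (y, w)) \<le> norm (x - y) + norm (v - w)"
      using norm_Pair_le[of "x - y" "v - w"] by simp
    have le: "b * norm ((x, v) - (y, w)) \<le> B * (norm (x - y) + norm (v - w))" if "0 \<le> b" "b \<le> B" for b
      using that n by (intro mult_mono) auto
    have "\<bar>L x v - L y w\<bar> \<le> b4 * norm ((x, v) - (y, w))"
      using b4(2)[of "(x, v)" "(y, w)"] R by auto
    moreover have "norm (Lv x v - Lv y w) \<le> norm (gradL (x, v) - gradL (y, w))"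
      unfolding Lv_def snd_diff[symmetric] by (metis norm_snd_le prod.collapse)
    moreover have "norm (gradL (x, v) - gradL (y, w)) \<le> b3 * norm ((x, v) - (y, w))"
      using b3(2)[of "(x, v)" "(y, w)"] R by auto
    ultimately show "\<bar>L x v - L y w\<bar> \<le> B * (norm (x - y) + norm (v - w)) \<and>
        norm (Lv x v - Lv y w) \<le> B * (norm (x - y) + norm (v - w))"
      using le[of b4] le[of b3] b3(1) b4(1) by (auto simp: B_def)
  qed
qed

text \<open>Superlinearity controls the large velocities, for which no bound on the dependence of \<open>L\<close> on
  the position is available.\<close>

lemma L_support_nearby:
  assumes "\<eta> > 0"
  obtains \<rho> where "\<rho> > 0" "\<And>x v y w. norm x \<le> R \<Longrightarrow> norm v \<le> R \<Longrightarrow> norm (y - x) \<le> \<rho> \<Longrightarrow>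
     L y w \<ge> L x v + Lv x v \<bullet> (w - v) - \<eta>"
proof -
  obtain B where B: "B \<ge> 0" "\<And>x v. norm x \<le> R \<Longrightarrow> norm v \<le> R \<Longrightarrow> \<bar>L x v\<bar> \<le> B \<and> norm (Lx x v) \<le> B \<and> norm (Lv x v) \<le> B"
    using local_bounds[of R] by metis
  have B1: "B + 1 \<ge> 0" using B by simp
  obtain C where C: "C \<ge> 0" "\<And>x v. L x v \<ge> (B + 1) * norm v - C"
    using superlinear[OF B1] by metis
  \<comment> \<open>Beyond the speed \<open>W\<close> the growth \<open>(B + 1) * norm w - C\<close>
    exceeds \<open>B + B * norm w + B * R\<close>, which bounds the supporting affine function from
    above.\<close>
  define W where "W = C + B + B * R"
  define R' where "R' = max (R + 1) W"
  obtain B' where B': "B' \<ge> 0" "\<And>x y v w. norm x \<le> R' \<Longrightarrow> norm y \<le> R' \<Longrightarrow> norm v \<le> R' \<Longrightarrow> norm w \<le> R' \<Longrightarrow>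
       \<bar>L x v - L y w\<bar> \<le> B' * (norm (x - y) + norm (v - w))"
    using local_bounds[of R'] by metis
  define \<rho> where "\<rho> = min 1 (\<eta> / (B' + 1))"
  have \<rho>: "\<rho> > 0" using assms B' by (simp add: \<rho>_def)
  have B\<rho>: "B' * \<rho> \<le> \<eta>"
  proof -
    have "B' * \<rho> \<le> B' * (\<eta> / (B' + 1))" using B' by (intro mult_left_mono) (auto simp: \<rho>_def)
    also have "\<dots> \<le> \<eta>" using B' assms by (simp add: field_simps)
    finally show ?thesis .
  qed
  show thesis
  proof (rule that[OF \<rho>])
    fix x v y w :: "real^'n"
    assume R: "norm x \<le> R" "norm v \<le> R" and y: "norm (y - x) \<le> \<rho>"
    show "L y w \<ge> L x v + Lv x v \<bullet> (w - v) - \<eta>"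
    proof (cases "norm w \<le> W")
      case True
      have "norm y \<le> R + 1"
        using norm_triangle_ineq[of x "y - x"] y R by (auto simp: \<rho>_def)
      then have "\<bar>L y w - L x w\<bar> \<le> B' * (norm (y - x) + norm (w - w))"
        using R True by (intro B'(2)) (auto simp: R'_def)
      also have "\<dots> \<le> B' * \<rho>" using y B' by (simp add: mult_left_mono)
      finally show ?thesis using L_support[of x v w] B\<rho> by linarith
    next
      case False
      have "L x v \<le> B" "norm (Lv x v) \<le> B" using B(2)[OF R] by auto
      have "Lv x v \<bullet> (w - v) \<le> norm (Lv x v) * norm (w - v)" by (rule norm_cauchy_schwarz)
      also have "\<dots> \<le> B * (norm w + norm v)"
        using \<open>norm (Lv x v) \<le> B\<close> B(1) by (intro mult_mono norm_triangle_ineq4) auto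
      also have "\<dots> \<le> B * norm w + B * R"
        using R B(1) by (simp add: algebra_simps mult_left_mono)
      finally have "L x v + Lv x v \<bullet> (w - v) \<le> B + B * norm w + B * R"
        using \<open>L x v \<le> B\<close> by simp
      also have "\<dots> \<le> (B + 1) * norm w - C"
        using False by (simp add: W_def algebra_simps)
      finally show ?thesis using C(2)[of w y] assms by simp
    qed
  qed
qed

end

section \<open>Short-time estimates for the fundamental solution\<close>

context tonelli
begin

lemma fundamental_solution_ge_norm:
  assumes "\<And>x v. L x v \<ge> K * norm v - C" "K \<ge> 0" "t > 0"
  shows "A t a b \<ge> K * norm (b - a) - C * t"
proof (rule field_le_epsilon)
  fix e :: real assume "e > 0"
  then have "A t a b < A t a b + e" by simp
  then obtain \<xi> where \<xi>: "admissible L 0 t \<xi>" "\<xi> 0 = a" "\<xi> t = b" "action L 0 t \<xi> < A t a b + e"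
    using fundamental_solution_less[OF _ assms(3)] by blast
  have "K * norm (\<xi> t - \<xi> 0) \<le> action L 0 t \<xi> + C * (t - 0)"
    by (rule action_ge_norm[OF \<xi>(1) assms(1,2)]) (use assms(3) in auto)
  then show "K * norm (b - a) - C * t \<le> A t a b + e" using \<xi> by simp
qed

lemma fundamental_solution_le_short:
  obtains B where "B \<ge> 0" "\<And>\<delta> a v. 0 \<le> \<delta> \<Longrightarrow> \<delta> \<le> 1 \<Longrightarrow> norm a \<le> R \<Longrightarrow> norm v \<le> R \<Longrightarrow>
    A \<delta> a (a + \<delta> *\<^sub>R v) \<le> \<delta> * (L a v + B * \<delta>)"
proof (cases "R \<ge> 0")
  case True
  obtain B where B: "B \<ge> 0" "\<And>x y v w. norm x \<le> 2 * R \<Longrightarrow> norm y \<le> 2 * R \<Longrightarrow> norm v \<le> 2 * R \<Longrightarrow> norm w \<le> 2 * R \<Longrightarrow>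
       \<bar>L x v - L y w\<bar> \<le> B * (norm (x - y) + norm (v - w))"
    using local_bounds[of "2 * R"] by metis
  \<comment> \<open>Along the segment the position moves by at most \<open>\<delta> * R\<close>, so
    \<open>L\<close> changes by at most \<open>B * R * \<delta>\<close>.\<close>
  show thesis
  proof (rule that[of "B * R"])
    fix \<delta> :: real and a v :: "real^'n"
    assume \<delta>: "0 \<le> \<delta>" "\<delta> \<le> 1" and R: "norm a \<le> R" "norm v \<le> R"
    have "L (a + s *\<^sub>R v) v \<le> L a v + B * R * \<delta>" if s: "s \<in> {0..\<delta>}" for s
    proof -
      have sv: "norm (s *\<^sub>R v) \<le> \<delta> * R" using s R True by (auto intro!: mult_mono)
      also have "\<dots> \<le> 1 * R" using \<delta> True by (intro mult_right_mono) auto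
      finally have "norm (a + s *\<^sub>R v) \<le> 2 * R" using norm_triangle_ineq[of a "s *\<^sub>R v"] R by simp
      then have "\<bar>L (a + s *\<^sub>R v) v - L a v\<bar> \<le> B * (norm ((a + s *\<^sub>R v) - a) + norm (v - v))"
        using R True by (intro B(2)) auto
      also have "\<dots> \<le> B * (\<delta> * R)" using sv B(1) by (auto intro!: mult_left_mono)
      finally show ?thesis by (simp add: mult_ac)
    qed
    from fundamental_solution_segment[OF \<delta>(1) this]
    show "A \<delta> a (a + \<delta> *\<^sub>R v) \<le> \<delta> * (L a v + B * R * \<delta>)" by (simp add: mult.commute)
  qed (use B True in simp)
next
  case False
  show thesis
  proof (rule that[of 0])
    fix \<delta> :: real and a v :: "real^'n"
    assume "norm a \<le> R"
    then have False using False norm_ge_zero[of a] by linarith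
    then show "A \<delta> a (a + \<delta> *\<^sub>R v) \<le> \<delta> * (L a v + 0 * \<delta>)" ..
  qed simp
qed

text \<open>By superlinearity a near-minimizer of short duration stays near \<open>a\<close>. There
  the supporting affine function of \<open>L a\<close> at \<open>v\<close>, lowered by \<eta>, is a
  minorant for all velocities, and \<open>action_ge_linear\<close> turns it into a bound by the
  endpoints.\<close>

lemma fundamental_solution_ge_short:
  assumes "\<eta> > 0"
  obtains \<delta>0 where "\<delta>0 > 0" "\<And>\<delta> a v. 0 < \<delta> \<Longrightarrow> \<delta> < \<delta>0 \<Longrightarrow> norm a \<le> R \<Longrightarrow> norm v \<le> R \<Longrightarrow>
    A \<delta> a (a + \<delta> *\<^sub>R v) \<ge> \<delta> * (L a v - \<eta>)"
proof -
  obtain \<rho> where \<rho>: "\<rho> > 0" "\<And>x v y w. norm x \<le> R \<Longrightarrow> norm v \<le> R \<Longrightarrow> norm (y - x) \<le> \<rho> \<Longrightarrow>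
     L y w \<ge> L x v + Lv x v \<bullet> (w - v) - \<eta>"
    using L_support_nearby[OF assms] by metis
  obtain B where B: "B \<ge> 0" "\<And>x v. norm x \<le> R \<Longrightarrow> norm v \<le> R \<Longrightarrow> \<bar>L x v\<bar> \<le> B \<and> norm (Lx x v) \<le> B \<and> norm (Lv x v) \<le> B"
    using local_bounds[of R] by metis
  obtain C where C: "C \<ge> 0" "\<And>x v. L x v \<ge> 1 * norm v - C"
    using superlinear[OF zero_le_one] by metis
  \<comment> \<open>A competitor whose action is below \<open>\<delta> * B\<close> moves by at most
    \<open>\<delta> * (B + C)\<close>, hence by at most \<rho>.\<close>
  show thesis
  proof (rule that[of "\<rho> / (B + C + 1)"])
    show "\<rho> / (B + C + 1) > 0" using \<rho> B C by simp
    fix \<delta> :: real and a v :: "real^'n"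
    assume \<delta>: "0 < \<delta>" "\<delta> < \<rho> / (B + C + 1)" and R: "norm a \<le> R" "norm v \<le> R"
    show "A \<delta> a (a + \<delta> *\<^sub>R v) \<ge> \<delta> * (L a v - \<eta>)"
    proof (rule ccontr)
      assume "\<not> ?thesis"
      then have "A \<delta> a (a + \<delta> *\<^sub>R v) < \<delta> * (L a v - \<eta>)" by simp
      then obtain \<xi> where \<xi>: "admissible L 0 \<delta> \<xi>" "\<xi> 0 = a" "\<xi> \<delta> = a + \<delta> *\<^sub>R v" "action L 0 \<delta> \<xi> < \<delta> * (L a v - \<eta>)"
        using fundamental_solution_less[OF _ \<delta>(1)] by blast
      have "norm (\<xi> s - a) \<le> \<rho>" if s: "s \<in> {0..\<delta>}" for s
      proof -
        have "1 * norm (\<xi> s - \<xi> 0) \<le> action L 0 \<delta> \<xi> + C * (\<delta> - 0)"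
          by (rule action_ge_norm[OF \<xi>(1) C(2)]) (use s in auto)
        also have "\<dots> \<le> \<delta> * (L a v - \<eta>) + C * \<delta>" using \<xi>(4) by simp
        also have "\<dots> \<le> \<delta> * B + C * \<delta>"
          using B(2)[OF R] assms \<delta> by (intro add_right_mono mult_left_mono) auto
        also have "\<dots> \<le> \<delta> * (B + C + 1)" using \<delta> by (simp add: algebra_simps)
        also have "\<dots> \<le> \<rho>" using \<delta>(2) B C by (simp add: pos_less_divide_eq)
        finally show ?thesis using \<xi> by simp
      qed
      then have "L (\<xi> s) w \<ge> Lv a v \<bullet> w - (Lv a v \<bullet> v - L a v + \<eta>)" if "s \<in> {0..\<delta>}" for s w
        using \<rho>(2)[OF R, of "\<xi> s" w] that by (simp add: inner_diff_right)
      then have "action L 0 \<delta> \<xi> \<ge> Lv a v \<bullet> (\<xi> \<delta> - \<xi> 0) - (Lv a v \<bullet> v - L a v + \<eta>) * (\<delta> - 0)"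
        by (intro action_ge_linear[OF \<xi>(1)]) (use \<delta> in auto)
      also have "Lv a v \<bullet> (\<xi> \<delta> - \<xi> 0) - (Lv a v \<bullet> v - L a v + \<eta>) * (\<delta> - 0) = \<delta> * (L a v - \<eta>)"
        using \<xi> by (simp add: algebra_simps)
      finally show False using \<xi>(4) by simp
    qed
  qed
qed

text \<open>The second-order bound for the perspective function \<open>r \<mapsto> r L (a, v / r)\<close> at \<open>r = 1\<close>.\<close>

lemma perspective_semiconcave:
  assumes "R \<ge> 0"
  obtains C where "C \<ge> 0" "\<And>a v \<theta>. norm a \<le> R \<Longrightarrow> norm v \<le> R \<Longrightarrow> \<bar>\<theta>\<bar> \<le> 1/2 \<Longrightarrow>
    (1 + \<theta>) * L a (v /\<^sub>R (1 + \<theta>)) + (1 - \<theta>) * L a (v /\<^sub>R (1 - \<theta>)) - 2 * L a v \<le> C * \<theta>\<^sup>2"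
proof -
  obtain B where B: "B \<ge> 0" "\<And>x y v w. norm x \<le> 2 * R \<Longrightarrow> norm y \<le> 2 * R \<Longrightarrow> norm v \<le> 2 * R \<Longrightarrow> norm w \<le> 2 * R \<Longrightarrow>
       norm (Lv x v - Lv y w) \<le> B * (norm (x - y) + norm (v - w))"
    using local_bounds[of "2 * R"] by metis
  show thesis
  proof (rule that[of "4 * B * R\<^sup>2"])
    fix a v :: "real^'n" and \<theta> :: real
    assume R: "norm a \<le> R" "norm v \<le> R" and \<theta>: "\<bar>\<theta>\<bar> \<le> 1/2"
    define vp where "vp = v /\<^sub>R (1 + \<theta>)"
    define vm where "vm = v /\<^sub>R (1 - \<theta>)"
    have pos: "1 + \<theta> \<ge> 1/2" "1 - \<theta> \<ge> 1/2" using \<theta> by auto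
    have sc: "r *\<^sub>R (v /\<^sub>R r) = v" if "r \<ge> 1/2" for r :: real using that by simp
    have v: "v = (1 + \<theta>) *\<^sub>R vp" "v = (1 - \<theta>) *\<^sub>R vm"
      by (simp_all only: vp_def vm_def sc[OF pos(1)] sc[OF pos(2)])
    have nb: "norm (v /\<^sub>R r) \<le> 2 * R" if "r \<ge> 1/2" for r
    proof -
      have "norm (v /\<^sub>R r) = norm v / r" using that by (simp add: field_simps)
      also have "\<dots> \<le> R / (1/2)" using R that assms by (intro frac_le) auto
      finally show ?thesis by simp
    qed
    \<comment> \<open>Support is taken at the perturbed velocities \<open>vp\<close> and
      \<open>vm\<close>, not at \<open>v\<close>. The first-order terms then combine to
      \<open>\<theta> * ((Lv a vm - Lv a vp) \<bullet> v)\<close>, which the Lipschitz bound for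
      \<open>Lv\<close> makes quadratic in \<theta>.\<close>
    have 1: "(1 + \<theta>) * L a vp \<le> (1 + \<theta>) * L a v - \<theta> * (Lv a vp \<bullet> v)"
    proof -
      have "v - vp = \<theta> *\<^sub>R vp" by (subst v(1)) (simp add: algebra_simps)
      then have "L a v \<ge> L a vp + Lv a vp \<bullet> (\<theta> *\<^sub>R vp)"
        using L_support[of a vp v] by simp
      then have "(1 + \<theta>) * (L a vp + \<theta> * (Lv a vp \<bullet> vp)) \<le> (1 + \<theta>) * L a v"
        using pos by (intro mult_left_mono) auto
      moreover have eq: "Lv a vp \<bullet> v = (1 + \<theta>) * (Lv a vp \<bullet> vp)" by (subst v(1)) simp
      ultimately show ?thesis unfolding eq by (simp add: algebra_simps)
    qed
    have 2: "(1 - \<theta>) * L a vm \<le> (1 - \<theta>) * L a v + \<theta> * (Lv a vm \<bullet> v)"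
    proof -
      have "v - vm = - \<theta> *\<^sub>R vm" by (subst v(2)) (simp add: algebra_simps)
      then have "L a v \<ge> L a vm + Lv a vm \<bullet> (- \<theta> *\<^sub>R vm)"
        using L_support[of a vm v] by simp
      then have "(1 - \<theta>) * (L a vm - \<theta> * (Lv a vm \<bullet> vm)) \<le> (1 - \<theta>) * L a v"
        using pos by (intro mult_left_mono) auto
      moreover have eq: "Lv a vm \<bullet> v = (1 - \<theta>) * (Lv a vm \<bullet> vm)" by (subst v(2)) simp
      ultimately show ?thesis unfolding eq by (simp add: algebra_simps)
    qed
    have "\<theta> * ((Lv a vm - Lv a vp) \<bullet> v) \<le> \<bar>\<theta>\<bar> * \<bar>(Lv a vm - Lv a vp) \<bullet> v\<bar>"
      unfolding abs_mult[symmetric] by (rule abs_ge_self)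
    also have "\<dots> \<le> \<bar>\<theta>\<bar> * (norm (Lv a vm - Lv a vp) * norm v)"
      by (intro mult_left_mono Cauchy_Schwarz_ineq2) simp
    also have "\<dots> \<le> \<bar>\<theta>\<bar> * ((B * norm (vm - vp)) * R)"
    proof (intro mult_left_mono mult_mono)
      show "norm (Lv a vm - Lv a vp) \<le> B * norm (vm - vp)"
        using B(2)[of a a vm vp] nb pos R assms by (simp add: vm_def vp_def)
    qed (use R B assms in auto)
    finally have 3: "\<theta> * ((Lv a vm - Lv a vp) \<bullet> v) \<le> \<bar>\<theta>\<bar> * ((B * norm (vm - vp)) * R)" .
    have 4: "norm (vm - vp) \<le> 4 * \<bar>\<theta>\<bar> * R"
    proof -
      have "vm - vp = (1 / (1 - \<theta>) - 1 / (1 + \<theta>)) *\<^sub>R v"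
        unfolding vm_def vp_def scaleR_diff_left inverse_eq_divide ..
      also have "1 / (1 - \<theta>) - 1 / (1 + \<theta>) = 2 * \<theta> / ((1 - \<theta>) * (1 + \<theta>))"
        using pos by (simp add: field_simps)
      finally have eq: "norm (vm - vp) = 2 * \<bar>\<theta>\<bar> / ((1 - \<theta>) * (1 + \<theta>)) * norm v"
        using pos by (simp add: abs_mult)
      have "\<theta>\<^sup>2 \<le> (1/2)\<^sup>2" using \<theta> by (intro abs_le_square_iff[THEN iffD1]) auto
      then have "(1 - \<theta>) * (1 + \<theta>) \<ge> 1/2" by (simp add: algebra_simps power2_eq_square)
      then have "2 * \<bar>\<theta>\<bar> / ((1 - \<theta>) * (1 + \<theta>)) \<le> 2 * \<bar>\<theta>\<bar> / (1/2)"
        by (intro divide_left_mono) auto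
      then show ?thesis unfolding eq using R by (intro mult_mono) auto
    qed
    note 3
    also have "\<bar>\<theta>\<bar> * ((B * norm (vm - vp)) * R) \<le> \<bar>\<theta>\<bar> * ((B * (4 * \<bar>\<theta>\<bar> * R)) * R)"
      using B(1) assms by (intro mult_left_mono mult_right_mono 4) auto
    also have "\<dots> = 4 * B * R\<^sup>2 * (\<bar>\<theta>\<bar> * \<bar>\<theta>\<bar>)" by (simp add: power2_eq_square mult_ac)
    also have "\<bar>\<theta>\<bar> * \<bar>\<theta>\<bar> = \<theta>\<^sup>2" by (simp add: power2_eq_square)
    finally have "\<theta> * (Lv a vm \<bullet> v) - \<theta> * (Lv a vp \<bullet> v) \<le> 4 * B * R\<^sup>2 * \<theta>\<^sup>2"
      by (simp add: inner_diff_left algebra_simps)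
    then show "(1 + \<theta>) * L a (v /\<^sub>R (1 + \<theta>)) + (1 - \<theta>) * L a (v /\<^sub>R (1 - \<theta>)) - 2 * L a v \<le> 4 * B * R\<^sup>2 * \<theta>\<^sup>2"
      using 1 2 unfolding vp_def[symmetric] vm_def[symmetric] by (simp add: algebra_simps)
  qed (use B in simp)
qed

text \<open>To go on from \<open>z\<close> with constant velocity \<open>v\<close> for a short time
  \<open>h\<close> is one way to reach \<open>z + h v\<close>. Dividing the triangle inequality by
  \<open>h\<close> leaves the claim; taken over all \<open>v\<close> it is the subsolution half of
  the Hamilton-Jacobi equation.\<close>

lemma fundamental_solution_subsolution:
  assumes "t > 0" and D: "((\<lambda>(t, z). A t x z) has_derivative (\<lambda>h. \<gamma> \<bullet> h)) (at (t, z))"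
  shows "\<gamma> \<bullet> (1, v) \<le> L z v"
proof -
  define R where "R = max (norm z) (norm v)"
  obtain B where B: "B \<ge> 0" "\<And>\<delta> a v. 0 \<le> \<delta> \<Longrightarrow> \<delta> \<le> 1 \<Longrightarrow> norm a \<le> R \<Longrightarrow> norm v \<le> R \<Longrightarrow>
    A \<delta> a (a + \<delta> *\<^sub>R v) \<le> \<delta> * (L a v + B * \<delta>)"
    using fundamental_solution_le_short[of R] by metis
  define \<phi> where "\<phi> h = A (t + h) x (z + h *\<^sub>R v)" for h
  have line: "((\<lambda>h. (t + h, z + h *\<^sub>R v)) has_derivative (\<lambda>h. (h, h *\<^sub>R v))) (at 0)"
    by (auto intro!: derivative_eq_intros)
  have "((\<lambda>h. case (t + h, z + h *\<^sub>R v) of (t, z) \<Rightarrow> A t x z) has_derivative (\<lambda>h. \<gamma> \<bullet> (h, h *\<^sub>R v))) (at 0)"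
    by (rule has_derivative_compose[where g="\<lambda>(t, z). A t x z", OF line]) (use D in simp)
  then have "(\<phi> has_derivative (\<lambda>h. \<gamma> \<bullet> (h, h *\<^sub>R v))) (at 0)"
    by (simp add: \<phi>_def[abs_def])
  then have "(\<phi> has_real_derivative \<gamma> \<bullet> (1, v)) (at 0)"
    unfolding has_field_derivative_def
    by (rule has_derivative_eq_rhs) (rule ext, cases \<gamma>, simp add: inner_prod_def algebra_simps)
  then have "((\<lambda>h. (\<phi> (0 + h) - \<phi> 0) / h) \<longlongrightarrow> \<gamma> \<bullet> (1, v)) (at 0)"
    by (simp add: DERIV_def)
  then have lim: "((\<lambda>h. (\<phi> (0 + h) - \<phi> 0) / h) \<longlongrightarrow> \<gamma> \<bullet> (1, v)) (at_right 0)"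
    by (rule tendsto_mono[rotated]) (simp add: at_le)
  show ?thesis
  proof (rule tendsto_le[OF _ _ lim])
    show "((\<lambda>h. L z v + B * h) \<longlongrightarrow> L z v) (at_right 0)"
      by (rule tendsto_eq_intros refl)+ simp
    have "\<forall>\<^sub>F h in at_right (0::real). h \<in> {0<..<1}"
      by (rule eventually_at_right_real) simp
    then show "\<forall>\<^sub>F h in at_right 0. (\<phi> (0 + h) - \<phi> 0) / h \<le> L z v + B * h"
    proof eventually_elim
      case (elim h)
      have "A (t + h) x (z + h *\<^sub>R v) \<le> A t x z + A h z (z + h *\<^sub>R v)"
        by (rule fundamental_solution_triangle) (use elim assms in auto)
      also have "A h z (z + h *\<^sub>R v) \<le> h * (L z v + B * h)"
        by (rule B(2)) (use elim in \<open>auto simp: R_def\<close>)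
      finally show ?case using elim by (simp add: \<phi>_def pos_divide_le_eq mult.commute)
    qed
  qed simp
qed

text \<open>The other half, at the one velocity with \<open>Lv z V = p\<close>, read off from the
  last stretch, of duration \<open>h\<close>, of a near-minimizer. The average speed on that stretch
  is not controlled: \<open>norm (q - z)\<close> is small but not of order \<open>h\<close>. The
  error in \<open>lower\<close> therefore must not contain a term quadratic in
  \<open>q - z\<close>.\<close>

lemma fundamental_solution_supersolution:
  assumes t: "t > 0" and \<sigma>0: "\<sigma>0 > 0" and c: "c \<ge> 0" and p: "p = Lv z V"
    and lower: "\<And>h q. 0 < h \<Longrightarrow> h < \<sigma>0 \<Longrightarrow> norm (q - z) < \<sigma>0 \<Longrightarrow>
      A (t - h) x q \<ge> A t x z - h * Ft + p \<bullet> (q - z) - c * h * (h + norm (q - z))"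
  shows "L z V \<le> Ft + p \<bullet> V"
proof (rule field_le_epsilon)
  fix e :: real assume e: "e > 0"
  then have e4: "e / 4 > 0" by simp
  define R where "R = max (norm z) (norm V)"
  obtain \<rho> where \<rho>: "\<rho> > 0" "\<And>x v y w. norm x \<le> R \<Longrightarrow> norm v \<le> R \<Longrightarrow> norm (y - x) \<le> \<rho> \<Longrightarrow>
     L y w \<ge> L x v + Lv x v \<bullet> (w - v) - e / 4"
    using L_support_nearby[OF e4] by metis
  define \<sigma> where "\<sigma> = min \<rho> (min (\<sigma>0 / 2) (e / (4 * (c + 1))))"
  have \<sigma>: "\<sigma> > 0" "\<sigma> \<le> \<rho>" "\<sigma> \<le> \<sigma>0 / 2" "\<sigma> \<le> e / (4 * (c + 1))"
    unfolding \<sigma>_def using \<rho>(1) \<sigma>0 e c by simp (meson min.coboundedI1 min.coboundedI2 order_refl)+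
  have \<sigma>\<sigma>0: "\<sigma> < \<sigma>0" using \<sigma>(3) \<sigma>0 by simp
  obtain C where C: "C \<ge> 0" "\<And>x v. L x v \<ge> 0 * norm v - C"
    using superlinear[OF order_refl] by metis
  \<comment> \<open>Bounds the action of the last stretch, since the curve before it costs at least
    \<open>- C * t\<close>.\<close>
  define b where "b = \<bar>A t x z\<bar> + 1 + C * t"
  have b: "b > 0" using C t by (simp add: b_def add_nonneg_pos add_pos_nonneg)
  \<comment> \<open>With this slope a stretch of action at most \<open>b\<close> and duration at
    most \<open>1 / (C' + 1)\<close> satisfies
    \<open>K * displacement \<le> b + 1 = K * \<sigma>\<close>, so it stays within \<sigma> of
    \<open>z\<close>.\<close>
  define K where "K = (b + 1) / \<sigma>"
  have K: "K > 0" using b \<sigma> by (simp add: K_def)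
  obtain C' where C': "C' \<ge> 0" "\<And>x v. L x v \<ge> K * norm v - C'"
    using superlinear[OF less_imp_le[OF K]] by metis
  define h where "h = min (min 1 (t / 2)) (min (\<sigma>0 / 2) (min (1 / (C' + 1)) (e / (4 * (c + 1)))))"
  have h': "0 < h" "h \<le> 1" "h \<le> t / 2" "h \<le> \<sigma>0 / 2" "h \<le> 1 / (C' + 1)" "h \<le> e / (4 * (c + 1))"
    unfolding h_def using t \<sigma>0 C'(1) e c by simp (meson min.coboundedI1 min.coboundedI2 order_refl)+
  then have h: "0 < h" "h \<le> 1" "h < t" "h < \<sigma>0" "h \<le> 1 / (C' + 1)" "h \<le> e / (4 * (c + 1))"
    using t \<sigma>0 by linarith+
  have C'h: "C' * h \<le> 1"
  proof -
    have "C' * h \<le> C' * (1 / (C' + 1))" using h C' by (intro mult_left_mono)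
    also have "\<dots> \<le> 1" using C' by (simp add: field_simps)
    finally show ?thesis .
  qed
  \<comment> \<open>The slack \<open>h\<^sup>2\<close> becomes negligible after the division by
    \<open>h\<close>.\<close>
  have "A t x z < A t x z + h\<^sup>2" using h by simp
  then obtain \<xi> where \<xi>: "admissible L 0 t \<xi>" "\<xi> 0 = x" "\<xi> t = z" "action L 0 t \<xi> < A t x z + h\<^sup>2"
    using fundamental_solution_less[OF _ t] by blast
  have adm: "admissible L 0 (t - h) \<xi>" "admissible L (t - h) t \<xi>"
    using admissible_subinterval[OF \<xi>(1)] h by auto
  have split: "action L 0 t \<xi> = action L 0 (t - h) \<xi> + action L (t - h) t \<xi>"
    using action_combine[OF \<xi>(1), of "t - h"] h by simp
  have "0 * norm (\<xi> (t - h) - \<xi> 0) \<le> action L 0 (t - h) \<xi> + C * (t - h - 0)"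
    by (rule action_ge_norm[OF adm(1) C(2)]) (use h in auto)
  moreover have "C * (t - h - 0) \<le> C * t" using C h by (intro mult_left_mono) auto
  moreover have "h\<^sup>2 \<le> 1" using h by (simp add: power_le_one)
  ultimately have a2: "action L (t - h) t \<xi> \<le> b"
    using split \<xi>(4) by (simp add: b_def)
  have near: "norm (\<xi> s - z) \<le> \<sigma>" if s: "s \<in> {t - h..t}" for s
  proof -
    have "K * norm (\<xi> t - \<xi> s) \<le> action L (t - h) t \<xi> + C' * (t - (t - h))"
      by (rule action_ge_norm[OF adm(2) C'(2)]) (use s K in auto)
    also have "\<dots> \<le> b + 1" using a2 C'h by simp
    also have "b + 1 = K * \<sigma>" using \<sigma>(1) by (simp add: K_def)
    finally have "norm (\<xi> t - \<xi> s) \<le> \<sigma>" using K by simp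
    then show ?thesis using \<xi>(3) by (simp add: norm_minus_commute)
  qed
  define q where "q = \<xi> (t - h)"
  have q: "norm (q - z) \<le> \<sigma>" using near[of "t - h"] h by (simp add: q_def)
  have "A (t - h - 0) (\<xi> 0) (\<xi> (t - h)) \<le> action L 0 (t - h) \<xi>"
    by (rule fundamental_solution_le_action[OF adm(1)]) (use h in simp)
  then have 1: "A t x z - h * Ft + p \<bullet> (q - z) - c * h * (h + norm (q - z)) \<le> action L 0 (t - h) \<xi>"
    using lower[of h q] h q \<sigma>\<sigma>0 \<xi> by (simp add: q_def)
  have "L (\<xi> s) w \<ge> p \<bullet> w - (p \<bullet> V - L z V + e / 4)" if "s \<in> {t - h..t}" for s w
    using \<rho>(2)[of z V "\<xi> s" w] near[OF that] \<sigma> by (simp add: R_def p inner_diff_right)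
  then have "action L (t - h) t \<xi> \<ge> p \<bullet> (\<xi> t - \<xi> (t - h)) - (p \<bullet> V - L z V + e / 4) * (t - (t - h))"
    by (intro action_ge_linear[OF adm(2)]) (use h in auto)
  then have 2: "action L (t - h) t \<xi> \<ge> - (p \<bullet> (q - z)) - (p \<bullet> V - L z V + e / 4) * h"
    using \<xi> by (simp add: q_def inner_diff_right)
  have "c * h * (h + norm (q - z)) \<le> c * h * (h + \<sigma>)"
    using c h q by (intro mult_left_mono) auto
  then have "- h * Ft - c * h * (h + \<sigma>) - (p \<bullet> V - L z V + e / 4) * h < h * h"
    using 1 2 \<xi>(4) split by (simp add: power2_eq_square)
  then have "h * (L z V) < h * (Ft + p \<bullet> V + e / 4 + (c + 1) * h + c * \<sigma>)"
    by (simp add: algebra_simps)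
  then have "L z V < Ft + p \<bullet> V + e / 4 + (c + 1) * h + c * \<sigma>"
    using h(1) by simp
  moreover have "(c + 1) * h \<le> e / 4"
    using h(6) c by (simp add: pos_le_divide_eq algebra_simps)
  moreover have "c * \<sigma> \<le> e / 4"
  proof -
    have "c * \<sigma> \<le> (c + 1) * \<sigma>" using \<sigma> by simp
    also have "\<dots> \<le> e / 4" using \<sigma>(4) c by (simp add: pos_le_divide_eq algebra_simps)
    finally show ?thesis .
  qed
  ultimately show "L z V \<le> Ft + p \<bullet> V + e" using e by simp
qed

section \<open>Semiconcavity of the fundamental solution in time\<close>

text \<open>Only the pieces of a nearly minimizing curve with bounded average speed are stretched in time:
  at least half of the pieces are of this kind, and nothing is known about \<open>L\<close> at the others.\<close>

lemma fundamental_solution_time_semiconcave: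
  assumes R: "R \<ge> 0" and T: "T > 0"
  obtains C where "C \<ge> 0" "\<And>x z t h. norm x \<le> R \<Longrightarrow> 0 < t \<Longrightarrow> t \<le> T \<Longrightarrow> norm (z - x) \<le> R * t \<Longrightarrow>
    \<bar>h\<bar> \<le> t / 4 \<Longrightarrow> A (t + h) x z + A (t - h) x z - 2 * A t x z \<le> C * h\<^sup>2 / t"
proof -
  obtain B where B: "B \<ge> 0" "\<And>x v. norm x \<le> R + R * T \<Longrightarrow> norm v \<le> R + R * T \<Longrightarrow> \<bar>L x v\<bar> \<le> B"
    using local_bounds[of "R + R * T"] by metis
  have "R \<le> R + R * T" using R T by simp
  then have BL: "L x v \<le> B" if "norm x \<le> R + R * T" "norm v \<le> R" for x v
    using B(2)[of x v] that by linarith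
  obtain C1 where C1: "C1 \<ge> 0" "\<And>x v. L x v \<ge> 1 * norm v - C1"
    using superlinear[OF zero_le_one] by metis
  \<comment> \<open>The segment gives \<open>A t x z \<le> B * t\<close> and the slack \<epsilon> is
    at most \<open>t\<close>; hence \<open>M * t\<close> bounds the action plus
    \<open>C1 * t\<close>, and with it the displacement and the length of the inscribed
    polygon.\<close>
  define M where "M = B + 1 + C1"
  have M: "M \<ge> 1" using B(1) C1 by (simp add: M_def)
  \<comment> \<open>\<open>R + M * T\<close> bounds the positions, and \<open>4 * M\<close> bounds
    speeds of at most \<open>2 * M\<close> after the duration is multiplied by a factor of at least
    1/2.\<close>
  define R' where "R' = max (R + M * T) (4 * M)"
  have R': "R' \<ge> 0" "R + M * T \<le> R'" "4 * M \<le> R'" using M by (auto simp: R'_def)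
  obtain Cp where Cp: "Cp \<ge> 0" "\<And>a v \<theta>. norm a \<le> R' \<Longrightarrow> norm v \<le> R' \<Longrightarrow> \<bar>\<theta>\<bar> \<le> 1/2 \<Longrightarrow>
    (1 + \<theta>) * L a (v /\<^sub>R (1 + \<theta>)) + (1 - \<theta>) * L a (v /\<^sub>R (1 - \<theta>)) - 2 * L a v \<le> Cp * \<theta>\<^sup>2"
    using perspective_semiconcave[OF R'(1)] by metis
  obtain Bl where Bl: "Bl \<ge> 0" "\<And>\<delta> a v. 0 \<le> \<delta> \<Longrightarrow> \<delta> \<le> 1 \<Longrightarrow> norm a \<le> R' \<Longrightarrow> norm v \<le> R' \<Longrightarrow>
    A \<delta> a (a + \<delta> *\<^sub>R v) \<le> \<delta> * (L a v + Bl * \<delta>)"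
    using fundamental_solution_le_short[of R'] by metis
  show thesis
  proof (rule that[of "4 * Cp"])
    fix x z :: "real^'n" and t h :: real
    assume x: "norm x \<le> R" and t: "0 < t" "t \<le> T" and z: "norm (z - x) \<le> R * t" and h: "\<bar>h\<bar> \<le> t / 4"
    show "A (t + h) x z + A (t - h) x z - 2 * A t x z \<le> 4 * Cp * h\<^sup>2 / t"
    proof (rule field_le_epsilon)
      fix \<kappa> :: real assume \<kappa>: "\<kappa> > 0"
      \<comment> \<open>Three errors share \<kappa>: near-minimality
        (\<open>2 * \<epsilon>\<close>), the lower bound for short pieces (\<open>2 * \<eta>\<close>
        per unit of time) and the replacement by segments (\<open>4 * Bl * \<delta>\<close> per unit
        of time).\<close>
      define \<epsilon> where "\<epsilon> = min t (\<kappa> / 8)"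
      have \<epsilon>: "\<epsilon> > 0" "\<epsilon> \<le> t" "2 * \<epsilon> \<le> \<kappa> / 4" using t \<kappa> by (auto simp: \<epsilon>_def)
      have At: "A t x z \<le> B * t"
      proof -
        define v where "v = (z - x) /\<^sub>R t"
        have v: "norm v \<le> R" "z = x + t *\<^sub>R v"
          using z t by (simp_all add: v_def pos_divide_le_eq divide_inverse_commute[symmetric])
        have "L (x + s *\<^sub>R v) v \<le> B" if s: "s \<in> {0..t}" for s
        proof (rule BL[OF _ v(1)])
          have "norm (s *\<^sub>R v) \<le> T * R" using s t v R by (auto intro!: mult_mono)
          then show "norm (x + s *\<^sub>R v) \<le> R + R * T"
            using x norm_triangle_ineq[of x "s *\<^sub>R v"] by (simp add: mult.commute)
        qed
        from fundamental_solution_segment[OF _ this] show ?thesis using t v by simp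
      qed
      have "A t x z < A t x z + \<epsilon>" using \<epsilon> by simp
      then obtain \<xi> where \<xi>: "admissible L 0 t \<xi>" "\<xi> 0 = x" "\<xi> t = z" "action L 0 t \<xi> < A t x z + \<epsilon>"
        using fundamental_solution_less[OF _ t(1)] by blast
      have act: "action L 0 t \<xi> + C1 * t \<le> M * t"
        using \<xi>(4) At \<epsilon> by (simp add: M_def algebra_simps)
      have \<xi>R: "norm (\<xi> s) \<le> R'" if s: "0 \<le> s" "s \<le> t" for s
      proof -
        have "1 * norm (\<xi> s - \<xi> 0) \<le> action L 0 t \<xi> + C1 * (t - 0)"
          by (rule action_ge_norm[OF \<xi>(1) C1(2)]) (use s in auto)
        also have "\<dots> \<le> M * T" using act t M by (smt (verit) mult_left_mono)
        finally show ?thesis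
          using x \<xi>(2) norm_triangle_ineq[of x "\<xi> s - x"] R' by auto
      qed
      define \<eta> where "\<eta> = \<kappa> / (8 * T)"
      have \<eta>: "\<eta> > 0" "t * (2 * \<eta>) \<le> \<kappa> / 4"
        using \<kappa> T t by (auto simp: \<eta>_def field_simps)
      obtain \<delta>0 where \<delta>0: "\<delta>0 > 0" "\<And>\<delta> a v. 0 < \<delta> \<Longrightarrow> \<delta> < \<delta>0 \<Longrightarrow> norm a \<le> R' \<Longrightarrow> norm v \<le> R' \<Longrightarrow>
        A \<delta> a (a + \<delta> *\<^sub>R v) \<ge> \<delta> * (L a v - \<eta>)"
        using fundamental_solution_ge_short[OF \<eta>(1), of R'] by metis
      define \<delta>1 where "\<delta>1 = min (\<delta>0 / 2) (min (1/2) (\<kappa> / (16 * (Bl + 1) * t)))"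
      have \<delta>1: "\<delta>1 > 0" "\<delta>1 \<le> \<delta>0 / 2" "\<delta>1 \<le> 1/2" "\<delta>1 \<le> \<kappa> / (16 * (Bl + 1) * t)"
        unfolding \<delta>1_def using \<delta>0(1) \<kappa> t Bl(1) by simp (meson min.coboundedI1 min.coboundedI2 order_refl)+
      obtain N :: nat where N: "t / \<delta>1 < real N" using reals_Archimedean2 by blast
      have N0: "N > 0"
      proof (rule ccontr)
        assume "\<not> N > 0"
        then show False using N divide_pos_pos[OF t(1) \<delta>1(1)] by simp
      qed
      define \<delta> where "\<delta> = t / real N"
      have \<delta>: "\<delta> > 0" "\<delta> < \<delta>1" "real N * \<delta> = t"
        using N N0 t \<delta>1 by (auto simp: \<delta>_def field_simps)
      have \<delta>\<kappa>: "t * (4 * Bl * \<delta>) \<le> \<kappa> / 4"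
      proof -
        have "\<delta> * (16 * (Bl + 1) * t) \<le> \<delta>1 * (16 * (Bl + 1) * t)"
          using \<delta> t Bl(1) by (intro mult_right_mono) auto
        also have "\<dots> \<le> \<kappa>" using \<delta>1(4) t Bl(1) by (simp add: pos_le_divide_eq)
        finally have "\<delta> * (16 * (Bl + 1) * t) \<le> \<kappa>" .
        moreover have "\<delta> * t \<ge> 0" using \<delta> t by simp
        ultimately show ?thesis by (simp add: algebra_simps)
      qed
      define q where "q i = \<xi> (real i * \<delta>)" for i :: nat
      have qR: "norm (q i) \<le> R'" if "i \<le> N" for i
      proof -
        have "real i * \<delta> \<le> real N * \<delta>" using that \<delta> by (intro mult_right_mono) auto
        then show ?thesis unfolding q_def using \<delta> by (intro \<xi>R) auto
      qed
      have q0: "q 0 = x" "q N = z" using \<xi> \<delta> by (auto simp: q_def)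
      have chain: "(\<Sum>i<N. A \<delta> (q i) (q (Suc i))) \<le> action L 0 t \<xi>"
        using action_ge_chain[OF \<xi>(1), of \<delta> N] \<delta> by (simp add: q_def)
      define w where "w i = (q (Suc i) - q i) /\<^sub>R \<delta>" for i
      have w: "q (Suc i) = q i + \<delta> *\<^sub>R w i" for i using \<delta> by (simp add: w_def)
      \<comment> \<open>The average speed of the polygon is at most \<open>M\<close>, so by Markov's
        inequality at least half of the pieces have speed at most \<open>2 * M\<close>.\<close>
      define G where "G = {i\<in>{..<N}. norm (w i) \<le> 2 * M}"
      define m where "m = card G"
      have finG: "finite G" "G \<subseteq> {..<N}" by (auto simp: G_def)
      have mN: "m \<le> N" using card_mono[OF finite_lessThan finG(2)] by (simp add: m_def)
      have half: "real N \<le> 2 * real m"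
      proof -
        have "(\<Sum>i<N. norm (q (Suc i) - q i) - C1 * \<delta>) \<le> (\<Sum>i<N. A \<delta> (q i) (q (Suc i)))"
          by (rule sum_mono) (use fundamental_solution_ge_norm[OF C1(2) zero_le_one \<delta>(1)] in simp)
        then have "(\<Sum>i<N. norm (q (Suc i) - q i)) \<le> action L 0 t \<xi> + C1 * t"
          using chain \<delta>(3) by (simp add: sum_subtractf mult_ac) 
        then have tot: "(\<Sum>i<N. norm (q (Suc i) - q i)) \<le> M * t" using act by linarith
        have "real (card ({..<N} - G)) * (2 * M * \<delta>) = (\<Sum>i\<in>{..<N} - G. 2 * M * \<delta>)" by simp
        also have "\<dots> \<le> (\<Sum>i\<in>{..<N} - G. norm (q (Suc i) - q i))"
        proof (rule sum_mono)
          fix i assume "i \<in> {..<N} - G"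
          then have "2 * M \<le> norm (w i)" by (auto simp: G_def)
          then have "\<delta> * (2 * M) \<le> \<delta> * norm (w i)" using \<delta> by (intro mult_left_mono) auto
          then show "2 * M * \<delta> \<le> norm (q (Suc i) - q i)" using \<delta> by (simp add: w mult_ac)
        qed
        also have "\<dots> \<le> (\<Sum>i<N. norm (q (Suc i) - q i))" by (rule sum_mono2) auto
        also have "\<dots> \<le> M * (real N * \<delta>)" using tot \<delta> by simp
        finally have "2 * real (card ({..<N} - G)) * (M * \<delta>) \<le> real N * (M * \<delta>)" by (simp add: mult_ac)
        moreover have "M * \<delta> > 0" using M \<delta>(1) by simp
        ultimately have "2 * real (card ({..<N} - G)) \<le> real N" by (rule mult_right_le_imp_le)
        moreover have "card ({..<N} - G) = N - m" using finG by (simp add: card_Diff_subset m_def)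
        ultimately show ?thesis using mN by (simp add: of_nat_diff)
      qed
      have m0: "real m > 0" using half N0 by (cases "m = 0") auto
      \<comment> \<open>Multiplying the duration of the \<open>m\<close> good pieces by
        \<open>1 + \<theta>\<close> changes the total time by exactly \<open>h\<close>; since
        \<open>m\<close> is at least \<open>N / 2\<close>, \<theta> is at most
        \<open>2 * \<bar>h\<bar> / t\<close> in absolute value.\<close>
      define \<theta> where "\<theta> = h / (\<delta> * real m)"
      have \<theta>h: "real m * (\<delta> * \<theta>) = h" using m0 \<delta> by (simp add: \<theta>_def)
      have \<theta>t: "\<bar>\<theta>\<bar> \<le> 2 * \<bar>h\<bar> / t"
      proof -
        have "t \<le> 2 * (\<delta> * real m)" using half \<delta> mult_left_mono[OF half, of \<delta>] by (simp add: mult_ac)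
        then have "\<bar>h\<bar> / (\<delta> * real m) \<le> \<bar>h\<bar> / (t / 2)"
          using t m0 \<delta> by (intro divide_left_mono) auto
        then show ?thesis using m0 \<delta> by (simp add: \<theta>_def abs_mult mult.commute)
      qed
      also have "\<dots> \<le> 1/2" using h t by (simp add: pos_divide_le_eq)
      finally have \<theta>2: "\<bar>\<theta>\<bar> \<le> 1/2" .
      define \<tau> where "\<tau> r i = (if i \<in> G then \<delta> * (1 + r) else \<delta>)" for r :: real and i
      have sum\<tau>: "(\<Sum>i<N. \<tau> r i) = t + real m * (\<delta> * r)" for r
      proof -
        have "(\<Sum>i<N. \<tau> r i) = (\<Sum>i<N. \<delta> + (if i \<in> G then \<delta> * r else 0))"
          by (intro sum.cong) (auto simp: \<tau>_def algebra_simps)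
        also have "\<dots> = real N * \<delta> + (\<Sum>i\<in>G. \<delta> * r)"
          using finG by (simp add: sum.distrib sum.If_cases Int_absorb1)
        finally show ?thesis using \<delta> by (simp add: m_def)
      qed
      have \<tau>pos: "\<tau> r i > 0" if "\<bar>r\<bar> \<le> 1/2" for r i
        using \<delta> that by (auto simp: \<tau>_def intro!: mult_pos_pos)
      have stretched: "A (t + real m * (\<delta> * r)) x z \<le> (\<Sum>i<N. A (\<tau> r i) (q i) (q (Suc i)))" if "\<bar>r\<bar> \<le> 1/2" for r
        using fundamental_solution_chain[of N "\<tau> r" q] \<tau>pos[OF that] N0 q0 by (simp add: sum\<tau>)
      have piece: "A (\<tau> \<theta> i) (q i) (q (Suc i)) + A (\<tau> (- \<theta>) i) (q i) (q (Suc i)) - 2 * A \<delta> (q i) (q (Suc i))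
          \<le> \<delta> * (Cp * \<theta>\<^sup>2 + 4 * Bl * \<delta> + 2 * \<eta>)" if i: "i < N" for i
      proof (cases "i \<in> G")
        \<comment> \<open>The duration is unchanged here, so the three terms cancel exactly,
          whatever the speed of the piece.\<close>
        case False
        then show ?thesis using \<delta> Cp Bl \<eta> by (simp add: \<tau>_def)
      next
        case True
        then have wM: "norm (w i) \<le> 2 * M" by (simp add: G_def)
        have qi: "norm (q i) \<le> R'" using qR i by simp
        \<comment> \<open>The endpoints of the piece are kept: a segment with velocity
          \<open>w i /\<^sub>R (1 + r)\<close> covers the same displacement in the new
          duration.\<close>
        have up: "A (\<delta> * (1 + r)) (q i) (q (Suc i)) \<le> \<delta> * (1 + r) * (L (q i) (w i /\<^sub>R (1 + r)) + Bl * (\<delta> * (1 + r)))"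
          if r: "\<bar>r\<bar> \<le> 1/2" for r
        proof -
          have r1: "1 + r \<ge> 1/2" "1 + r \<le> 2" using r by auto
          have "norm (w i /\<^sub>R (1 + r)) = norm (w i) / (1 + r)" using r1 by (simp add: field_simps)
          also have "\<dots> \<le> (2 * M) / (1/2)" using wM r1 M by (intro frac_le) auto
          finally have nw: "norm (w i /\<^sub>R (1 + r)) \<le> R'" using R' by simp
          have "\<delta> * (1 + r) \<le> 1/2 * 2" using \<delta> \<delta>1 r1 by (intro mult_mono) auto
          then have "A (\<delta> * (1 + r)) (q i) (q i + (\<delta> * (1 + r)) *\<^sub>R (w i /\<^sub>R (1 + r))) \<le>
             \<delta> * (1 + r) * (L (q i) (w i /\<^sub>R (1 + r)) + Bl * (\<delta> * (1 + r)))"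
            using \<delta> r1 by (intro Bl(2) qi nw) auto
          moreover have "q i + (\<delta> * (1 + r)) *\<^sub>R (w i /\<^sub>R (1 + r)) = q (Suc i)"
            using r1 by (simp add: w)
          ultimately show ?thesis by simp
        qed
        have lo: "A \<delta> (q i) (q (Suc i)) \<ge> \<delta> * (L (q i) (w i) - \<eta>)"
          unfolding w by (rule \<delta>0(2)) (use \<delta> \<delta>1 \<delta>0(1) qi wM R' M in auto)
        have per: "\<delta> * ((1 + \<theta>) * L (q i) (w i /\<^sub>R (1 + \<theta>)) + (1 - \<theta>) * L (q i) (w i /\<^sub>R (1 - \<theta>)) - 2 * L (q i) (w i)) \<le> \<delta> * (Cp * \<theta>\<^sup>2)"
          using \<delta> wM R' M qi \<theta>2 by (intro mult_left_mono Cp(2)) auto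
        have sq: "\<delta> * (Bl * \<delta>) * ((1 + \<theta>)\<^sup>2 + (1 - \<theta>)\<^sup>2) \<le> \<delta> * (Bl * \<delta>) * 4"
        proof (intro mult_left_mono)
          have "\<theta>\<^sup>2 \<le> (1/2)\<^sup>2" using \<theta>2 by (intro abs_le_square_iff[THEN iffD1]) auto
          then show "(1 + \<theta>)\<^sup>2 + (1 - \<theta>)\<^sup>2 \<le> 4" by (simp add: power2_eq_square algebra_simps)
        qed (use \<delta> Bl in auto)
        show ?thesis
          using up[OF \<theta>2] up[of "- \<theta>"] \<theta>2 lo per sq True
          by (simp add: \<tau>_def algebra_simps power2_eq_square)
      qed
      have "A (t + h) x z + A (t - h) x z - 2 * A t x z \<le>
         (\<Sum>i<N. A (\<tau> \<theta> i) (q i) (q (Suc i))) + (\<Sum>i<N. A (\<tau> (- \<theta>) i) (q i) (q (Suc i))) - 2 * (\<Sum>i<N. A \<delta> (q i) (q (Suc i))) + 2 * \<epsilon>"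
        using stretched[OF \<theta>2] stretched[of "- \<theta>"] \<theta>2 \<theta>h chain \<xi>(4) by simp
      also have "\<dots> = (\<Sum>i<N. A (\<tau> \<theta> i) (q i) (q (Suc i)) + A (\<tau> (- \<theta>) i) (q i) (q (Suc i)) - 2 * A \<delta> (q i) (q (Suc i))) + 2 * \<epsilon>"
        by (simp add: sum.distrib sum_subtractf sum_distrib_left)
      also have "\<dots> \<le> (\<Sum>i<N. \<delta> * (Cp * \<theta>\<^sup>2 + 4 * Bl * \<delta> + 2 * \<eta>)) + 2 * \<epsilon>"
        by (intro add_right_mono sum_mono piece) simp
      also have "\<dots> = t * (Cp * \<theta>\<^sup>2) + t * (4 * Bl * \<delta>) + t * (2 * \<eta>) + 2 * \<epsilon>"
        using \<delta>(3) by (simp add: algebra_simps) (simp add: mult.assoc[symmetric])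
      also have "\<dots> \<le> t * (Cp * \<theta>\<^sup>2) + \<kappa>"
        using \<delta>\<kappa> \<eta> \<epsilon> \<kappa> by simp
      also have "t * (Cp * \<theta>\<^sup>2) \<le> 4 * Cp * h\<^sup>2 / t"
      proof -
        have "\<theta>\<^sup>2 \<le> (2 * \<bar>h\<bar> / t)\<^sup>2" using \<theta>t by (metis abs_ge_zero power2_abs power_mono)
        then have "t * (Cp * \<theta>\<^sup>2) \<le> t * (Cp * (2 * \<bar>h\<bar> / t)\<^sup>2)"
          using t Cp by (intro mult_left_mono) auto
        also have "\<dots> = 4 * Cp * h\<^sup>2 / t" using t by (simp add: power2_eq_square field_simps)
        finally show ?thesis .
      qed
      finally show "A (t + h) x z + A (t - h) x z - 2 * A t x z \<le> 4 * Cp * h\<^sup>2 / t + \<kappa>" by simp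
    qed
  qed (use Cp in simp)
qed

end

section \<open>Velocities and the characteristic relation\<close>

lemma differentiable_imp_locally_Lipschitz_at:
  fixes g :: "'a::real_normed_vector \<Rightarrow> 'b::real_normed_vector"
  assumes "(g has_derivative G) (at p)"
  obtains c d where "c \<ge> 0" "d > 0" "\<And>q. norm (q - p) < d \<Longrightarrow> norm (g q - g p) \<le> c * norm (q - p)"
proof -
  obtain d where d: "d > 0" "\<And>q. norm (q - p) < d \<Longrightarrow> norm (g q - g p - G (q - p)) \<le> 1 * norm (q - p)"
    using assms zero_less_one unfolding has_derivative_at_alt by blast
  obtain K where K: "K > 0" "\<And>h. norm (G h) \<le> norm h * K"
    using bounded_linear.pos_bounded[OF has_derivative_bounded_linear[OF assms]] by blast
  have "norm (g q - g p) \<le> (K + 1) * norm (q - p)" if "norm (q - p) < d" for q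
  proof -
    have "norm (g q - g p) \<le> norm (g q - g p - G (q - p)) + norm (G (q - p))"
      using norm_triangle_ineq[of "g q - g p - G (q - p)" "G (q - p)"] by simp
    also have "\<dots> \<le> 1 * norm (q - p) + norm (q - p) * K"
      by (intro add_mono d K that)
    finally show ?thesis by (simp add: algebra_simps)
  qed
  then show thesis using that[of "K + 1" d] K d by simp
qed

lemma GDERIV_imp_directional:
  assumes "GDERIV f x :> p"
  shows "((\<lambda>l. (f (x + l *\<^sub>R d) - f x) / l) \<longlongrightarrow> p \<bullet> d) (at_right 0)"
proof -
  have line: "((\<lambda>l. x + l *\<^sub>R d) has_derivative (\<lambda>l. l *\<^sub>R d)) (at 0)"
    by (auto intro!: derivative_eq_intros)
  have "((\<lambda>l. f (x + l *\<^sub>R d)) has_derivative (\<lambda>l. (l *\<^sub>R d) \<bullet> p)) (at 0)"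
    by (rule has_derivative_compose[where g=f, OF line]) (use assms in \<open>simp add: gderiv_def\<close>)
  then have "((\<lambda>l. f (x + l *\<^sub>R d)) has_real_derivative p \<bullet> d) (at 0)"
    unfolding has_field_derivative_def
    by (rule has_derivative_eq_rhs) (rule ext, simp add: inner_commute mult.commute)
  then have "((\<lambda>l. (f (x + (0 + l) *\<^sub>R d) - f (x + 0 *\<^sub>R d)) / l) \<longlongrightarrow> p \<bullet> d) (at 0)"
    unfolding DERIV_def .
  then have "((\<lambda>l. (f (x + (0 + l) *\<^sub>R d) - f (x + 0 *\<^sub>R d)) / l) \<longlongrightarrow> p \<bullet> d) (at_right 0)"
    by (rule tendsto_mono[rotated]) (simp add: at_le)
  then show ?thesis by simp
qed

lemma GDERIV_snd:
  assumes "((\<lambda>(t, z). f t z) has_derivative (\<lambda>h. \<gamma> \<bullet> h)) (at (t, z))"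
  shows "GDERIV (f t) z :> snd \<gamma>"
proof -
  have pair: "((\<lambda>z. (t, z)) has_derivative (\<lambda>k. (0, k))) (at z)"
    by (auto intro!: derivative_eq_intros)
  have "((\<lambda>z. case (t, z) of (t, z) \<Rightarrow> f t z) has_derivative (\<lambda>k. \<gamma> \<bullet> (0, k))) (at z)"
    by (rule has_derivative_compose[where g="\<lambda>(t, z). f t z", OF pair assms])
  then show ?thesis
    by (cases \<gamma>) (simp add: gderiv_def inner_prod_def inner_commute)
qed

context tonelli
begin

text \<open>Surjectivity of the Legendre map with a locally uniform bound: \<open>V\<close>
  maximizes \<open>p \<bullet> v - L z v\<close>, and superlinearity with slope \<open>P + 1\<close>
  confines the maximum to a ball.\<close>

lemma exists_velocity:
  obtains W where "W \<ge> 0" "\<And>z p. norm z \<le> R \<Longrightarrow> norm p \<le> P \<Longrightarrow> \<exists>V. norm V \<le> W \<and> Lv z V = p"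
proof (cases "P \<ge> 0 \<and> R \<ge> 0")
  case True
  then have P1: "P + 1 \<ge> 0" by simp
  obtain C where C: "C \<ge> 0" "\<And>x v. L x v \<ge> (P + 1) * norm v - C"
    using superlinear[OF P1] by metis
  obtain B where B: "B \<ge> 0" "\<And>x v. norm x \<le> R \<Longrightarrow> norm v \<le> R \<Longrightarrow> \<bar>L x v\<bar> \<le> B"
    using local_bounds[of R] by metis
  \<comment> \<open>Beyond the radius \<open>C + B\<close> one has
    \<open>f v \<le> C - norm v < - B \<le> f 0\<close>.\<close>
  show thesis
  proof (rule that[of "C + B"])
    fix z p :: "real^'n" assume z: "norm z \<le> R" and p: "norm p \<le> P"
    define f where "f v = p \<bullet> v - L z v" for v
    have "continuous_on (cball 0 (C + B)) f"
      unfolding f_def by (intro continuous_intros continuous_on_L)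
    then obtain V where V: "V \<in> cball 0 (C + B)" "\<And>v. v \<in> cball 0 (C + B) \<Longrightarrow> f v \<le> f V"
      using continuous_attains_sup[of "cball 0 (C + B)" f] B C by (auto simp: compact_cball)
    have max: "f v \<le> f V" for v
    proof (cases "v \<in> cball 0 (C + B)")
      case False
      have "p \<bullet> v \<le> norm p * norm v" by (rule norm_cauchy_schwarz)
      also have "\<dots> \<le> P * norm v" using p by (intro mult_right_mono) auto
      finally have "f v \<le> C - norm v" using C(2)[of v z] by (simp add: f_def algebra_simps)
      also have "\<dots> \<le> - B" using False by simp
      also have "\<dots> \<le> f 0" using B(2)[of z 0] z True by (simp add: f_def)
      also have "\<dots> \<le> f V" using V(2)[of 0] B C by simp
      finally show ?thesis .
    qed (rule V(2))
    have "(f has_derivative (\<lambda>h. p \<bullet> h - h \<bullet> Lv z V)) (at V)"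
      unfolding f_def by (intro derivative_intros GDERIV_Lv[unfolded gderiv_def])
    then have "(\<lambda>h. p \<bullet> h - h \<bullet> Lv z V) = (\<lambda>h. 0)"
      by (rule differential_zero_maxmin[OF UNIV_I open_UNIV]) (use max in auto)
    then have "h \<bullet> p = h \<bullet> Lv z V" for h
      by (metis eq_iff_diff_eq_0 inner_commute)
    then have "Lv z V = p" by (metis vector_eq_ldot)
    then show "\<exists>V. norm V \<le> C + B \<and> Lv z V = p" using V(1) by auto
  qed (use B C in simp)
next
  case False
  show thesis
  proof (rule that[of 0])
    fix z p :: "real^'n" assume "norm z \<le> R" "norm p \<le> P"
    then have False using False norm_ge_zero[of z] norm_ge_zero[of p] by linarith
    then show "\<exists>V. norm V \<le> 0 \<and> Lv z V = p" ..
  qed simp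
qed

text \<open>With \<open>V\<close> the final velocity of the minimizer, \<open>L q V - \<partial>\<^sub>t A - V \<bullet> \<partial>\<^sub>z A\<close> is nonnegative by the
  subsolution property and vanishes at \<open>(t, z)\<close>.  Hence its gradient vanishes there: this is the
  Hamilton--Jacobi equation differentiated once, with no reference to the Hamiltonian.\<close>

lemma fundamental_solution_characteristic:
  assumes U: "open U" "\<And>s q. (s, q) \<in> U \<Longrightarrow> s > 0"
    and \<gamma>: "\<And>p. p \<in> U \<Longrightarrow> ((\<lambda>(t, z). A t x z) has_derivative (\<lambda>h. \<gamma> p \<bullet> h)) (at p)"
    and \<Gamma>: "\<And>p. p \<in> U \<Longrightarrow> (\<gamma> has_derivative \<Gamma> p) (at p)"
    and sym: "\<And>p v w. p \<in> U \<Longrightarrow> \<Gamma> p v \<bullet> w = \<Gamma> p w \<bullet> v"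
    and tz: "(t, z) \<in> U"
    and conv: "\<And>s a b. (s, a) \<in> U \<Longrightarrow> (s, b) \<in> U \<Longrightarrow> s \<le> t \<Longrightarrow> A s x b \<ge> A s x a + snd (\<gamma> (s, a)) \<bullet> (b - a)"
    and V: "Lv z V = snd (\<gamma> (t, z))"
  shows "\<Gamma> (t, z) (1, V) = (0, Lx z V)"
proof -
  have sub: "\<gamma> p \<bullet> (1, V) \<le> L (snd p) V" if p: "p \<in> U" for p
  proof -
    obtain s q where sq: "p = (s, q)" by (cases p)
    show ?thesis
      using fundamental_solution_subsolution[of s x "\<gamma> p" q V] U(2)[of s q] \<gamma>[OF p] p unfolding sq by simp
  qed
  define p Ft where "p = snd (\<gamma> (t, z))" and "Ft = fst (\<gamma> (t, z))"
  have \<gamma>eq: "\<gamma> (t, z) \<bullet> (r, h) = Ft * r + p \<bullet> h" for r h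
    by (simp add: p_def Ft_def inner_prod_def)
  obtain c d where c: "c \<ge> 0" "d > 0" "\<And>q. norm (q - (t, z)) < d \<Longrightarrow> norm (\<gamma> q - \<gamma> (t, z)) \<le> c * norm (q - (t, z))"
    using differentiable_imp_locally_Lipschitz_at[OF \<Gamma>[OF tz]] by blast
  obtain e where e: "e > 0" "ball (t, z) e \<subseteq> U" using U(1) tz openE by blast
  define \<sigma> where "\<sigma> = min d e / 2"
  have \<sigma>: "\<sigma> > 0" using c e by (simp add: \<sigma>_def)
  have near: "norm ((t - h, q) - (t, z)) < min d e" if "0 \<le> h" "h < \<sigma>" "norm (q - z) < \<sigma>" for h q
  proof -
    have "norm ((t - h, q) - (t, z)) \<le> norm (- h) + norm (q - z)"
      using norm_Pair_le[of "- h" "q - z"] by simp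
    also have "\<dots> < \<sigma> + \<sigma>" using that by simp
    finally show ?thesis by (simp add: \<sigma>_def)
  qed
  have inU: "(t - h, q) \<in> U" if "0 \<le> h" "h < \<sigma>" "norm (q - z) < \<sigma>" for h q
  proof -
    have "norm ((t - h, q) - (t, z)) < e" using near[OF that] by simp
    then have "(t - h, q) \<in> ball (t, z) e"
      unfolding mem_ball dist_norm norm_minus_commute[of "(t, z)"] .
    then show ?thesis using e(2) by blast
  qed
  have "L z V \<le> Ft + p \<bullet> V"
  proof (rule fundamental_solution_supersolution[OF U(2)[OF tz] \<sigma> c(1)])
    show "p = Lv z V" using V by (simp add: p_def)
    fix h q assume h: "0 < h" "h < \<sigma>" and q: "norm (q - z) < \<sigma>"
    \<comment> \<open>The expansion first goes back in time at fixed \<open>z\<close> and then moves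
      in space at the earlier time by convexity, with a gradient error of at most
      \<open>c * h\<close>. This is why no term quadratic in \<open>q - z\<close> appears.\<close>
    have hz: "(t - h, z) \<in> U" using inU[of h z] h \<sigma> by simp
    have \<gamma>h: "norm (\<gamma> (t - r, z) - \<gamma> (t, z)) \<le> c * h" if "0 \<le> r" "r \<le> h" for r
    proof -
      have "norm (\<gamma> (t - r, z) - \<gamma> (t, z)) \<le> c * norm ((t - r, z) - (t, z))"
        by (rule c(3)) (use near[of r z] that h \<sigma> in auto)
      also have "\<dots> \<le> c * h" using that c(1) by (intro mult_left_mono) (auto simp: norm_Pair)
      finally show ?thesis .
    qed
    have "((\<lambda>r. A (t - r) x z) has_real_derivative - fst (\<gamma> (t - r, z))) (at r)" if r: "0 \<le> r" "r \<le> h" for r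
    proof -
      have line: "((\<lambda>r. (t - r, z)) has_derivative (\<lambda>h. (- h, 0))) (at r)"
        by (auto intro!: derivative_eq_intros)
      have "((\<lambda>r. case (t - r, z) of (t, z) \<Rightarrow> A t x z) has_derivative (\<lambda>h. \<gamma> (t - r, z) \<bullet> (- h, 0))) (at r)"
        by (rule has_derivative_compose[where g="\<lambda>(t, z). A t x z", OF line])
           (rule \<gamma>, use inU[of r z] r h \<sigma> in auto)
      then have "((\<lambda>r. A (t - r) x z) has_derivative (\<lambda>h. \<gamma> (t - r, z) \<bullet> (- h, 0))) (at r)" by simp
      then show ?thesis
        unfolding has_field_derivative_def
        by (rule has_derivative_eq_rhs) (rule ext, simp add: inner_prod_def)
    qed
    from MVT2[OF h(1) this] obtain r where r: "0 < r" "r < h"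
      "A (t - h) x z - A (t - 0) x z = (h - 0) * (- fst (\<gamma> (t - r, z)))" by blast
    have "\<bar>fst (\<gamma> (t - r, z)) - Ft\<bar> \<le> norm (\<gamma> (t - r, z) - \<gamma> (t, z))"
      unfolding Ft_def fst_diff[symmetric] by (metis norm_fst_le prod.collapse real_norm_def)
    also have "\<dots> \<le> c * h" by (rule \<gamma>h) (use r in auto)
    finally have "h * fst (\<gamma> (t - r, z)) \<le> h * (Ft + c * h)" using h by (intro mult_left_mono) auto
    then have 1: "A (t - h) x z \<ge> A t x z - h * Ft - c * h * h"
      using r(3) by (simp add: algebra_simps)
    have "norm (snd (\<gamma> (t - h, z)) - p) \<le> norm (\<gamma> (t - h, z) - \<gamma> (t, z))"
      unfolding p_def snd_diff[symmetric] by (metis norm_snd_le prod.collapse)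
    also have "\<dots> \<le> c * h" by (rule \<gamma>h) (use h in auto)
    finally have "norm (snd (\<gamma> (t - h, z)) - p) * norm (q - z) \<le> c * h * norm (q - z)"
      by (rule mult_right_mono) simp
    then have 2: "(snd (\<gamma> (t - h, z)) - p) \<bullet> (q - z) \<ge> - (c * h * norm (q - z))"
      using Cauchy_Schwarz_ineq2[of "snd (\<gamma> (t - h, z)) - p" "q - z"] by linarith
    have "A (t - h) x q \<ge> A (t - h) x z + snd (\<gamma> (t - h, z)) \<bullet> (q - z)"
      by (rule conv[OF hz]) (use inU[of h q] h q in auto)
    then show "A (t - h) x q \<ge> A t x z - h * Ft + p \<bullet> (q - z) - c * h * (h + norm (q - z))"
      using 1 2 by (simp add: inner_diff_left algebra_simps)
  qed
  then have sup: "L z V \<le> \<gamma> (t, z) \<bullet> (1, V)" by (simp add: \<gamma>eq)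
  define \<Phi> where "\<Phi> q = L (snd q) V - \<gamma> q \<bullet> (1, V)" for q
  have "(\<Phi> has_derivative (\<lambda>k. snd k \<bullet> Lx z V - \<Gamma> (t, z) k \<bullet> (1, V))) (at (t, z))"
    unfolding \<Phi>_def
  proof (rule has_derivative_diff)
    have sndd: "(snd has_derivative snd) (at (t, z))"
      by (intro bounded_linear_imp_has_derivative bounded_linear_snd)
    show "((\<lambda>q. L (snd q) V) has_derivative (\<lambda>k. snd k \<bullet> Lx z V)) (at (t, z))"
      by (rule has_derivative_compose[where g="\<lambda>x. L x V", OF sndd])
         (use GDERIV_Lx[of V z] in \<open>simp add: gderiv_def\<close>)
    show "((\<lambda>q. \<gamma> q \<bullet> (1, V)) has_derivative (\<lambda>k. \<Gamma> (t, z) k \<bullet> (1, V))) (at (t, z))"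
      by (rule has_derivative_inner_left[OF \<Gamma>[OF tz]])
  qed
  then have "(\<lambda>k. snd k \<bullet> Lx z V - \<Gamma> (t, z) k \<bullet> (1, V)) = (\<lambda>k. 0)"
  proof (rule differential_zero_maxmin[OF tz U(1)])
    have "\<Phi> (t, z) \<le> \<Phi> q" if "q \<in> U" for q
      using sub[OF that] sup by (simp add: \<Phi>_def)
    then show "(\<forall>y\<in>U. \<Phi> y \<le> \<Phi> (t, z)) \<or> (\<forall>y\<in>U. \<Phi> (t, z) \<le> \<Phi> y)" by blast
  qed
  then have eq: "\<Gamma> (t, z) k \<bullet> (1, V) = snd k \<bullet> Lx z V" for k
    by (metis eq_iff_diff_eq_0)
  \<comment> \<open>Symmetry of the second derivative turns the vanishing gradient of \<Phi> into
    the value of \<Gamma> in the direction \<open>(1, V)\<close>.\<close>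
  have "k \<bullet> \<Gamma> (t, z) (1, V) = k \<bullet> (0, Lx z V)" for k
    using eq[of k] sym[OF tz, of "(1, V)" k] by (simp add: inner_commute inner_prod_def)
  then show ?thesis by (metis vector_eq_ldot)
qed

end

section \<open>The intrinsic characteristic\<close>

text \<open>Multiplication by \<open>t\<close> removes the singular factors, so the constant is
  independent of \<open>t\<close>. If \<open>d\<close> exceeded \<open>K * \<bar>r\<bar>\<close>,
  the two remaining terms in \<open>r\<close> would each be at most
  \<open>C3 * d\<^sup>2 / 8\<close>, while together they must reach
  \<open>C3 * d\<^sup>2 / 2\<close>.\<close>

lemma quadratic_estimate:
  fixes a d r B C' e t t0 C2 C3 :: real
  assumes le: "a \<le> C2 * d\<^sup>2 + \<bar>r\<bar> * (B * d) + (a / 8 + 2 * r\<^sup>2 * (C' / t)) + e * (\<bar>r\<bar> + d) * d"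
    and a: "2 * C3 / t * d\<^sup>2 \<le> a" and C2: "C2 < C3 / t" and e: "0 \<le> e" "e \<le> 1" "e \<le> C3 / (4 * t0)"
    and t: "0 < t" "t \<le> t0" and pos: "d \<ge> 0" "B \<ge> 0" "C' \<ge> 0" "C3 > 0"
  shows "d \<le> (1 + 8 * t0 * (B + 1) / C3 + 16 * C' / C3) * \<bar>r\<bar>"
proof (rule ccontr)
  define K where "K = 1 + 8 * t0 * (B + 1) / C3 + 16 * C' / C3"
  assume "\<not> ?thesis"
  then have dK: "K * \<bar>r\<bar> < d" by (simp add: K_def)
  have t0: "t0 > 0" using t by simp
  have 0: "0 \<le> 8 * t0 * (B + 1) / C3" "0 \<le> 16 * C' / C3" using t0 pos by auto
  then have "K \<ge> 1" "8 * t0 * (B + 1) / C3 \<le> K" "16 * C' / C3 \<le> K" by (auto simp: K_def)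
  then have K: "K \<ge> 1" "8 * t0 * (B + 1) \<le> K * C3" "16 * C' \<le> K * C3"
    using pos by (auto simp: pos_divide_le_eq)
  have "1 * \<bar>r\<bar> \<le> K * \<bar>r\<bar>" using K(1) by (intro mult_right_mono) auto
  then have rd: "\<bar>r\<bar> \<le> d" using dK by simp
  have d0: "d > 0" using \<open>1 * \<bar>r\<bar> \<le> K * \<bar>r\<bar>\<close> dK by linarith
  \<comment> \<open>Half of \<open>a\<close> absorbs the semiconcavity term and Cauchy-Schwarz has
    taken an eighth, so 3/8 of \<open>a\<close> remain.\<close>
  have "C2 * d\<^sup>2 \<le> C3 / t * d\<^sup>2" using C2 by (intro mult_right_mono) auto
  also have "\<dots> = 1 / 2 * (2 * C3 / t * d\<^sup>2)" by simp
  also have "\<dots> \<le> 1 / 2 * a" using a by (intro mult_left_mono) auto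
  finally have "3 / 8 * a \<le> \<bar>r\<bar> * (B * d) + 2 * r\<^sup>2 * (C' / t) + e * (\<bar>r\<bar> + d) * d"
    using le by linarith
  then have "t * (3 / 8 * a) \<le> t * (\<bar>r\<bar> * (B * d) + 2 * r\<^sup>2 * (C' / t) + e * (\<bar>r\<bar> + d) * d)"
    using t by (intro mult_left_mono) auto
  also have "\<dots> = t * (B * \<bar>r\<bar> * d) + 2 * r\<^sup>2 * C' + (t * e) * (\<bar>r\<bar> * d) + (t * e) * d\<^sup>2"
    using t by (simp add: algebra_simps power2_eq_square)
  also have "\<dots> \<le> t0 * (B * \<bar>r\<bar> * d) + 2 * r\<^sup>2 * C' + t0 * (\<bar>r\<bar> * d) + C3 / 4 * d\<^sup>2"
  proof -
    have "t * (B * \<bar>r\<bar> * d) \<le> t0 * (B * \<bar>r\<bar> * d)" using t pos by (intro mult_right_mono) auto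
    moreover have "t * e \<le> t0 * 1" using t e by (intro mult_mono) auto
    then have "(t * e) * (\<bar>r\<bar> * d) \<le> t0 * (\<bar>r\<bar> * d)" using pos by (intro mult_right_mono) auto
    moreover have "t * e \<le> t0 * (C3 / (4 * t0))" using t e by (intro mult_mono) auto
    then have "(t * e) * d\<^sup>2 \<le> C3 / 4 * d\<^sup>2" using t0 by (intro mult_right_mono) auto
    ultimately show ?thesis by linarith
  qed
  finally have 1: "t * (3 / 8 * a) \<le> t0 * (B + 1) * \<bar>r\<bar> * d + 2 * C' * r\<^sup>2 + C3 / 4 * d\<^sup>2"
    by (simp add: algebra_simps)
  have "t * (2 * C3 / t * d\<^sup>2) \<le> t * a" using a t by (intro mult_left_mono) auto
  then have "2 * C3 * d\<^sup>2 \<le> t * a" using t by simp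
  then have 2: "C3 / 2 * d\<^sup>2 \<le> t0 * (B + 1) * \<bar>r\<bar> * d + 2 * C' * r\<^sup>2" using 1 by simp
  have "8 * t0 * (B + 1) * (\<bar>r\<bar> * d) \<le> K * C3 * (\<bar>r\<bar> * d)" using K pos by (intro mult_right_mono) auto
  also have "\<dots> = C3 * d * (K * \<bar>r\<bar>)" by simp
  also have "\<dots> < C3 * d * d" using dK pos d0 by (intro mult_strict_left_mono) auto
  finally have 3: "8 * (t0 * (B + 1) * \<bar>r\<bar> * d) < C3 * d\<^sup>2" by (simp add: power2_eq_square mult_ac)
  have "16 * C' * (\<bar>r\<bar> * \<bar>r\<bar>) \<le> K * C3 * (\<bar>r\<bar> * \<bar>r\<bar>)" using K by (intro mult_right_mono) auto
  also have "\<dots> = C3 * (K * \<bar>r\<bar>) * \<bar>r\<bar>" by simp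
  also have "\<dots> \<le> C3 * d * d" using dK rd pos by (intro mult_mono mult_left_mono) auto
  finally have 4: "8 * (2 * C' * r\<^sup>2) \<le> C3 * d\<^sup>2" by (simp add: power2_eq_square mult_ac)
  have "C3 * d\<^sup>2 > 0" using pos d0 by simp
  then show False using 2 3 4 by linarith
qed

locale intrinsic_characteristic = tonelli L for L :: "real^'n \<Rightarrow> real^'n \<Rightarrow> real" +
  fixes \<Omega> :: "(real^'n) set" and u :: "real^'n \<Rightarrow> real" and x :: "real^'n" and y :: "real \<Rightarrow> real^'n"
    and Lip C2 C3 lam t0 t_lam :: real
  assumes lip: "Lip-lipschitz_on (closure \<Omega>) u"
    and semiconcave: "semiconcave_on \<Omega> C2 u"
    and pos: "C2 > 0" "lam > 0" "C3 > 0" "t0 > 0" "t_lam > t0"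
    and cball: "\<And>t. t \<in> {0<..t0} \<Longrightarrow> cball x (lam * t) \<subseteq> \<Omega>"
    and C2_A: "C_on 2 {(t, z). 0 < t \<and> t < t_lam \<and> norm (z - x) < lam * t} (\<lambda>(t, z). A t x z)"
    and conv: "\<And>t z z' p. t \<in> {0<..t0} \<Longrightarrow> z \<in> ball x (lam * t) \<Longrightarrow> z' \<in> ball x (lam * t) \<Longrightarrow>
           GDERIV (\<lambda>w. A t x w) z :> p \<Longrightarrow>
           A t x z' \<ge> A t x z + p \<bullet> (z' - z) + C3 / t * (norm (z' - z))\<^sup>2"
    and C23: "\<And>t. t \<in> {0<..t0} \<Longrightarrow> C2 - C3 / t < 0"
    and y0: "y 0 = x"
    and y_max: "\<And>t. t \<in> {0<..t0} \<Longrightarrow> is_arg_max (\<lambda>z. u z - A t x z) (\<lambda>z. z \<in> closure \<Omega>) (y t)"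
    and y_ball: "\<And>t. t \<in> {0<..t0} \<Longrightarrow> y t \<in> ball x (lam * t)"
begin

text \<open>The open cone with vertex \<open>(0, x)\<close>, cut off at \<open>t_lam\<close>. As
  \<open>t_lam\<close> lies beyond \<open>t0\<close>, the final time \<open>t0\<close> is interior
  and needs no one-sided derivatives.\<close>

definition "sector = {(t, z). 0 < t \<and> t < t_lam \<and> norm (z - x) < lam * t}"

lemma open_sector: "open sector"
proof -
  have "sector = {q. 0 < fst q} \<inter> {q. fst q < t_lam} \<inter> {q. norm (snd q - x) < lam * fst q}"
    by (auto simp: sector_def)
  then show ?thesis
    by (auto intro!: open_Int open_Collect_less continuous_intros)
qed

lemma sector_iff: "t \<in> {0<..t0} \<Longrightarrow> (t, z) \<in> sector \<longleftrightarrow> z \<in> ball x (lam * t)"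
  using pos by (auto simp: sector_def dist_norm norm_minus_commute)

lemma u_A_le: "t \<in> {0<..t0} \<Longrightarrow> a \<in> \<Omega> \<Longrightarrow> u a - A t x a \<le> u (y t) - A t x (y t)"
  using y_max[of t] closure_subset[of \<Omega>] by (auto simp: is_arg_max_def not_less)

lemma ball_subset: "t \<in> {0<..t0} \<Longrightarrow> ball x (lam * t) \<subseteq> cball x (lam * t0)"
proof -
  assume t: "t \<in> {0<..t0}"
  have "lam * t \<le> lam * t0" using t pos by (intro mult_left_mono) auto
  then show ?thesis by auto
qed

lemma cball_subset: "cball x (lam * t0) \<subseteq> \<Omega>"
  using cball[of t0] pos by simp

text \<open>Compare \<open>y t\<close> with the points of the segment towards \<open>a\<close>:
  semiconcavity transfers the increment of \<open>u\<close> to points close to \<open>y t\<close>,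
  where maximality replaces it by the increment of \<open>A\<close>. The point \<open>a\<close>
  ranges over the ball for \<open>t0\<close>, not for \<open>t\<close>, so that \<open>y s\<close>
  is allowed for every other time \<open>s\<close>.\<close>

lemma first_order:
  assumes t: "t \<in> {0<..t0}" and p: "GDERIV (\<lambda>w. A t x w) (y t) :> p" and a: "a \<in> cball x (lam * t0)"
  shows "u a - u (y t) \<le> p \<bullet> (a - y t) + C2 / 2 * (norm (a - y t))\<^sup>2"
proof -
  define z where "z = y t"
  have z: "z \<in> cball x (lam * t0)" using y_ball[OF t] ball_subset[OF t] by (auto simp: z_def)
  have seg: "closed_segment a z \<subseteq> cball x (lam * t0)"
    by (rule closed_segment_subset[OF a z convex_cball])
  show ?thesis
  proof (rule tendsto_le)
    show "((\<lambda>l. (A t x (z + l *\<^sub>R (a - z)) - A t x z) / l + C2 / 2 * (norm (a - z))\<^sup>2)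
        \<longlongrightarrow> p \<bullet> (a - y t) + C2 / 2 * (norm (a - y t))\<^sup>2) (at_right 0)"
      using GDERIV_imp_directional[OF p, of "a - y t"] unfolding z_def
      by (intro tendsto_add tendsto_const)
    have "\<forall>\<^sub>F l in at_right (0::real). l \<in> {0<..<1}"
      by (rule eventually_at_right_real) simp
    then show "\<forall>\<^sub>F l in at_right 0. u a - u (y t) \<le> (A t x (z + l *\<^sub>R (a - z)) - A t x z) / l + C2 / 2 * (norm (a - z))\<^sup>2"
    proof eventually_elim
      case (elim l)
      have zl: "l *\<^sub>R a + (1 - l) *\<^sub>R z = z + l *\<^sub>R (a - z)" by (simp add: algebra_simps)
      have "z + l *\<^sub>R (a - z) \<in> closed_segment a z"
        using elim unfolding zl[symmetric] closed_segment_def by (auto intro!: exI[of _ "1 - l"])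
      then have 1: "u (z + l *\<^sub>R (a - z)) - A t x (z + l *\<^sub>R (a - z)) \<le> u z - A t x z"
        using u_A_le[OF t] seg cball_subset unfolding z_def by blast
      have "l * u a + (1 - l) * u z - u (l *\<^sub>R a + (1 - l) *\<^sub>R z) \<le> C2 / 2 * l * (1 - l) * (norm (a - z))\<^sup>2"
        using semiconcave seg cball_subset elim unfolding semiconcave_on_def by (auto simp: greaterThanLessThan_iff)
      then have 2: "l * (u a - u z) \<le> u (z + l *\<^sub>R (a - z)) - u z + C2 / 2 * l * (1 - l) * (norm (a - z))\<^sup>2"
      proof -
        have "l * (u a - u z) = l * u a + (1 - l) * u z - u z" by (simp add: algebra_simps)
        then show ?thesis
          using \<open>l * u a + (1 - l) * u z - u (l *\<^sub>R a + (1 - l) *\<^sub>R z) \<le> C2 / 2 * l * (1 - l) * (norm (a - z))\<^sup>2\<close>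
          unfolding zl by linarith
      qed
      have "C2 / 2 * l * (1 - l) * (norm (a - z))\<^sup>2 \<le> C2 / 2 * l * 1 * (norm (a - z))\<^sup>2"
        using elim pos by (intro mult_right_mono mult_left_mono) auto
      then have "l * (u a - u z) \<le> (A t x (z + l *\<^sub>R (a - z)) - A t x z) + l * (C2 / 2 * (norm (a - z))\<^sup>2)"
        using 1 2 by (simp add: mult_ac)
      then show ?case
        using elim unfolding z_def[symmetric] by (simp add: field_simps)
    qed
  qed auto
qed

lemma derivatives:
  "\<exists>\<gamma> \<Gamma>. (\<forall>q\<in>sector. ((\<lambda>(t, z). A t x z) has_derivative (\<lambda>h. \<gamma> q \<bullet> h)) (at q)) \<and>
    (\<forall>q\<in>sector. (\<gamma> has_derivative \<Gamma> q) (at q)) \<and>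
    (\<forall>q\<in>sector. \<forall>v w. \<Gamma> q v \<bullet> w = \<Gamma> q w \<bullet> v) \<and>
    (\<forall>t z. (t, z) \<in> sector \<longrightarrow> GDERIV (\<lambda>w. A t x w) z :> snd (\<gamma> (t, z)))"
proof -
  obtain \<gamma> \<Gamma> where 1: "\<And>q. q \<in> sector \<Longrightarrow> ((\<lambda>(t, z). A t x z) has_derivative (\<lambda>h. \<gamma> q \<bullet> h)) (at q)"
    "\<And>q. q \<in> sector \<Longrightarrow> (\<gamma> has_derivative \<Gamma> q) (at q)"
    "\<And>q v w. q \<in> sector \<Longrightarrow> \<Gamma> q v \<bullet> w = \<Gamma> q w \<bullet> v"
    using C2_gradient[OF open_sector C2_A[folded sector_def]] by metis
  have "GDERIV (\<lambda>w. A t x w) z :> snd (\<gamma> (t, z))" if "(t, z) \<in> sector" for t z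
    by (rule GDERIV_snd[where f="\<lambda>t. A t x"]) (rule 1(1)[OF that])
  then show ?thesis using 1 by (intro exI[of _ \<gamma>] exI[of _ \<Gamma>]) blast
qed

lemma strict_maximum:
  assumes t: "t \<in> {0<..t0}" and a: "a \<in> ball x (lam * t)"
  shows "u a - A t x a + C2 / 2 * (norm (a - y t))\<^sup>2 \<le> u (y t) - A t x (y t)"
proof -
  have "(t, y t) \<in> sector" using y_ball[OF t] sector_iff[OF t] by simp
  then obtain p where p: "GDERIV (\<lambda>w. A t x w) (y t) :> p"
    using derivatives by blast
  have a': "a \<in> cball x (lam * t0)" using a ball_subset[OF t] by blast
  \<comment> \<open>Since \<open>C3 / t > C2\<close>, the convexity of \<open>A\<close> pays for the
    term with \<open>C2 / 2\<close> in \<open>first_order\<close> and leaves another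
    \<open>C2 / 2\<close> as the gap.\<close>
  have "C2 * (norm (a - y t))\<^sup>2 \<le> C3 / t * (norm (a - y t))\<^sup>2"
    using C23[OF t] by (intro mult_right_mono) auto
  then show ?thesis
    using first_order[OF t p a'] conv[OF t y_ball[OF t] a p] by (simp add: field_simps)
qed

text \<open>Move from \<open>y t\<close> against \<open>p\<close>: the Lipschitz bound limits the
  decrease of \<open>u\<close> to \<open>Lip * s * norm p\<close>, while \<open>first_order\<close>
  forces a decrease of about \<open>s * (norm p)\<^sup>2\<close>. The 1 added to \<open>Lip\<close>
  absorbs the quadratic term.\<close>

lemma gradient_bound:
  assumes t: "t \<in> {0<..t0}" and p: "GDERIV (\<lambda>w. A t x w) (y t) :> p"
  shows "norm p \<le> Lip + 1"
proof -
  have yb: "y t \<in> ball x (lam * t)" by (rule y_ball[OF t])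
  then obtain e where e: "e > 0" "ball (y t) e \<subseteq> ball x (lam * t)"
    using open_ball open_contains_ball by blast
  \<comment> \<open>The first bound keeps the test point in the ball, the second makes the quadratic
    term at most \<open>s * norm p\<close>.\<close>
  define s where "s = min (e / (2 * (norm p + 1))) (2 / (C2 * (norm p + 1)))"
  have np: "norm p + 1 > 0" by (simp add: add_nonneg_pos)
  have s: "s > 0" using e np pos by (simp add: s_def)
  have s1: "s * norm p < e"
  proof -
    have "s * norm p \<le> e / (2 * (norm p + 1)) * (norm p + 1)" using s by (intro mult_mono) (auto simp: s_def)
    also have "\<dots> = e / 2" using np by (simp add: field_simps)
    finally show ?thesis using e by simp
  qed
  have s2: "C2 / 2 * (s * norm p) \<le> 1"
  proof -
    have "s * norm p \<le> 2 / (C2 * (norm p + 1)) * (norm p + 1)" using s by (intro mult_mono) (auto simp: s_def)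
    also have "\<dots> = 2 / C2"
    proof -
      have "2 / (C2 * n) * n = 2 / C2" if "n \<noteq> 0" for n using that by simp
      from this[of "norm p + 1"] show ?thesis using np by linarith
    qed
    finally show ?thesis using pos by (simp add: field_simps)
  qed
  define a where "a = y t - s *\<^sub>R p"
  have "a \<in> ball (y t) e" using s1 s by (simp add: a_def dist_norm)
  then have a: "a \<in> ball x (lam * t)" using e by blast
  have in\<Omega>: "a \<in> closure \<Omega>" "y t \<in> closure \<Omega>"
    using a yb ball_subset[OF t] cball_subset closure_subset by blast+
  have "\<bar>u a - u (y t)\<bar> \<le> Lip * (s * norm p)"
    using lipschitz_onD[OF lip in\<Omega>] s by (simp add: a_def dist_norm)
  moreover have "u a - u (y t) \<le> p \<bullet> (a - y t) + C2 / 2 * (norm (a - y t))\<^sup>2"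
    by (rule first_order[OF t p]) (use a ball_subset[OF t] in blast)
  moreover have "p \<bullet> (a - y t) = - ((s * norm p) * norm p)"
    by (simp add: a_def power2_norm_eq_inner[symmetric] power2_eq_square)
  moreover have "C2 / 2 * (norm (a - y t))\<^sup>2 \<le> s * norm p"
  proof -
    have "C2 / 2 * (norm (a - y t))\<^sup>2 = (C2 / 2 * (s * norm p)) * (s * norm p)"
      using s by (simp add: a_def power2_eq_square)
    also have "\<dots> \<le> 1 * (s * norm p)" using s2 s by (intro mult_right_mono) auto
    finally show ?thesis by simp
  qed
  ultimately have "(s * norm p) * norm p \<le> (s * norm p) * (Lip + 1)" by (simp add: algebra_simps)
  then show ?thesis
    using s lipschitz_on_nonneg[OF lip] by (cases "p = 0") auto
qed


lemma hessian_time_le: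
  assumes D: "\<And>q. q \<in> sector \<Longrightarrow> ((\<lambda>(t, z). A t x z) has_derivative (\<lambda>h. \<gamma> q \<bullet> h)) (at q)"
    and D2: "\<And>q. q \<in> sector \<Longrightarrow> (\<gamma> has_derivative \<Gamma> q) (at q)"
    and tz: "(t, z) \<in> sector"
    and C: "\<And>h. \<bar>h\<bar> \<le> t / 4 \<Longrightarrow> A (t + h) x z + A (t - h) x z - 2 * A t x z \<le> C * h\<^sup>2 / t"
  shows "\<Gamma> (t, z) (1, 0) \<bullet> (1, 0) \<le> C / t"
proof (rule field_le_epsilon)
  fix e :: real assume e: "e > 0"
  have t: "t > 0" using tz by (simp add: sector_def)
  \<comment> \<open>With \<open>w = - v\<close> the mixed second difference becomes the symmetric
    second difference in time with the opposite sign.\<close>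
  define v :: "real \<times> (real^'n)" where "v = (1, 0)"
  define f where "f = (\<lambda>(t, z). A t x z)"
  obtain s0 where s0: "s0 > 0" "\<And>s. 0 < s \<Longrightarrow> s < s0 \<Longrightarrow>
    \<bar>f ((t, z) + s *\<^sub>R v + s *\<^sub>R (- v)) - f ((t, z) + s *\<^sub>R v) - f ((t, z) + s *\<^sub>R (- v)) + f (t, z)
      - s\<^sup>2 * (\<Gamma> (t, z) (- v) \<bullet> v)\<bar> \<le> e * s\<^sup>2"
    using second_difference_estimate[OF open_sector tz D[folded f_def] D2[OF tz] e, where v=v and w="- v"] by blast
  define s where "s = min (s0 / 2) (t / 4)"
  have s: "0 < s" "s < s0" "\<bar>s\<bar> \<le> t / 4" using s0 t by (auto simp: s_def)
  have lin: "linear (\<Gamma> (t, z))" using D2[OF tz] has_derivative_linear by blast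
  have "\<Gamma> (t, z) (- v) \<bullet> v = - (\<Gamma> (t, z) v \<bullet> v)"
    using lin by (simp add: linear_neg)
  moreover have "f ((t, z) + s *\<^sub>R v) = A (t + s) x z" "f ((t, z) + s *\<^sub>R (- v)) = A (t - s) x z"
    "f ((t, z) + s *\<^sub>R v + s *\<^sub>R (- v)) = A t x z" "f (t, z) = A t x z"
    by (simp_all add: f_def v_def)
  ultimately have "s\<^sup>2 * (\<Gamma> (t, z) v \<bullet> v) \<le> A (t + s) x z + A (t - s) x z - 2 * A t x z + e * s\<^sup>2"
    using s0(2)[OF s(1,2)] by (simp add: abs_le_iff)
  also have "\<dots> \<le> s\<^sup>2 * (C / t + e)"
    using C[OF s(3)] by (simp add: algebra_simps)
  finally show "\<Gamma> (t, z) (1, 0) \<bullet> (1, 0) \<le> C / t + e"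
    using s(1) by (simp add: v_def)
qed

text \<open>The order of the quantifiers is the point: \<open>d\<close> comes from differentiability
  at \<open>(t, y t)\<close> and may degenerate as \<open>t\<close> tends to 0, while
  \<open>K\<close> is fixed beforehand from bounds that are uniform on the cone.\<close>

lemma y_pointwise_Lipschitz:
  obtains K where "K \<ge> 0" "\<And>t. t \<in> {0<..t0} \<Longrightarrow>
    \<exists>d>0. \<forall>s\<in>{0<..t0}. \<bar>s - t\<bar> < d \<longrightarrow> norm (y s - y t) \<le> K * \<bar>s - t\<bar>"
proof -
  \<comment> \<open>Large enough for the positions (\<open>norm x + lam * t0\<close>) and for the
    slope \<open>lam\<close> of the cone at once.\<close>
  define R where "R = norm x + lam + lam * t0"
  have R: "R \<ge> 0" "norm x \<le> R" "lam \<le> R" using pos by (auto simp: R_def)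
  obtain \<gamma> \<Gamma> where D':
    "\<forall>q\<in>sector. ((\<lambda>(t, z). A t x z) has_derivative (\<lambda>h. \<gamma> q \<bullet> h)) (at q)"
    "\<forall>q\<in>sector. (\<gamma> has_derivative \<Gamma> q) (at q)"
    "\<forall>q\<in>sector. \<forall>v w. \<Gamma> q v \<bullet> w = \<Gamma> q w \<bullet> v"
    "\<forall>t z. (t, z) \<in> sector \<longrightarrow> GDERIV (\<lambda>w. A t x w) z :> snd (\<gamma> (t, z))"
    using derivatives by blast
  note D = D'(1)[rule_format] D'(2)[rule_format] D'(3)[rule_format] D'(4)[rule_format]
  obtain W where W: "W \<ge> 0" "\<And>z p. norm z \<le> R \<Longrightarrow> norm p \<le> Lip + 1 \<Longrightarrow> \<exists>V. norm V \<le> W \<and> Lv z V = p"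
    using exists_velocity[of R "Lip + 1"] by metis
  obtain B where B: "B \<ge> 0" "\<And>x v. norm x \<le> max R W \<Longrightarrow> norm v \<le> max R W \<Longrightarrow> norm (Lx x v) \<le> B"
    using local_bounds[of "max R W"] by metis
  obtain C where C: "C \<ge> 0" "\<And>x z t h. norm x \<le> R \<Longrightarrow> 0 < t \<Longrightarrow> t \<le> t0 \<Longrightarrow> norm (z - x) \<le> R * t \<Longrightarrow>
    \<bar>h\<bar> \<le> t / 4 \<Longrightarrow> A (t + h) x z + A (t - h) x z - 2 * A t x z \<le> C * h\<^sup>2 / t"
    using fundamental_solution_time_semiconcave[OF R(1) pos(4)] by metis
  \<comment> \<open>\<open>D(V, V)\<close> is the second time derivative plus
    \<open>Lx z V \<bullet> V\<close>, hence at most \<open>C / t + B * W\<close>; for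
    \<open>t \<le> t0\<close> the last term is at most \<open>B * W * t0 / t\<close>.\<close>
  define C' where "C' = C + B * W * t0"
  have C': "C' \<ge> 0" using C B W pos by (simp add: C'_def)
  define K where "K = 1 + 8 * t0 * (B + 1) / C3 + 16 * C' / C3"
  have K: "K \<ge> 0" using pos B C' by (simp add: K_def)
  have conv': "A s x b \<ge> A s x a + snd (\<gamma> (s, a)) \<bullet> (b - a) + C3 / s * (norm (b - a))\<^sup>2"
    if "s \<in> {0<..t0}" "(s, a) \<in> sector" "(s, b) \<in> sector" for s a b
    using conv[OF that(1), of a b] D(4)[OF that(2)] that sector_iff by blast
  \<comment> \<open>Adding \<open>conv'\<close> for both orders of \<open>a\<close> and
    \<open>b\<close> gives strong monotonicity of the gradient, which passes to the Hessian in
    \<open>Dz_lower\<close>.\<close>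
  have mono: "2 * C3 / s * (norm (b - a))\<^sup>2 \<le> (snd (\<gamma> (s, b)) - snd (\<gamma> (s, a))) \<bullet> (b - a)"
    if "s \<in> {0<..t0}" "(s, a) \<in> sector" "(s, b) \<in> sector" for s a b
    using conv'[OF that(1,2,3)] conv'[OF that(1,3,2)]
    by (simp add: inner_diff_left inner_diff_right norm_minus_commute)
  have "\<exists>d>0. \<forall>s\<in>{0<..t0}. \<bar>s - t\<bar> < d \<longrightarrow> norm (y s - y t) \<le> K * \<bar>s - t\<bar>"
    if t: "t \<in> {0<..t0}" for t
  proof -
    have t': "0 < t" "t \<le> t0" using t by auto
    define z where "z = y t"
    have zb: "z \<in> ball x (lam * t)" using y_ball[OF t] by (simp add: z_def)
    have tz: "(t, z) \<in> sector" using zb sector_iff[OF t] by simp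
    define p where "p = snd (\<gamma> (t, z))"
    have p: "GDERIV (\<lambda>w. A t x w) (y t) :> p" using D(4)[OF tz] by (simp add: p_def z_def)
    have zx: "norm (z - x) \<le> lam * t" using zb by (simp add: dist_norm norm_minus_commute)
    have "lam * t \<le> lam * t0" using t pos by (intro mult_left_mono) auto
    moreover have "norm z \<le> norm x + norm (z - x)" using norm_triangle_ineq[of x "z - x"] by simp
    ultimately have zR: "norm z \<le> R" using zx pos unfolding R_def by linarith
    obtain V where V: "norm V \<le> W" "Lv z V = p"
      using W(2)[OF zR gradient_bound[OF t p]] by blast
    define l where "l = Lx z V"
    have l: "norm l \<le> B" unfolding l_def by (rule B(2)) (use zR V in auto)
    define G where "G = \<Gamma> (t, z)"
    have lin: "linear G" using D(2)[OF tz] has_derivative_linear unfolding G_def by blast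
    have sym: "G v \<bullet> w = G w \<bullet> v" for v w unfolding G_def by (rule D(3)[OF tz])
    have char: "G (1, V) = (0, l)"
      unfolding G_def l_def
    proof (rule fundamental_solution_characteristic[OF open_sector _ D(1,2,3) tz])
      show "s > 0" if "(s, q) \<in> sector" for s q using that by (simp add: sector_def)
      show "A s x a + snd (\<gamma> (s, a)) \<bullet> (b - a) \<le> A s x b" if "(s, a) \<in> sector" "(s, b) \<in> sector" "s \<le> t" for s a b
      proof -
        have s: "s \<in> {0<..t0}" using that t by (auto simp: sector_def)
        have "0 \<le> C3 / s * (norm (b - a))\<^sup>2" using s pos by simp
        then show ?thesis using conv'[OF s that(1,2)] by linarith
      qed
    qed (use V p_def in auto)
    \<comment> \<open>The Hessian form in the space variables at \<open>(t, z)\<close>.\<close>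
    define Dz where "Dz h k = G (0, h) \<bullet> (0, k)" for h k
    have Dz_sym: "Dz h k = Dz k h" for h k unfolding Dz_def by (rule sym)
    have G_split: "G (r, h) = r *\<^sub>R G (1, 0) + G (0, h)" for r h
    proof -
      have "(r, h) = r *\<^sub>R (1, 0) + (0, h)" by simp
      then show ?thesis using lin by (metis linear_add linear_scale)
    qed
    have G_lin: "G (0, h + k) = G (0, h) + G (0, k)" "G (0, r *\<^sub>R h) = r *\<^sub>R G (0, h)" for h k r
    proof -
      have "(0::real, h + k) = (0, h) + (0, k)" "(0::real, r *\<^sub>R h) = r *\<^sub>R (0, h)" by auto
      then show "G (0, h + k) = G (0, h) + G (0, k)" "G (0, r *\<^sub>R h) = r *\<^sub>R G (0, h)"
        using lin by (metis linear_add, metis linear_scale)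
    qed
    \<comment> \<open>Both components at once: in space \<open>F_tz = l - D V\<close>, in time
      \<open>F_tt = - F_tz \<bullet> V\<close>.\<close>
    have G10: "G (1, 0) = (0, l) - G (0, V)" using char G_split[of 1 V] by (simp add: eq_diff_eq)
    have Dz_lower: "2 * C3 / t * (norm h)\<^sup>2 \<le> Dz h h" for h
    proof -
      have "GDERIV (\<lambda>w. snd (\<gamma> (t, w)) \<bullet> h) z :> snd (G (0, h))"
      proof -
        have pair: "((\<lambda>z. (t, z)) has_derivative (\<lambda>k. (0, k))) (at z)"
          by (auto intro!: derivative_eq_intros)
        have "((\<lambda>w. \<gamma> (t, w)) has_derivative (\<lambda>k. G (0, k))) (at z)"
          unfolding G_def by (rule has_derivative_compose[where g=\<gamma>, OF pair D(2)[OF tz]])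
        then have "((\<lambda>w. snd (\<gamma> (t, w)) \<bullet> h) has_derivative (\<lambda>k. snd (G (0, k)) \<bullet> h)) (at z)"
          by (intro has_derivative_inner_left has_derivative_snd)
        moreover have "snd (G (0, k)) \<bullet> h = k \<bullet> snd (G (0, h))" for k
          using sym[of "(0, k)" "(0, h)"] by (simp add: inner_prod_def inner_commute)
        ultimately show ?thesis by (simp add: gderiv_def)
      qed
      from GDERIV_imp_directional[OF this, of h]
      have lim: "((\<lambda>r. (snd (\<gamma> (t, z + r *\<^sub>R h)) \<bullet> h - snd (\<gamma> (t, z)) \<bullet> h) / r) \<longlongrightarrow> Dz h h) (at_right 0)"
        by (simp add: Dz_def inner_prod_def)
      show ?thesis
      proof (rule tendsto_lowerbound[OF lim])
        obtain e where e: "e > 0" "ball z e \<subseteq> ball x (lam * t)"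
          using zb open_ball open_contains_ball by blast
        have "\<forall>\<^sub>F r in at_right (0::real). r \<in> {0<..<e / (norm h + 1)}"
          by (rule eventually_at_right_real) (use e in \<open>simp add: add_nonneg_pos\<close>)
        then show "\<forall>\<^sub>F r in at_right 0. 2 * C3 / t * (norm h)\<^sup>2 \<le> (snd (\<gamma> (t, z + r *\<^sub>R h)) \<bullet> h - snd (\<gamma> (t, z)) \<bullet> h) / r"
        proof eventually_elim
          case (elim r)
          have "r * norm h \<le> r * (norm h + 1)" using elim by (intro mult_left_mono) auto
          also have "\<dots> < e" using elim by (simp add: pos_less_divide_eq add_nonneg_pos)
          finally have "z + r *\<^sub>R h \<in> ball z e" using elim by (simp add: dist_norm)
          then have "(t, z + r *\<^sub>R h) \<in> sector" using e sector_iff[OF t] by blast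
          from mono[OF t tz this]
          have "r * (r * (2 * C3 / t * (norm h)\<^sup>2)) \<le> r * (snd (\<gamma> (t, z + r *\<^sub>R h)) \<bullet> h - snd (\<gamma> (t, z)) \<bullet> h)"
            using elim by (simp add: inner_diff_left power2_eq_square mult_ac)
          then have "r * (2 * C3 / t * (norm h)\<^sup>2) \<le> snd (\<gamma> (t, z + r *\<^sub>R h)) \<bullet> h - snd (\<gamma> (t, z)) \<bullet> h"
            by (rule mult_left_le_imp_le) (use elim in simp)
          moreover have "0 < r" using elim by simp
          ultimately show ?case
            by (subst pos_le_divide_eq) (simp_all only: mult.commute[of _ r])
        qed
      qed simp
    qed
    have DVV: "Dz V V \<le> C' / t"
    proof -
      have "G (1, 0) \<bullet> (1, 0) \<le> C / t"
        unfolding G_def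
      proof (rule hessian_time_le[OF D(1,2) tz])
        fix h assume "\<bar>h\<bar> \<le> t / 4"
        moreover have "norm (z - x) \<le> R * t"
          using zx R t' by (meson less_imp_le mult_right_mono order.trans)
        ultimately show "A (t + h) x z + A (t - h) x z - 2 * A t x z \<le> C * h\<^sup>2 / t"
          using C(2) R t' by blast
      qed auto
      moreover have "G (1, 0) \<bullet> (1, 0) = Dz V V - l \<bullet> V"
      proof -
        have "G (1, 0) \<bullet> (1, 0) = - (G (0, V) \<bullet> (1, 0))" by (subst G10) (simp add: inner_diff_left)
        also have "G (0, V) \<bullet> (1, 0) = G (1, 0) \<bullet> (0, V)" by (rule sym)
        also have "\<dots> = l \<bullet> V - Dz V V" by (simp add: G10 inner_diff_left Dz_def)
        finally show ?thesis by simp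
      qed
      moreover have "l \<bullet> V \<le> B * W"
        using norm_cauchy_schwarz[of l V] mult_mono[OF l V(1) B(1)] by simp
      moreover have "B * W \<le> B * W * t0 / t"
      proof -
        have "B * W * t \<le> B * W * t0" using t' B W by (intro mult_left_mono) auto
        then show ?thesis using t' by (simp add: pos_le_divide_eq)
      qed
      ultimately show ?thesis by (simp add: C'_def add_divide_distrib)
    qed
    obtain e where e: "e > 0" "ball (t, z) e \<subseteq> sector" using open_sector tz openE by blast
    obtain c d1 where c: "c \<ge> 0" "d1 > 0" "\<And>q. norm (q - (t, z)) < d1 \<Longrightarrow> norm (\<gamma> q - \<gamma> (t, z)) \<le> c * norm (q - (t, z))"
      using differentiable_imp_locally_Lipschitz_at[OF D(2)[OF tz]] by blast
    \<comment> \<open>The error of the expansion only has to be absorbed by the convexity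
      \<open>C3 / t\<close>, so a fixed size of \<open>e0\<close> is enough.\<close>
    define e0 where "e0 = min 1 (C3 / (4 * t0))"
    have e0: "e0 > 0" using pos by (simp add: e0_def)
    obtain d2 where d2: "d2 > 0" "\<And>q. norm (q - (t, z)) < d2 \<Longrightarrow> norm (\<gamma> q - \<gamma> (t, z) - G (q - (t, z))) \<le> e0 * norm (q - (t, z))"
      using D(2)[OF tz] e0 unfolding has_derivative_at_alt G_def by blast
    \<comment> \<open>A crude Lipschitz constant, built from the local constant \<open>c\<close> of
      the gradient at \<open>(t, z)\<close> and so dependent on \<open>t\<close>. It merely ensures
      that \<open>(s, y s)\<close> falls within \<open>d2\<close> of \<open>(t, z)\<close>.\<close>
    define M where "M = c * t0 / C3"
    have M: "M \<ge> 0" using c pos by (simp add: M_def)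
    define d where "d = min (min e d1) (d2 / (1 + M))"
    have d: "d > 0" using e c d2 M by (simp add: d_def)
    have "norm (y s - y t) \<le> K * \<bar>s - t\<bar>" if s: "s \<in> {0<..t0}" and st: "\<bar>s - t\<bar> < d" for s
    proof -
      define r where "r = s - t"
      define \<Delta> where "\<Delta> = y s - z"
      have yb: "y s \<in> ball x (lam * s)" by (rule y_ball[OF s])
      have sy: "(s, y s) \<in> sector" using yb sector_iff[OF s] by simp
      have nsz: "norm ((s, z) - (t, z)) = \<bar>r\<bar>" by (simp add: norm_Pair r_def)
      have "(s, z) \<in> ball (t, z) e"
        unfolding mem_ball dist_norm norm_minus_commute[of "(t, z)"] nsz using st by (simp add: d_def r_def)
      then have sz: "(s, z) \<in> sector" using e by blast
      define p' where "p' = snd (\<gamma> (s, y s))"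
      have p': "GDERIV (\<lambda>w. A s x w) (y s) :> p'" using D(4)[OF sy] by (simp add: p'_def)
      have "u (y s) - u (y t) \<le> p \<bullet> (y s - y t) + C2 / 2 * (norm (y s - y t))\<^sup>2"
        by (rule first_order[OF t p]) (use yb ball_subset[OF s] in blast)
      moreover have "u (y t) - u (y s) \<le> p' \<bullet> (y t - y s) + C2 / 2 * (norm (y t - y s))\<^sup>2"
        by (rule first_order[OF s p']) (use y_ball[OF t] ball_subset[OF t] in blast)
      ultimately have up: "(p' - p) \<bullet> \<Delta> \<le> C2 * (norm \<Delta>)\<^sup>2"
        by (simp add: \<Delta>_def z_def inner_diff_left inner_diff_right norm_minus_commute)
      have "norm \<Delta> \<le> M * \<bar>r\<bar>"
      proof -
        define w where "w = snd (\<gamma> (s, z)) - p"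
        have "norm w \<le> norm (\<gamma> (s, z) - \<gamma> (t, z))"
          unfolding w_def p_def snd_diff[symmetric] by (metis norm_snd_le prod.collapse)
        also have "\<dots> \<le> c * \<bar>r\<bar>"
          using c(3)[of "(s, z)"] st unfolding nsz by (simp add: d_def r_def)
        finally have w: "norm w \<le> c * \<bar>r\<bar>" .
        have "2 * C3 / s * (norm \<Delta>)\<^sup>2 \<le> (p' - p) \<bullet> \<Delta> - w \<bullet> \<Delta>"
          using mono[OF s sz sy] unfolding p'_def \<Delta>_def w_def by (simp add: inner_diff_left)
        moreover have "- (w \<bullet> \<Delta>) \<le> c * \<bar>r\<bar> * norm \<Delta>"
          using Cauchy_Schwarz_ineq2[of w \<Delta>] mult_right_mono[OF w, of "norm \<Delta>"] by simp
        moreover have "C2 * (norm \<Delta>)\<^sup>2 \<le> C3 / s * (norm \<Delta>)\<^sup>2"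
          using C23[OF s] by (intro mult_right_mono) auto
        ultimately have "C3 / s * (norm \<Delta>)\<^sup>2 \<le> c * \<bar>r\<bar> * norm \<Delta>" using up by simp
        moreover have "C3 / t0 * (norm \<Delta>)\<^sup>2 \<le> C3 / s * (norm \<Delta>)\<^sup>2"
          using s pos by (intro mult_right_mono divide_left_mono) auto
        ultimately have "(C3 / t0 * norm \<Delta>) * norm \<Delta> \<le> (c * \<bar>r\<bar>) * norm \<Delta>" by (simp add: power2_eq_square)
        have "C3 / t0 * norm \<Delta> \<le> c * \<bar>r\<bar>"
        proof (cases "\<Delta> = 0")
          case False
          then show ?thesis
            using mult_right_le_imp_le[OF \<open>(C3 / t0 * norm \<Delta>) * norm \<Delta> \<le> (c * \<bar>r\<bar>) * norm \<Delta>\<close>] by simp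
        qed (use c(1) in simp)
        then show ?thesis using pos by (simp add: M_def field_simps)
      qed
      have nq: "norm ((s, y s) - (t, z)) \<le> \<bar>r\<bar> + norm \<Delta>"
        using norm_Pair_le[of r \<Delta>] by (simp add: r_def \<Delta>_def)
      also have "\<dots> \<le> (1 + M) * \<bar>r\<bar>" using \<open>norm \<Delta> \<le> M * \<bar>r\<bar>\<close> by (simp add: algebra_simps)
      also have "\<dots> < d2" using st M by (simp add: d_def r_def pos_less_divide_eq mult.commute)
      finally have "norm (\<gamma> (s, y s) - \<gamma> (t, z) - G ((s, y s) - (t, z))) \<le> e0 * norm ((s, y s) - (t, z))"
        by (rule d2(2))
      also have "\<dots> \<le> e0 * (\<bar>r\<bar> + norm \<Delta>)" using nq e0 by simp
      finally have err: "norm (\<gamma> (s, y s) - \<gamma> (t, z) - G (r, \<Delta>)) \<le> e0 * (\<bar>r\<bar> + norm \<Delta>)"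
        by (simp add: r_def \<Delta>_def)
      have "\<bar>(\<gamma> (s, y s) - \<gamma> (t, z) - G (r, \<Delta>)) \<bullet> (0, \<Delta>)\<bar> \<le> norm (\<gamma> (s, y s) - \<gamma> (t, z) - G (r, \<Delta>)) * norm (0::real, \<Delta>)"
        by (rule Cauchy_Schwarz_ineq2)
      also have "\<dots> \<le> e0 * (\<bar>r\<bar> + norm \<Delta>) * norm \<Delta>" using err by (simp add: mult_right_mono)
      finally have "G (r, \<Delta>) \<bullet> (0, \<Delta>) \<le> (\<gamma> (s, y s) - \<gamma> (t, z)) \<bullet> (0, \<Delta>) + e0 * (\<bar>r\<bar> + norm \<Delta>) * norm \<Delta>"
        by (simp add: inner_diff_left)
      also have "(\<gamma> (s, y s) - \<gamma> (t, z)) \<bullet> (0, \<Delta>) = (p' - p) \<bullet> \<Delta>"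
        by (simp add: inner_prod_def p'_def p_def)
      also have "G (r, \<Delta>) \<bullet> (0, \<Delta>) = r * (l \<bullet> \<Delta>) - r * Dz V \<Delta> + Dz \<Delta> \<Delta>"
        unfolding G_split[of r \<Delta>] G10 Dz_def by (simp add: inner_add_left inner_diff_left algebra_simps)
      finally have 1: "Dz \<Delta> \<Delta> \<le> C2 * (norm \<Delta>)\<^sup>2 - r * (l \<bullet> \<Delta>) + r * Dz V \<Delta> + e0 * (\<bar>r\<bar> + norm \<Delta>) * norm \<Delta>"
        using up by simp
      have 2: "- (r * (l \<bullet> \<Delta>)) \<le> \<bar>r\<bar> * (B * norm \<Delta>)"
      proof -
        have "- (r * (l \<bullet> \<Delta>)) \<le> \<bar>r\<bar> * \<bar>l \<bullet> \<Delta>\<bar>" unfolding abs_mult[symmetric] by simp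
        also have "\<dots> \<le> \<bar>r\<bar> * (B * norm \<Delta>)"
          using Cauchy_Schwarz_ineq2[of l \<Delta>] mult_right_mono[OF l, of "norm \<Delta>"] by (intro mult_left_mono) auto
        finally show ?thesis .
      qed
      have 3: "r * Dz V \<Delta> \<le> Dz \<Delta> \<Delta> / 8 + 2 * r\<^sup>2 * (C' / t)"
      proof -
        \<comment> \<open>Weighted Cauchy-Schwarz for \<open>Dz\<close>: positivity at
          \<open>\<Delta> - 4 r V\<close> leaves an eighth of \<open>Dz \<Delta> \<Delta>\<close>, a
          share that \<open>quadratic_estimate\<close> can absorb.\<close>
        define k where "k = \<Delta> + (- (4 * r)) *\<^sub>R V"
        have "0 \<le> 2 * C3 / t * (norm k)\<^sup>2" using pos t' by simp
        also have "\<dots> \<le> Dz k k" by (rule Dz_lower)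
        also have "Dz k k = Dz \<Delta> \<Delta> - 4 * r * Dz \<Delta> V - 4 * r * Dz V \<Delta> + 16 * r\<^sup>2 * Dz V V"
        proof -
          have "(0::real, k) = (0, \<Delta>) + (- (4 * r)) *\<^sub>R (0, V)" by (simp add: k_def)
          moreover have "G (0, k) = G (0, \<Delta>) + (- (4 * r)) *\<^sub>R G (0, V)" unfolding k_def G_lin ..
          ultimately show ?thesis
            unfolding Dz_def by (simp only: inner_add_left inner_add_right inner_scaleR_left inner_scaleR_right)
              (simp add: power2_eq_square algebra_simps)
        qed
        finally have "8 * (r * Dz V \<Delta>) \<le> Dz \<Delta> \<Delta> + 16 * r\<^sup>2 * Dz V V"
          using Dz_sym[of \<Delta> V] by simp
        moreover have "16 * r\<^sup>2 * Dz V V \<le> 16 * r\<^sup>2 * (C' / t)" using DVV by (intro mult_left_mono) auto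
        ultimately show ?thesis by simp
      qed
      have "norm \<Delta> \<le> K * \<bar>r\<bar>"
        unfolding K_def
      proof (rule quadratic_estimate)
        show "Dz \<Delta> \<Delta> \<le> C2 * (norm \<Delta>)\<^sup>2 + \<bar>r\<bar> * (B * norm \<Delta>) + (Dz \<Delta> \<Delta> / 8 + 2 * r\<^sup>2 * (C' / t)) + e0 * (\<bar>r\<bar> + norm \<Delta>) * norm \<Delta>"
          using 1 2 3 by linarith
        show "2 * C3 / t * (norm \<Delta>)\<^sup>2 \<le> Dz \<Delta> \<Delta>" by (rule Dz_lower)
        show "C2 < C3 / t" using C23[OF t] by simp
        show "0 \<le> e0" "e0 \<le> 1" "e0 \<le> C3 / (4 * t0)" using e0 by (auto simp: e0_def)
      qed (use t' B C' pos in auto)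
      then show ?thesis by (simp add: \<Delta>_def r_def z_def)
    qed
    then show ?thesis using d by blast
  qed
  then show thesis using that K by blast
qed

text \<open>A pointwise bound with a single constant propagates to intervals by bisection, in the
  form of the Bolzano rule. At \<open>t = 0\<close> the cone itself supplies the bound
  \<open>lam\<close>.\<close>

lemma y_Lipschitz: "\<exists>K. K-lipschitz_on {0..t0} y"
proof -
  obtain K0 where K0: "K0 \<ge> 0" "\<And>t. t \<in> {0<..t0} \<Longrightarrow>
    \<exists>d>0. \<forall>s\<in>{0<..t0}. \<bar>s - t\<bar> < d \<longrightarrow> norm (y s - y t) \<le> K0 * \<bar>s - t\<bar>"
    using y_pointwise_Lipschitz by metis
  define K where "K = max K0 lam"
  have K: "K \<ge> 0" "K0 \<le> K" "lam \<le> K" using K0 by (auto simp: K_def)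
  have local: "\<exists>d>0. \<forall>s\<in>{0..t0}. \<bar>s - t\<bar> < d \<longrightarrow> norm (y s - y t) \<le> K * \<bar>s - t\<bar>" if t: "t \<in> {0..t0}" for t
  proof (cases "t = 0")
    case True
    have "norm (y s - y t) \<le> K * \<bar>s - t\<bar>" if s: "s \<in> {0..t0}" for s
    proof (cases "s = 0")
      case False
      then have "norm (y s - x) \<le> lam * s" using y_ball[of s] s by (simp add: dist_norm norm_minus_commute)
      also have "\<dots> \<le> K * s" using K s by (intro mult_right_mono) auto
      finally show ?thesis using True y0 s by simp
    qed (use True in simp)
    then show ?thesis using zero_less_one by blast
  next
    case False
    then have t': "t \<in> {0<..t0}" using t by auto
    obtain d where d: "d > 0" "\<And>s. s \<in> {0<..t0} \<Longrightarrow> \<bar>s - t\<bar> < d \<Longrightarrow> norm (y s - y t) \<le> K0 * \<bar>s - t\<bar>"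
      using K0(2)[OF t'] by blast
    \<comment> \<open>A distance below \<open>t\<close> excludes \<open>s = 0\<close>, which
      \<open>d\<close> does not cover.\<close>
    have "norm (y s - y t) \<le> K * \<bar>s - t\<bar>" if "s \<in> {0..t0}" "\<bar>s - t\<bar> < min d t" for s
    proof -
      have "norm (y s - y t) \<le> K0 * \<bar>s - t\<bar>" using that t by (intro d(2)) auto
      also have "\<dots> \<le> K * \<bar>s - t\<bar>" using K by (intro mult_right_mono) auto
      finally show ?thesis .
    qed
    then show ?thesis using d t' by (intro exI[of _ "min d t"]) auto
  qed
  have "norm (y b - y a) \<le> K * (b - a)" if ab: "0 \<le> a" "a \<le> b" "b \<le> t0" for a b
  proof -
    have "0 \<le> a \<longrightarrow> b \<le> t0 \<longrightarrow> norm (y b - y a) \<le> K * (b - a)"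
      using ab(2)
    proof (induction rule: Bolzano)
      case (trans a b c)
      show ?case
      proof (intro impI)
        assume "0 \<le> a" "c \<le> t0"
        then have "norm (y b - y a) \<le> K * (b - a)" "norm (y c - y b) \<le> K * (c - b)" using trans by auto
        then show "norm (y c - y a) \<le> K * (c - a)"
          using norm_triangle_ineq[of "y c - y b" "y b - y a"] by (simp add: algebra_simps)
      qed
    next
      case (local t)
      then have "t \<in> {0..t0}" using ab by auto
      from \<open>\<And>t. t \<in> {0..t0} \<Longrightarrow> \<exists>d>0. \<forall>s\<in>{0..t0}. \<bar>s - t\<bar> < d \<longrightarrow> norm (y s - y t) \<le> K * \<bar>s - t\<bar>\<close>[OF this]
      obtain d where d: "d > 0" "\<And>s. s \<in> {0..t0} \<Longrightarrow> \<bar>s - t\<bar> < d \<Longrightarrow> norm (y s - y t) \<le> K * \<bar>s - t\<bar>" by blast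
      show ?case
      proof (intro exI[of _ d] conjI allI impI d(1))
        fix a' b' assume *: "a' \<le> t \<and> t \<le> b' \<and> b' - a' < d" "0 \<le> a'" "b' \<le> t0"
        have "norm (y a' - y t) \<le> K * (t - a')" using d(2)[of a'] * \<open>t \<in> {0..t0}\<close> by auto
        moreover have "norm (y b' - y t) \<le> K * (b' - t)" using d(2)[of b'] * \<open>t \<in> {0..t0}\<close> by auto
        ultimately show "norm (y b' - y a') \<le> K * (b' - a')"
          using norm_triangle_ineq4[of "y b' - y t" "y a' - y t"] by (simp add: algebra_simps)
      qed
    qed
    then show ?thesis using ab by simp
  qed note le = this
  have "K-lipschitz_on {0..t0} y"
  proof (rule lipschitz_onI)
    fix a b assume "a \<in> {0..t0}" "b \<in> {0..t0}"
    then show "dist (y a) (y b) \<le> K * dist a b"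
      using le[of a b] le[of b a] by (cases "a \<le> b") (auto simp: dist_norm norm_minus_commute)
  qed (rule K)
  then show ?thesis by blast
qed

lemma y_uniform_limit:
  assumes um: "uniform_limit (closure \<Omega>) um u sequentially"
    and ym0: "\<And>m. m \<ge> 1 \<Longrightarrow> ym m 0 = x"
    and ym: "\<And>m t. m \<ge> 1 \<Longrightarrow> t \<in> {0<..t0} \<Longrightarrow>
           is_arg_max (\<lambda>z. um m z - A t x z) (\<lambda>z. z \<in> closure \<Omega>) (ym m t)"
    and ym_ball: "\<And>m t. m \<ge> 1 \<Longrightarrow> t \<in> {0<..t0} \<Longrightarrow> ym m t \<in> ball x (lam * t)"
  shows "uniform_limit {0..t0} ym y sequentially"
  unfolding uniform_limit_iff
proof (intro allI impI)
  fix e :: real assume e: "e > 0"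
  \<comment> \<open>Passing from \<open>um m\<close> to \<open>u\<close> at two points costs
    \<open>2 * \<epsilon>\<close>; the gap in \<open>strict_maximum\<close> then gives a squared
    distance below \<open>e\<^sup>2 / 2\<close>.\<close>
  define \<epsilon> where "\<epsilon> = C2 * e\<^sup>2 / 8"
  have \<epsilon>: "\<epsilon> > 0" using e pos by (simp add: \<epsilon>_def)
  have "\<forall>\<^sub>F m in sequentially. \<forall>z\<in>closure \<Omega>. dist (um m z) (u z) < \<epsilon>"
    using um \<epsilon> unfolding uniform_limit_iff by blast
  then show "\<forall>\<^sub>F m in sequentially. \<forall>t\<in>{0..t0}. dist (ym m t) (y t) < e"
    using eventually_ge_at_top[of 1]
  proof eventually_elim
    case (elim m)
    show ?case
    proof
      fix t assume t: "t \<in> {0..t0}"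
      show "dist (ym m t) (y t) < e"
      proof (cases "t = 0")
        case True
        then show ?thesis using ym0[OF elim(2)] y0 e by simp
      next
        case False
        then have t': "t \<in> {0<..t0}" using t by auto
        define a where "a = ym m t"
        have a: "a \<in> ball x (lam * t)" using ym_ball[OF elim(2) t'] by (simp add: a_def)
        have cl: "a \<in> closure \<Omega>" "y t \<in> closure \<Omega>"
          using ym[OF elim(2) t'] y_max[OF t'] by (auto simp: is_arg_max_def a_def)
        have "um m (y t) - A t x (y t) \<le> um m a - A t x a"
          using ym[OF elim(2) t'] cl by (auto simp: is_arg_max_def a_def not_less)
        moreover have "\<bar>um m a - u a\<bar> < \<epsilon>" "\<bar>um m (y t) - u (y t)\<bar> < \<epsilon>"
          using elim(1) cl by (auto simp: dist_real_def)
        moreover have "u a - A t x a + C2 / 2 * (norm (a - y t))\<^sup>2 \<le> u (y t) - A t x (y t)"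
          by (rule strict_maximum[OF t' a])
        ultimately have "C2 / 2 * (norm (a - y t))\<^sup>2 < 2 * \<epsilon>" by linarith
        also have "\<dots> = C2 / 2 * (e\<^sup>2 / 2)" by (simp add: \<epsilon>_def)
        finally have "(norm (a - y t))\<^sup>2 < e\<^sup>2 / 2" using pos by simp
        also have "\<dots> \<le> e\<^sup>2" by simp
        finally have "norm (a - y t) < e" using e by (simp add: power_less_imp_less_base)
        then show ?thesis by (simp add: dist_norm a_def)
      qed
    qed
  qed
qed

end

section \<open>Assembly of the two conclusions\<close>

theorem theorem5p6:
  fixes \<Omega> :: "(real^'n) set"
    and L :: "real^'n \<Rightarrow> real^'n \<Rightarrow> real"
    and u :: "real^'n \<Rightarrow> real"
    and um :: "nat \<Rightarrow> real^'n \<Rightarrow> real"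
    and Dum :: "nat \<Rightarrow> real^'n \<Rightarrow> real^'n"
    and D2um :: "nat \<Rightarrow> real^'n \<Rightarrow> real^'n^'n"
    and x :: "real^'n"
    and y :: "real \<Rightarrow> real^'n"
    and ym :: "nat \<Rightarrow> real \<Rightarrow> real^'n"
    and C\<^sub>0 C\<^sub>1 C\<^sub>2 C\<^sub>3 lam t\<^sub>0 t_lam :: real
  defines "A \<equiv> fundamental_solution L"
  assumes "open \<Omega>" and "bounded \<Omega>"
    and "tonelli_lagrangian L"
    and "C\<^sub>0 > 0" and "C\<^sub>1 > 0" and "C\<^sub>2 > 0"
    \<comment> \<open>the solution u\<close>
    and "\<exists>K. K-lipschitz_on (closure \<Omega>) u"
    and "viscosity_solution (hamiltonian L) \<Omega> u"
    and "\<And>z. z \<in> closure \<Omega> \<Longrightarrow> \<bar>u z\<bar> \<le> C\<^sub>0"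
    and "\<And>z p. z \<in> \<Omega> \<Longrightarrow> GDERIV u z :> p \<Longrightarrow> norm p \<le> C\<^sub>1"
    and "semiconcave_on \<Omega> C\<^sub>2 u"
    \<comment> \<open>the approximating sequence; Dum and D2um are gradient and Hessian, up to the boundary\<close>
    and "\<And>m. m \<ge> 1 \<Longrightarrow> smooth_on_closure \<Omega> (um m)"
    and "\<And>m. m \<ge> 1 \<Longrightarrow> continuous_on (closure \<Omega>) (Dum m)"
    and "\<And>m z. m \<ge> 1 \<Longrightarrow> z \<in> \<Omega> \<Longrightarrow> GDERIV (um m) z :> Dum m z"
    and "\<And>m. m \<ge> 1 \<Longrightarrow> continuous_on (closure \<Omega>) (D2um m)"
    and "\<And>m z. m \<ge> 1 \<Longrightarrow> z \<in> \<Omega> \<Longrightarrow> (Dum m has_derivative (\<lambda>h. D2um m z *v h)) (at z)"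
    and "\<And>m z. m \<ge> 1 \<Longrightarrow> z \<in> closure \<Omega> \<Longrightarrow> \<bar>um m z\<bar> \<le> C\<^sub>0"
    and "\<And>m z. m \<ge> 1 \<Longrightarrow> z \<in> closure \<Omega> \<Longrightarrow> norm (Dum m z) \<le> C\<^sub>1"
    and "\<And>m z h. m \<ge> 1 \<Longrightarrow> z \<in> closure \<Omega> \<Longrightarrow> h \<bullet> (D2um m z *v h) \<le> C\<^sub>2 * (norm h)\<^sup>2"
    and "uniform_limit (closure \<Omega>) um u sequentially"
    and "x \<in> Sing \<Omega> u"
    \<comment> \<open>the choice of the time horizon\<close>
    and "lam > 0" and "C\<^sub>3 > 0" and "t\<^sub>0 > 0" and "t_lam > t\<^sub>0"
    and "\<And>t. t \<in> {0<..t\<^sub>0} \<Longrightarrow> cball x (lam * t) \<subseteq> \<Omega>"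
    and "C_on 2 {(t, z). 0 < t \<and> t < t_lam \<and> norm (z - x) < lam * t} (\<lambda>(t, z). A t x z)"
    and "\<And>t z z' p. t \<in> {0<..t\<^sub>0} \<Longrightarrow> z \<in> ball x (lam * t) \<Longrightarrow> z' \<in> ball x (lam * t) \<Longrightarrow>
           GDERIV (\<lambda>w. A t x w) z :> p \<Longrightarrow>
           A t x z' \<ge> A t x z + p \<bullet> (z' - z) + C\<^sub>3 / t * (norm (z' - z))\<^sup>2"
    and "\<And>t. t \<in> {0<..t\<^sub>0} \<Longrightarrow> C\<^sub>2 - C\<^sub>3 / t < 0"
    and "\<And>t. t \<in> {0<..t\<^sub>0} \<Longrightarrow>
           (\<exists>!z. is_arg_max (\<lambda>z. u z - A t x z) (\<lambda>z. z \<in> closure \<Omega>) z) \<and>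
           (\<forall>z. is_arg_max (\<lambda>z. u z - A t x z) (\<lambda>z. z \<in> closure \<Omega>) z \<longrightarrow> z \<in> ball x (lam * t))"
    and "\<And>m t. m \<ge> 1 \<Longrightarrow> t \<in> {0<..t\<^sub>0} \<Longrightarrow>
           (\<exists>!z. is_arg_max (\<lambda>z. um m z - A t x z) (\<lambda>z. z \<in> closure \<Omega>) z) \<and>
           (\<forall>z. is_arg_max (\<lambda>z. um m z - A t x z) (\<lambda>z. z \<in> closure \<Omega>) z \<longrightarrow> z \<in> ball x (lam * t))"
    \<comment> \<open>the curves\<close>
    and "y 0 = x"
    and "\<And>t. t \<in> {0<..t\<^sub>0} \<Longrightarrow> is_arg_max (\<lambda>z. u z - A t x z) (\<lambda>z. z \<in> closure \<Omega>) (y t)"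
    and "\<And>m. m \<ge> 1 \<Longrightarrow> ym m 0 = x"
    and "\<And>m t. m \<ge> 1 \<Longrightarrow> t \<in> {0<..t\<^sub>0} \<Longrightarrow>
           is_arg_max (\<lambda>z. um m z - A t x z) (\<lambda>z. z \<in> closure \<Omega>) (ym m t)"
  shows "uniform_limit {0..t\<^sub>0} ym y sequentially \<and> (\<exists>K. K-lipschitz_on {0..t\<^sub>0} y)"
proof -
  obtain K where lip: "K-lipschitz_on (closure \<Omega>) u"
    using \<open>\<exists>K. K-lipschitz_on (closure \<Omega>) u\<close> by blast
  have max: "is_arg_max (\<lambda>z. u z - A t x z) (\<lambda>z. z \<in> closure \<Omega>) (y t)" if "t \<in> {0<..t\<^sub>0}" for t
    using that by fact
  have maxm: "is_arg_max (\<lambda>z. um m z - A t x z) (\<lambda>z. z \<in> closure \<Omega>) (ym m t)" if "m \<ge> 1" "t \<in> {0<..t\<^sub>0}" for m t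
    using that by fact
  have uniq: "(\<exists>!z. is_arg_max (\<lambda>z. u z - A t x z) (\<lambda>z. z \<in> closure \<Omega>) z) \<and>
      (\<forall>z. is_arg_max (\<lambda>z. u z - A t x z) (\<lambda>z. z \<in> closure \<Omega>) z \<longrightarrow> z \<in> ball x (lam * t))"
    if "t \<in> {0<..t\<^sub>0}" for t
    using that by fact
  have uniqm: "(\<exists>!z. is_arg_max (\<lambda>z. um m z - A t x z) (\<lambda>z. z \<in> closure \<Omega>) z) \<and>
      (\<forall>z. is_arg_max (\<lambda>z. um m z - A t x z) (\<lambda>z. z \<in> closure \<Omega>) z \<longrightarrow> z \<in> ball x (lam * t))"
    if "m \<ge> 1" "t \<in> {0<..t\<^sub>0}" for m t
    using that by fact
  have y_ball: "y t \<in> ball x (lam * t)" if "t \<in> {0<..t\<^sub>0}" for t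
    using uniq[OF that] max[OF that] by blast
  have ym_ball: "ym m t \<in> ball x (lam * t)" if "m \<ge> 1" "t \<in> {0<..t\<^sub>0}" for m t
    using uniqm[OF that] maxm[OF that] by blast
  \<comment> \<open>The locale is phrased with \<open>fundamental_solution L\<close>; folding
    \<open>A_def\<close> matches its assumptions with the hypotheses.\<close>
  have ic: "intrinsic_characteristic L \<Omega> u x y K C\<^sub>2 C\<^sub>3 lam t\<^sub>0 t_lam"
    by (intro intrinsic_characteristic.intro tonelli.intro intrinsic_characteristic_axioms.intro;
        (unfold A_def[symmetric])?; fact)
  show ?thesis
    using intrinsic_characteristic.y_uniform_limit[OF ic, folded A_def, of um ym]
      intrinsic_characteristic.y_Lipschitz[OF ic] maxm ym_ball
      \<open>uniform_limit (closure \<Omega>) um u sequentially\<close> \<open>\<And>m. m \<ge> 1 \<Longrightarrow> ym m 0 = x\<close>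
    by blast
qed

end
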